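(* Let $(X,d)$ be a complete and quasiconvex metric space. Let $T\in\mathbf{M}_1(X)$ be a metric $1$-current whose mass measure $\|T\|$ is inner regular by compact sets. Then there is a sequence $(T_i)_i$ of normal $1$-currents on $X$ such that $\mathbb{M}(T-T_i)\to 0$.
   Context: $X$ is quasiconvex if there is $C\in[1,\infty)$ such that any $x,y\in X$ are joined by a continuous curve of length at most $C\,d(x,y)$. Metric currents (Ambrosio–Kirchheim). $\mathrm{LIP}(f)$ is the global Lipschitz constant; $\mathrm{Lip}(X)$ the real Lipschitz functions, $\mathrm{Lip}_b(X)$ the bounded ones. A metric $1$-current on $X$ is a bilinear map $T\colon \mathrm{Lip}_b(X)\times \mathrm{Lip}(X)\to\mathbb{R}$ such that: (locality) $T(f,\pi)=0$ if $\pi$ is constant on a neighbourhood of $\{f\neq0\}$; (joint continuity) $T(f,\pi^n)\to T(f,\pi)$ whenever $\pi^n\to\pi$ pointwise and $\sup_n\mathrm{LIP}(\pi^n)<\infty$; (finite mass) there is a finite nonnegative Borel measure $\mu$ with $|T(f,\pi)|\le \mathrm{LIP}(\pi)\int|f|\,d\mu$ for all $(f,\pi)$. The minimal such $\mu$ is the mass measure $\|T\|$, and $\mathbb{M}(T):=\|T\|(X)$. $\mathbf{M}_1(X)$ is the space of metric $1$-currents. The boundary is $\partial T(f):=T(1,f)$; $T$ is normal if $\partial T$ has finite mass, i.e. there is a finite Borel measure $\nu$ with $|\partial T(f)|\le\int|f|\,d\nu$ for all $f\in\mathrm{Lip}_b(X)$. *)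

theory Defs
  imports "HOL-Analysis.Analysis"
begin

definition curve_length :: "(real \<Rightarrow> 'a::metric_space) \<Rightarrow> ennreal" where
  "curve_length g =
     (SUP ts \<in> {ts. sorted ts \<and> set ts \<subseteq> {0..1}}.
        ennreal (\<Sum>i<length ts - 1. dist (g (ts ! i)) (g (ts ! Suc i))))"

definition quasiconvex :: "'a::metric_space set \<Rightarrow> bool" where
  "quasiconvex S \<longleftrightarrow>
     (\<exists>C\<ge>1. \<forall>x\<in>S. \<forall>y\<in>S. \<exists>g.
        path g \<and> path_image g \<subseteq> S \<and> pathstart g = x \<and> pathfinish g = y \<and>
        curve_length g \<le> ennreal (C * dist x y))"

definition Lip :: "('a::metric_space \<Rightarrow> real) set" where
  "Lip = {f. \<exists>L. L-lipschitz_on UNIV f}"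

definition Lip_b :: "('a::metric_space \<Rightarrow> real) set" where
  "Lip_b = {f \<in> Lip. bounded (range f)}"

text \<open>The infimum is attained for \<open>f \<in> Lip\<close>; the value is irrelevant for other \<open>f\<close>.\<close>

definition LIP :: "('a::metric_space \<Rightarrow> real) \<Rightarrow> real" where
  "LIP f = Inf {L. L-lipschitz_on UNIV f}"

text \<open>
  A functional on \<open>Lip_b \<times> Lip\<close> is represented by a total function on pairs of real functions;
  no notion below depends on its values outside \<open>Lip_b \<times> Lip\<close>.
\<close>

type_synonym 'a functional1 = "('a \<Rightarrow> real) \<Rightarrow> ('a \<Rightarrow> real) \<Rightarrow> real"

definition finite_borel_measure :: "'a::topological_space measure \<Rightarrow> bool" where
  "finite_borel_measure \<mu> \<longleftrightarrow> sets \<mu> = sets borel \<and> finite_measure \<mu>"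

definition bilinear_Lip :: "'a::metric_space functional1 \<Rightarrow> bool" where
  "bilinear_Lip T \<longleftrightarrow>
     (\<forall>f\<in>Lip_b. \<forall>g\<in>Lip_b. \<forall>\<pi>\<in>Lip. \<forall>a b.
        T (\<lambda>x. a * f x + b * g x) \<pi> = a * T f \<pi> + b * T g \<pi>) \<and>
     (\<forall>f\<in>Lip_b. \<forall>\<pi>\<in>Lip. \<forall>\<rho>\<in>Lip. \<forall>a b.
        T f (\<lambda>x. a * \<pi> x + b * \<rho> x) = a * T f \<pi> + b * T f \<rho>)"

definition local_current :: "'a::metric_space functional1 \<Rightarrow> bool" where
  "local_current T \<longleftrightarrow>
     (\<forall>f\<in>Lip_b. \<forall>\<pi>\<in>Lip.
        (\<exists>U c. open U \<and> {x. f x \<noteq> 0} \<subseteq> U \<and> (\<forall>x\<in>U. \<pi> x = c)) \<longrightarrow> T f \<pi> = 0)"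

definition jointly_continuous :: "'a::metric_space functional1 \<Rightarrow> bool" where
  "jointly_continuous T \<longleftrightarrow>
     (\<forall>f\<in>Lip_b. \<forall>\<pi>\<in>Lip. \<forall>\<pi>s :: nat \<Rightarrow> 'a \<Rightarrow> real.
        (\<forall>n. \<pi>s n \<in> Lip) \<longrightarrow> (\<forall>x. (\<lambda>n. \<pi>s n x) \<longlonglongrightarrow> \<pi> x) \<longrightarrow>
        bdd_above (range (\<lambda>n. LIP (\<pi>s n))) \<longrightarrow>
        (\<lambda>n. T f (\<pi>s n)) \<longlonglongrightarrow> T f \<pi>)"

definition controls :: "'a::metric_space measure \<Rightarrow> 'a functional1 \<Rightarrow> bool" where
  "controls \<mu> T \<longleftrightarrow>
     (\<forall>f\<in>Lip_b. \<forall>\<pi>\<in>Lip. \<bar>T f \<pi>\<bar> \<le> LIP \<pi> * (\<integral>x. \<bar>f x\<bar> \<partial>\<mu>))"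

definition metric_current1 :: "'a::metric_space functional1 \<Rightarrow> bool" where
  "metric_current1 T \<longleftrightarrow>
     bilinear_Lip T \<and> local_current T \<and> jointly_continuous T \<and>
     (\<exists>\<mu>. finite_borel_measure \<mu> \<and> controls \<mu> T)"

text \<open>
  On measures with a common sigma-algebra, here the Borel one, the order of type \<open>measure\<close>
  is the setwise order of \<open>emeasure\<close>.
\<close>

definition mass_measure :: "'a::metric_space functional1 \<Rightarrow> 'a measure" where
  "mass_measure T = (LEAST \<mu>. finite_borel_measure \<mu> \<and> controls \<mu> T)"

definition mass :: "'a::metric_space functional1 \<Rightarrow> ennreal" where
  "mass T = emeasure (mass_measure T) UNIV"

definition boundary :: "'a functional1 \<Rightarrow> ('a \<Rightarrow> real) \<Rightarrow> real" where
  "boundary T f = T (\<lambda>_. 1) f"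

definition normal_current1 :: "'a::metric_space functional1 \<Rightarrow> bool" where
  "normal_current1 T \<longleftrightarrow>
     metric_current1 T \<and>
     (\<exists>\<nu>. finite_borel_measure \<nu> \<and> (\<forall>f\<in>Lip_b. \<bar>boundary T f\<bar> \<le> (\<integral>x. \<bar>f x\<bar> \<partial>\<nu>)))"

definition inner_regular_compact :: "'a::topological_space measure \<Rightarrow> bool" where
  "inner_regular_compact \<mu> \<longleftrightarrow>
     (\<forall>A\<in>sets borel. emeasure \<mu> A = (SUP K\<in>{K. compact K \<and> K \<subseteq> A}. emeasure \<mu> K))"

end

theory Submission
  imports Defs
begin

text \<open>
  The boundary functional \<open>F \<pi> = T 1 \<pi>\<close> of \<open>T\<close> lies in the Arens--Eells space of \<open>X\<close>: since \<open>\<parallel>T\<parallel>\<close> is nearly carried by a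
  compact set and \<open>T\<close> is jointly continuous, for each \<open>\<epsilon>\<close> there is a finite set \<open>A\<close> such that \<open>F\<close> has
  norm at most \<open>\<epsilon>\<close> on the Lipschitz functions vanishing on \<open>A\<close>. By Hahn--Banach in finite dimension
  \<open>F\<close> is then \<open>\<epsilon>\<close>-close to a finite combination of dipoles \<open>\<delta>\<^sub>x - \<delta>\<^sub>y\<close> with transport cost at most
  \<open>\<parallel>F\<parallel> + \<epsilon>\<close>. In a quasiconvex space dipoles are boundaries of curves of comparable mass, so iteration
  fills the remainder \<open>F - m\<close>, where \<open>m\<close> is a finite combination of dipoles at distance \<open>d\<close> from \<open>F\<close>, by a
  series \<open>R\<close> of curves of mass at most \<open>3 C d\<close>. Then \<open>T - R\<close> has boundary \<open>m\<close>, hence is normal, and it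
  differs from \<open>T\<close> by the small current \<open>R\<close>.
\<close>

section \<open>Lipschitz functions\<close>

text \<open>The dipole approximation controls transport cost as well as distance in norm, and this
  is what makes the iteration affordable. A residual of norm \<open>d * (1 / 2) ^ n\<close> is
  replaced by dipoles whose cost is that norm plus the new error. With the new error half of the old
  norm, stage \<open>n\<close> costs \<open>3 / 2 * C * d * (1 / 2) ^ n\<close>, and the geometric
  series gives \<open>3 * C * d\<close>.

  Joint continuity comes without a rate, so the finite set is found by contradiction, along finer
  and finer nets of the compact set.

  \<open>mass_measure\<close> is defined by \<open>LEAST\<close>, so nothing can be derived about it
  before a least controlling measure has been constructed. That construction rests on controlling
  measures being stable under minima and decreasing limits.

  Currents of curves are limits of Riemann--Stieltjes sums with an explicit rate. This avoids
  differentiating Lipschitz functions along curves and reduces joint continuity to convergence at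
  finitely many points.\<close>

lemma LIP_lipschitz:
  fixes f :: "'a::metric_space \<Rightarrow> real"
  assumes "f \<in> Lip"
  shows "(LIP f)-lipschitz_on UNIV f"
proof (rule lipschitz_onI)
  let ?S = "{L. L-lipschitz_on UNIV f}"
  have ne: "?S \<noteq> {}" using assms by (auto simp: Lip_def)
  show nonneg: "0 \<le> LIP f"
    unfolding LIP_def using ne by (intro cInf_greatest) (auto dest: lipschitz_on_nonneg)
  fix x y
  show "dist (f x) (f y) \<le> LIP f * dist x y"
  proof (cases "x = y")
    case False
    then have "dist (f x) (f y) / dist x y \<le> LIP f"
      unfolding LIP_def using ne
      by (intro cInf_greatest) (auto simp: divide_simps dest: lipschitz_onD)
    then show ?thesis using False by (simp add: field_simps)
  qed simp
qed

lemma LIP_nonneg: "f \<in> Lip \<Longrightarrow> 0 \<le> LIP f"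
  using LIP_lipschitz lipschitz_on_nonneg by blast

lemma LIP_le: "L-lipschitz_on UNIV f \<Longrightarrow> LIP f \<le> L"
  unfolding LIP_def by (rule cInf_lower) (auto intro!: bdd_belowI dest: lipschitz_on_nonneg)

lemma LipI: "L-lipschitz_on UNIV f \<Longrightarrow> f \<in> Lip"
  by (auto simp: Lip_def)

lemma Lip_const [simp]: "(\<lambda>_. c) \<in> Lip"
  by (rule LipI[OF lipschitz_on_constant])

lemma Lip_add: "f \<in> Lip \<Longrightarrow> g \<in> Lip \<Longrightarrow> (\<lambda>x. f x + g x) \<in> Lip"
  unfolding Lip_def by (blast intro: lipschitz_on_add)

lemma Lip_diff: "f \<in> Lip \<Longrightarrow> g \<in> Lip \<Longrightarrow> (\<lambda>x. f x - g x) \<in> Lip"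
  unfolding Lip_def by (blast intro: lipschitz_on_diff)

lemma Lip_cmult: "f \<in> Lip \<Longrightarrow> (\<lambda>x. c * f x) \<in> Lip"
  unfolding Lip_def by (blast intro: lipschitz_on_cmult_real)

lemma LIP_add_le: "f \<in> Lip \<Longrightarrow> g \<in> Lip \<Longrightarrow> LIP (\<lambda>x. f x + g x) \<le> LIP f + LIP g"
  by (intro LIP_le lipschitz_on_add LIP_lipschitz)

lemma LIP_diff_le: "f \<in> Lip \<Longrightarrow> g \<in> Lip \<Longrightarrow> LIP (\<lambda>x. f x - g x) \<le> LIP f + LIP g"
  by (intro LIP_le lipschitz_on_diff LIP_lipschitz)

lemma LIP_cmult_le: "f \<in> Lip \<Longrightarrow> LIP (\<lambda>x. c * f x) \<le> \<bar>c\<bar> * LIP f"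
  by (intro LIP_le lipschitz_on_cmult_real LIP_lipschitz)

lemma LipD: "f \<in> Lip \<Longrightarrow> \<bar>f x - f y\<bar> \<le> LIP f * dist x y"
  using lipschitz_onD[OF LIP_lipschitz, of f x y] by (simp add: dist_real_def)

lemma Lip_b_subset: "f \<in> Lip_b \<Longrightarrow> f \<in> Lip"
  by (simp add: Lip_b_def)

lemma Lip_bI: "f \<in> Lip \<Longrightarrow> (\<And>x. \<bar>f x\<bar> \<le> B) \<Longrightarrow> f \<in> Lip_b"
  by (auto simp: Lip_b_def bounded_iff)

lemma Lip_b_bound:
  assumes "f \<in> Lip_b"
  obtains B where "B \<ge> 0" "\<And>x. \<bar>f x\<bar> \<le> B"
proof -
  obtain B where B: "\<And>x. \<bar>f x\<bar> \<le> B" using assms by (auto simp: Lip_b_def bounded_iff)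
  show thesis by (rule that[of B]) (use order_trans[OF abs_ge_zero B] B in auto)
qed

lemma Lip_b_const [simp]: "(\<lambda>_. c) \<in> Lip_b"
  by (rule Lip_bI[where B = "\<bar>c\<bar>"]) auto

lemma Lip_b_mult:
  assumes f: "f \<in> Lip_b" and g: "g \<in> Lip_b"
  shows "(\<lambda>x. f x * g x) \<in> Lip_b"
proof -
  obtain B where B: "B \<ge> 0" "\<And>x. \<bar>f x\<bar> \<le> B" using Lip_b_bound[OF f] by metis
  obtain C where C: "C \<ge> 0" "\<And>x. \<bar>g x\<bar> \<le> C" using Lip_b_bound[OF g] by metis
  note fg = Lip_b_subset[OF f] Lip_b_subset[OF g]
  have "(B * LIP g + LIP f * C)-lipschitz_on UNIV (\<lambda>x. f x * g x)"
  proof (rule lipschitz_onI)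
    show "0 \<le> B * LIP g + LIP f * C" using B C fg by (simp add: LIP_nonneg)
    fix x y
    have "f x * g x - f y * g y = f x * (g x - g y) + (f x - f y) * g y"
      by (simp add: algebra_simps)
    then have "dist (f x * g x) (f y * g y) \<le> \<bar>f x\<bar> * \<bar>g x - g y\<bar> + \<bar>f x - f y\<bar> * \<bar>g y\<bar>"
      unfolding dist_real_def by (metis abs_mult abs_triangle_ineq)
    also have "\<dots> \<le> B * (LIP g * dist x y) + (LIP f * dist x y) * C"
      using B C fg by (intro add_mono mult_mono LipD) (auto simp: LIP_nonneg)
    finally show "dist (f x * g x) (f y * g y) \<le> (B * LIP g + LIP f * C) * dist x y"
      by (simp add: algebra_simps)
  qed
  then have "(\<lambda>x. f x * g x) \<in> Lip" by (rule LipI)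
  then show ?thesis
    by (rule Lip_bI[where B = "B * C"]) (simp add: abs_mult B C mult_mono)
qed

lemma bilinear_Lip_add_left:
  assumes "bilinear_Lip T" "f \<in> Lip_b" "g \<in> Lip_b" "\<pi> \<in> Lip"
  shows "T (\<lambda>x. f x + g x) \<pi> = T f \<pi> + T g \<pi>"
  using assms(1)[unfolded bilinear_Lip_def, THEN conjunct1, rule_format, OF assms(2-4), of 1 1] by simp

lemma bilinear_Lip_right:
  assumes "bilinear_Lip T" "f \<in> Lip_b" "\<pi> \<in> Lip" "\<rho> \<in> Lip"
  shows "T f (\<lambda>x. a * \<pi> x + b * \<rho> x) = a * T f \<pi> + b * T f \<rho>"
  using assms(1)[unfolded bilinear_Lip_def, THEN conjunct2, rule_format, OF assms(2-4)] .

text \<open>Clamping a real number is 1-Lipschitz. Clamping at small heights gives functions that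
  tend to 0 with a fixed Lipschitz constant, as joint continuity demands; subtracting the clamped
  function gives one that vanishes where the original is small, as locality demands.\<close>

lemma lipschitz_on_clamp:
  fixes f :: "'a::metric_space \<Rightarrow> real"
  assumes "L-lipschitz_on S f"
  shows "L-lipschitz_on S (\<lambda>x. max a (min b (f x)))"
proof (rule lipschitz_onI)
  show "0 \<le> L" using assms by (rule lipschitz_on_nonneg)
  fix x y assume "x \<in> S" "y \<in> S"
  then have "dist (f x) (f y) \<le> L * dist x y" using assms by (simp add: lipschitz_onD)
  moreover have "dist (max a (min b (f x))) (max a (min b (f y))) \<le> dist (f x) (f y)"
    by (auto simp: dist_real_def max_def min_def)
  ultimately show "dist (max a (min b (f x))) (max a (min b (f y))) \<le> L * dist x y" by linarith
qed

lemma Lip_borel: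
  fixes f :: "'a::metric_space \<Rightarrow> real"
  shows "f \<in> Lip \<Longrightarrow> f \<in> borel_measurable borel"
  using LIP_lipschitz by (blast intro: borel_measurable_continuous_onI lipschitz_on_continuous_on)

section \<open>Currents of Lipschitz curves\<close>

lemma sum_double: "(\<Sum>i<2 * m. u i) = (\<Sum>i<m. u (2 * i) + u (2 * i + 1))"
  for u :: "nat \<Rightarrow> 'b::comm_monoid_add"
  by (induction m) (simp_all add: add.assoc)

text \<open>Left-endpoint Riemann--Stieltjes sum for the integral of \<open>f\<close> against
  \<open>dg\<close> over \<open>{0..L}\<close>. For Lipschitz \<open>f\<close> and \<open>g\<close>
  these sums converge without any derivative of \<open>g\<close>.\<close>

definition dyadic_sum :: "(real \<Rightarrow> real) \<Rightarrow> (real \<Rightarrow> real) \<Rightarrow> real \<Rightarrow> nat \<Rightarrow> real" where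
  "dyadic_sum f g L n =
     (\<Sum>i<2 ^ n. f (real i * (L / 2 ^ n)) * (g (real (Suc i) * (L / 2 ^ n)) - g (real i * (L / 2 ^ n))))"

text \<open>Inserting the midpoint of a cell changes its term by the increment of \<open>f\<close>
  over the left half times the increment of \<open>g\<close> over the right half, at most
  \<open>(A * h) * (B * h)\<close> with \<open>h = L / 2 ^ Suc n\<close>; there are
  \<open>2 ^ n\<close> cells.\<close>

lemma dyadic_sum_step:
  assumes f: "A-lipschitz_on UNIV f" and g: "B-lipschitz_on UNIV g" and L: "0 \<le> L"
  shows "\<bar>dyadic_sum f g L (Suc n) - dyadic_sum f g L n\<bar> \<le> A * B * L\<^sup>2 / 4 / 2 ^ n"
proof -
  define h where "h = L / 2 ^ Suc n"
  have h2: "L / 2 ^ n = 2 * h" by (simp add: h_def)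
  have h0: "0 \<le> h" using L by (simp add: h_def)
  let ?p = "\<lambda>i. real (2 * i) * h" and ?q = "\<lambda>i. real (2 * i + 1) * h" and ?r = "\<lambda>i. real (2 * i + 2) * h"
  have "dyadic_sum f g L (Suc n) = (\<Sum>i<2 * 2 ^ n. f (real i * h) * (g (real (Suc i) * h) - g (real i * h)))"
    by (simp add: dyadic_sum_def h_def)
  also have "\<dots> = (\<Sum>i<2 ^ n. f (?p i) * (g (?q i) - g (?p i)) + f (?q i) * (g (?r i) - g (?q i)))"
    by (subst sum_double) (simp add: algebra_simps)
  finally have 1: "dyadic_sum f g L (Suc n) = \<dots>" .
  have 2: "dyadic_sum f g L n = (\<Sum>i<2 ^ n. f (?p i) * (g (?r i) - g (?p i)))"
    unfolding dyadic_sum_def h2 by (intro sum.cong) (simp_all add: algebra_simps)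
  have "\<bar>dyadic_sum f g L (Suc n) - dyadic_sum f g L n\<bar>
      = \<bar>\<Sum>i<2 ^ n. (f (?q i) - f (?p i)) * (g (?r i) - g (?q i))\<bar>"
    unfolding 1 2 sum_subtractf[symmetric]
    by (intro arg_cong[where f = abs] sum.cong) (simp_all add: algebra_simps)
  also have "\<dots> \<le> (\<Sum>i<(2::nat) ^ n. (A * h) * (B * h))"
  proof (rule order_trans[OF sum_abs], rule sum_mono)
    fix i
    have "\<bar>f (?q i) - f (?p i)\<bar> \<le> A * \<bar>?q i - ?p i\<bar>" "\<bar>g (?r i) - g (?q i)\<bar> \<le> B * \<bar>?r i - ?q i\<bar>"
      using lipschitz_onD[OF f, of "?q i" "?p i"] lipschitz_onD[OF g, of "?r i" "?q i"]
      by (auto simp: dist_real_def)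
    moreover have "?q i - ?p i = h" "?r i - ?q i = h" by (simp_all add: algebra_simps)
    ultimately show "\<bar>(f (?q i) - f (?p i)) * (g (?r i) - g (?q i))\<bar> \<le> (A * h) * (B * h)"
      unfolding abs_mult using h0 lipschitz_on_nonneg[OF f] by (intro mult_mono) auto
  qed
  also have "\<dots> = A * B * L\<^sup>2 / 4 / 2 ^ n"
    by (simp add: h_def power2_eq_square divide_simps)
  finally show ?thesis .
qed

text \<open>The tail of a geometric series. The explicit rate is kept because it will be uniform
  over functions with bounded Lipschitz constants.\<close>

lemma geometric_steps_limit:
  fixes u :: "nat \<Rightarrow> real"
  assumes step: "\<And>n. \<bar>u (Suc n) - u n\<bar> \<le> c / 2 ^ n"
  shows "u \<longlonglongrightarrow> lim u" and "\<bar>u n - lim u\<bar> \<le> 2 * c / 2 ^ n"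
proof -
  have c: "c \<ge> 0" using step[of 0] by simp
  \<comment> \<open>The subtracted term is the part of the geometric tail not yet used; without it
    the induction on \<open>k\<close> would not close.\<close>
  have tail: "\<bar>u (n + k) - u n\<bar> \<le> 2 * c / 2 ^ n - 2 * c / 2 ^ (n + k)" for n k
  proof (induction k)
    case (Suc k)
    have "\<bar>u (Suc (n + k)) - u n\<bar> \<le> \<bar>u (Suc (n + k)) - u (n + k)\<bar> + \<bar>u (n + k) - u n\<bar>" by linarith
    also have "\<dots> \<le> c / 2 ^ (n + k) + (2 * c / 2 ^ n - 2 * c / 2 ^ (n + k))"
      using step[of "n + k"] Suc by linarith
    also have "\<dots> = 2 * c / 2 ^ n - 2 * c / 2 ^ (n + Suc k)" by (simp add: field_simps)
    finally show ?case by simp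
  qed simp
  have tail': "\<bar>u (n + k) - u n\<bar> \<le> 2 * c / 2 ^ n" for n k
  proof -
    have "0 \<le> 2 * c / 2 ^ (n + k)" using c by simp
    then show ?thesis using tail[of n k] by linarith
  qed
  have "Cauchy u"
  proof (rule CauchyI')
    fix e :: real assume "0 < e"
    have "(\<lambda>n. 2 * c * (1 / 2) ^ n) \<longlonglongrightarrow> 2 * c * 0" by (intro tendsto_intros) auto
    then have "\<forall>\<^sub>F n in sequentially. 2 * c / 2 ^ n < e"
      using order_tendstoD(2)[of _ "0::real"] \<open>0 < e\<close> by (simp add: power_divide)
    then obtain N where N: "\<And>n. n \<ge> N \<Longrightarrow> 2 * c / 2 ^ n < e" by (auto simp: eventually_sequentially)
    show "\<exists>M. \<forall>m\<ge>M. \<forall>n>m. dist (u m) (u n) < e"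
    proof (intro exI allI impI)
      fix m n assume "m \<ge> N" "n > m"
      then show "dist (u m) (u n) < e"
        using N[of m] tail'[of m "n - m"] by (simp add: dist_real_def abs_minus_commute)
    qed
  qed
  then show lim: "u \<longlonglongrightarrow> lim u"
    using Cauchy_convergent_iff convergent_LIMSEQ_iff by blast
  have "(\<lambda>k. \<bar>u (k + n) - u n\<bar>) \<longlonglongrightarrow> \<bar>lim u - u n\<bar>"
    by (intro tendsto_intros LIMSEQ_ignore_initial_segment lim)
  then have "\<bar>lim u - u n\<bar> \<le> 2 * c / 2 ^ n"
    by (rule LIMSEQ_le_const2) (use tail'[of n] in \<open>auto simp: add.commute\<close>)
  then show "\<bar>u n - lim u\<bar> \<le> 2 * c / 2 ^ n" by (simp add: abs_minus_commute)
qed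

definition curve_current :: "(real \<Rightarrow> 'a::metric_space) \<Rightarrow> real \<Rightarrow> 'a functional1" where
  "curve_current \<gamma> L f \<pi> = lim (dyadic_sum (f \<circ> \<gamma>) (\<pi> \<circ> \<gamma>) L)"

text \<open>Its total mass is the parameter length \<open>L\<close>, which may exceed the length of
  the curve; an upper bound is enough for a controlling measure.\<close>

definition curve_measure :: "(real \<Rightarrow> 'a::metric_space) \<Rightarrow> real \<Rightarrow> 'a measure" where
  "curve_measure \<gamma> L = distr (restrict_space lborel {0..L}) borel \<gamma>"

text \<open>On a cell of length \<open>h\<close> the left endpoint value exceeds
  \<open>\<phi>\<close> by at most \<open>A * h\<close>. For fixed \<open>m * h\<close> the total
  error is of order \<open>h\<close>, so it disappears under refinement.\<close>

lemma left_riemann_sum_le: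
  fixes \<phi> :: "real \<Rightarrow> real"
  assumes \<phi>: "A-lipschitz_on UNIV \<phi>" and h: "0 \<le> h"
  shows "(\<Sum>i<m. \<phi> (real i * h)) * h \<le> integral {0..real m * h} \<phi> + real m * (A * h\<^sup>2)"
proof (induction m)
  case (Suc m)
  have int: "\<phi> integrable_on {a..b}" for a b
    using \<phi> by (intro integrable_continuous_real) (meson continuous_on_subset lipschitz_on_continuous_on subset_UNIV)
  let ?a = "real m * h" and ?b = "real (Suc m) * h"
  have ab: "?b - ?a = h" "0 \<le> ?a" "?a \<le> ?b" using h by (auto simp: algebra_simps)
  have "(\<phi> ?a - A * h) * h = integral {?a..?b} (\<lambda>_. \<phi> ?a - A * h)"
    using ab by (simp add: mult.commute)
  also have "\<dots> \<le> integral {?a..?b} \<phi>"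
  proof (rule integral_le[OF _ int])
    fix x assume x: "x \<in> {?a..?b}"
    have "\<phi> ?a - \<phi> x \<le> A * \<bar>?a - x\<bar>"
      using lipschitz_onD[OF \<phi>, of ?a x] by (simp add: dist_real_def)
    also have "\<dots> \<le> A * h" using x ab lipschitz_on_nonneg[OF \<phi>] by (intro mult_left_mono) auto
    finally show "\<phi> ?a - A * h \<le> \<phi> x" by simp
  qed auto
  finally have "\<phi> ?a * h \<le> integral {?a..?b} \<phi> + A * h\<^sup>2"
    by (simp add: algebra_simps power2_eq_square)
  moreover have "integral {0..?b} \<phi> = integral {0..?a} \<phi> + integral {?a..?b} \<phi>"
    using Henstock_Kurzweil_Integration.integral_combine[OF ab(2,3) int] by simp
  ultimately show ?case using Suc by (simp add: algebra_simps)
qed simp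

section \<open>The axioms of a metric current for a 1-Lipschitz curve\<close>

context
  fixes \<gamma> :: "real \<Rightarrow> 'a::metric_space" and L :: real
  assumes \<gamma>: "1-lipschitz_on UNIV \<gamma>" and L: "0 \<le> L"
begin

lemma lipschitz_comp_curve:
  fixes f :: "'a \<Rightarrow> real"
  assumes "f \<in> Lip"
  shows "(LIP f)-lipschitz_on UNIV (f \<circ> \<gamma>)"
  using lipschitz_on_compose[OF \<gamma>, of "LIP f" f] LIP_lipschitz[OF assms]
  by (auto intro: lipschitz_on_subset)

lemma dyadic_sum_curve:
  fixes f \<pi> :: "'a \<Rightarrow> real"
  assumes "f \<in> Lip" "\<pi> \<in> Lip"
  shows dyadic_sum_tendsto_curve_current:
      "dyadic_sum (f \<circ> \<gamma>) (\<pi> \<circ> \<gamma>) L \<longlonglongrightarrow> curve_current \<gamma> L f \<pi>"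
    and dyadic_sum_curve_current_rate:
      "\<bar>dyadic_sum (f \<circ> \<gamma>) (\<pi> \<circ> \<gamma>) L n - curve_current \<gamma> L f \<pi>\<bar> \<le> LIP f * LIP \<pi> * L\<^sup>2 / 2 / 2 ^ n"
proof -
  note step = dyadic_sum_step[OF lipschitz_comp_curve[OF assms(1)] lipschitz_comp_curve[OF assms(2)] L]
  show "dyadic_sum (f \<circ> \<gamma>) (\<pi> \<circ> \<gamma>) L \<longlonglongrightarrow> curve_current \<gamma> L f \<pi>"
    unfolding curve_current_def by (rule geometric_steps_limit(1)[OF step])
  show "\<bar>dyadic_sum (f \<circ> \<gamma>) (\<pi> \<circ> \<gamma>) L n - curve_current \<gamma> L f \<pi>\<bar> \<le> LIP f * LIP \<pi> * L\<^sup>2 / 2 / 2 ^ n"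
    using geometric_steps_limit(2)[OF step, of n] unfolding curve_current_def by (simp add: mult_ac)
qed

lemma curve_current_bilinear: "bilinear_Lip (curve_current \<gamma> L)"
  unfolding bilinear_Lip_def
proof (intro conjI ballI allI)
  fix f g \<pi> :: "'a \<Rightarrow> real" and a b
  assume "f \<in> Lip_b" "g \<in> Lip_b" and \<pi>: "\<pi> \<in> Lip"
  then have f: "f \<in> Lip" and g: "g \<in> Lip" by (auto intro: Lip_b_subset)
  have "dyadic_sum ((\<lambda>x. a * f x + b * g x) \<circ> \<gamma>) (\<pi> \<circ> \<gamma>) L
      = (\<lambda>n. a * dyadic_sum (f \<circ> \<gamma>) (\<pi> \<circ> \<gamma>) L n + b * dyadic_sum (g \<circ> \<gamma>) (\<pi> \<circ> \<gamma>) L n)"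
    by (auto simp: dyadic_sum_def sum_distrib_left sum.distrib[symmetric] algebra_simps intro!: sum.cong)
  moreover have "\<dots> \<longlonglongrightarrow> a * curve_current \<gamma> L f \<pi> + b * curve_current \<gamma> L g \<pi>"
    by (intro tendsto_intros dyadic_sum_tendsto_curve_current f g \<pi>)
  ultimately show "curve_current \<gamma> L (\<lambda>x. a * f x + b * g x) \<pi>
      = a * curve_current \<gamma> L f \<pi> + b * curve_current \<gamma> L g \<pi>"
    unfolding curve_current_def[of _ _ "\<lambda>x. a * f x + b * g x"] by (simp add: limI)
next
  fix f \<pi> \<rho> :: "'a \<Rightarrow> real" and a b
  assume "f \<in> Lip_b" and \<pi>: "\<pi> \<in> Lip" and \<rho>: "\<rho> \<in> Lip"
  then have f: "f \<in> Lip" by (auto intro: Lip_b_subset)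
  have "dyadic_sum (f \<circ> \<gamma>) ((\<lambda>x. a * \<pi> x + b * \<rho> x) \<circ> \<gamma>) L
      = (\<lambda>n. a * dyadic_sum (f \<circ> \<gamma>) (\<pi> \<circ> \<gamma>) L n + b * dyadic_sum (f \<circ> \<gamma>) (\<rho> \<circ> \<gamma>) L n)"
    by (auto simp: dyadic_sum_def sum_distrib_left sum.distrib[symmetric] algebra_simps intro!: sum.cong)
  moreover have "\<dots> \<longlonglongrightarrow> a * curve_current \<gamma> L f \<pi> + b * curve_current \<gamma> L f \<rho>"
    by (intro tendsto_intros dyadic_sum_tendsto_curve_current f \<pi> \<rho>)
  ultimately show "curve_current \<gamma> L f (\<lambda>x. a * \<pi> x + b * \<rho> x)
      = a * curve_current \<gamma> L f \<pi> + b * curve_current \<gamma> L f \<rho>"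
    unfolding curve_current_def[of _ _ _ "\<lambda>x. a * \<pi> x + b * \<rho> x"] by (simp add: limI)
qed

text \<open>If \<open>f\<close> is nonzero at both ends of a cell, both ends lie in \<open>U\<close>
  and the increment of \<open>\<pi>\<close> is 0. Otherwise \<open>f\<close> vanishes at one end,
  hence is at most \<open>LIP f * h\<close> at the other, and the term is of order
  \<open>h\<^sup>2\<close>. The \<open>2 ^ n\<close> terms therefore sum to something of order
  \<open>h\<close>, whatever the curve does between grid points.\<close>

lemma curve_current_local: "local_current (curve_current \<gamma> L)"
  unfolding local_current_def
proof (intro ballI impI; elim exE conjE)
  fix f \<pi> :: "'a \<Rightarrow> real" and U c
  assume "f \<in> Lip_b" and \<pi>: "\<pi> \<in> Lip" and fU: "{x. f x \<noteq> 0} \<subseteq> U" and c: "\<forall>x\<in>U. \<pi> x = c"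
  then have f: "f \<in> Lip" by (auto intro: Lip_b_subset)
  let ?S = "dyadic_sum (f \<circ> \<gamma>) (\<pi> \<circ> \<gamma>) L"
  have bound: "\<bar>?S n\<bar> \<le> LIP f * LIP \<pi> * L\<^sup>2 * (1 / 2) ^ n" for n
  proof -
    define h where "h = L / 2 ^ n"
    have h: "0 \<le> h" using L by (simp add: h_def)
    have "\<bar>?S n\<bar> \<le> (\<Sum>i<(2::nat) ^ n. (LIP f * h) * (LIP \<pi> * h))"
      unfolding dyadic_sum_def h_def[symmetric]
    proof (rule order_trans[OF sum_abs], rule sum_mono)
      fix i
      let ?p = "real i * h" and ?q = "real (Suc i) * h"
      have pq: "\<bar>?q - ?p\<bar> = h" using h by (simp add: algebra_simps)
      have df: "\<bar>f (\<gamma> ?p) - f (\<gamma> ?q)\<bar> \<le> LIP f * h"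
        using lipschitz_onD[OF lipschitz_comp_curve[OF f], of ?p ?q] pq
        by (simp add: dist_real_def abs_minus_commute)
      have d\<pi>: "\<bar>\<pi> (\<gamma> ?q) - \<pi> (\<gamma> ?p)\<bar> \<le> LIP \<pi> * h"
        using lipschitz_onD[OF lipschitz_comp_curve[OF \<pi>], of ?q ?p] pq by (simp add: dist_real_def)
      have "f (\<gamma> ?p) = 0 \<or> f (\<gamma> ?q) = 0 \<or> \<pi> (\<gamma> ?q) = \<pi> (\<gamma> ?p)"
        using fU c by (metis (mono_tags, lifting) mem_Collect_eq subsetD)
      then have "\<bar>f (\<gamma> ?p)\<bar> * \<bar>\<pi> (\<gamma> ?q) - \<pi> (\<gamma> ?p)\<bar> \<le> (LIP f * h) * (LIP \<pi> * h)"
        using df d\<pi> h LIP_nonneg[OF f] LIP_nonneg[OF \<pi>] by (auto intro: mult_mono)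
      then show "\<bar>(f \<circ> \<gamma>) ?p * ((\<pi> \<circ> \<gamma>) ?q - (\<pi> \<circ> \<gamma>) ?p)\<bar> \<le> (LIP f * h) * (LIP \<pi> * h)"
        by (simp add: abs_mult)
    qed
    also have "\<dots> = LIP f * LIP \<pi> * L\<^sup>2 * (1 / 2) ^ n"
      by (simp add: h_def power2_eq_square power_divide)
    finally show ?thesis .
  qed
  have "(\<lambda>n. LIP f * LIP \<pi> * L\<^sup>2 * (1 / 2) ^ n) \<longlonglongrightarrow> LIP f * LIP \<pi> * L\<^sup>2 * 0"
    by (intro tendsto_intros) auto
  then have "(\<lambda>n. LIP f * LIP \<pi> * L\<^sup>2 * (1 / 2) ^ n) \<longlonglongrightarrow> 0" by (simp only: mult_zero_right)
  then have "?S \<longlonglongrightarrow> 0"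
    by (rule Lim_null_comparison[rotated]) (simp only: real_norm_def bound always_eventually simp_thms)
  then show "curve_current \<gamma> L f \<pi> = 0"
    using dyadic_sum_tendsto_curve_current[OF f \<pi>] LIMSEQ_unique by blast
qed

text \<open>The rate of the dyadic sums depends on the second argument only through a bound for its
  Lipschitz constant, so it is uniform along the sequence. At a fixed level only finitely many
  points of the curve are involved, where pointwise convergence suffices.\<close>

lemma curve_current_jointly_continuous: "jointly_continuous (curve_current \<gamma> L)"
  unfolding jointly_continuous_def
proof (intro ballI allI impI)
  fix f \<pi> :: "'a \<Rightarrow> real" and \<pi>s
  assume "f \<in> Lip_b" and \<pi>: "\<pi> \<in> Lip" and \<pi>s: "\<forall>n. \<pi>s n \<in> Lip"
    and lim: "\<forall>x. (\<lambda>n. \<pi>s n x) \<longlonglongrightarrow> \<pi> x" and bdd: "bdd_above (range (\<lambda>n. LIP (\<pi>s n)))"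
  then have f: "f \<in> Lip" by (auto intro: Lip_b_subset)
  obtain B0 where B0: "\<And>n. LIP (\<pi>s n) \<le> B0" using bdd by (auto simp: bdd_above_def)
  \<comment> \<open>The maximum makes the rate apply to the limit \<open>\<pi>\<close> too, without
    comparing its constant to those of the sequence.\<close>
  define B where "B = max B0 (LIP \<pi>)"
  have B: "LIP (\<pi>s n) \<le> B" "LIP \<pi> \<le> B" for n using B0[of n] by (auto simp: B_def)
  define K where "K = LIP f * B * L\<^sup>2 / 2"
  let ?S = "\<lambda>k \<rho>. dyadic_sum (f \<circ> \<gamma>) (\<rho> \<circ> \<gamma>) L k"
  have rate: "\<bar>?S k \<rho> - curve_current \<gamma> L f \<rho>\<bar> \<le> K * (1 / 2) ^ k" if "\<rho> \<in> Lip" "LIP \<rho> \<le> B" for \<rho> k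
  proof -
    have "LIP f * LIP \<rho> * L\<^sup>2 / 2 / 2 ^ k \<le> K / 2 ^ k"
      unfolding K_def using that LIP_nonneg[OF f]
      by (intro divide_right_mono mult_right_mono mult_left_mono) auto
    then show ?thesis using dyadic_sum_curve_current_rate[OF f that(1), of k] by (simp add: power_divide)
  qed
  show "(\<lambda>n. curve_current \<gamma> L f (\<pi>s n)) \<longlonglongrightarrow> curve_current \<gamma> L f \<pi>"
  proof (rule LIMSEQ_I)
    fix e :: real assume e: "0 < e"
    have "(\<lambda>k. K * (1 / 2) ^ k) \<longlonglongrightarrow> K * 0" by (intro tendsto_intros) auto
    then have "\<forall>\<^sub>F k in sequentially. K * (1 / 2) ^ k < e / 3"
      using e by (intro order_tendstoD(2)[of _ "K * 0"]) auto
    then obtain k where k: "K * (1 / 2) ^ k < e / 3" by (auto simp: eventually_sequentially)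
    have "(\<lambda>n. ?S k (\<pi>s n)) \<longlonglongrightarrow> ?S k \<pi>"
      unfolding dyadic_sum_def comp_def by (intro tendsto_intros lim[rule_format])
    then obtain N where N: "\<And>n. n \<ge> N \<Longrightarrow> \<bar>?S k (\<pi>s n) - ?S k \<pi>\<bar> < e / 3"
      using LIMSEQ_D[of _ _ "e / 3"] e by fastforce
    show "\<exists>N. \<forall>n\<ge>N. norm (curve_current \<gamma> L f (\<pi>s n) - curve_current \<gamma> L f \<pi>) < e"
    proof (intro exI allI impI)
      fix n assume "n \<ge> N"
      then show "norm (curve_current \<gamma> L f (\<pi>s n) - curve_current \<gamma> L f \<pi>) < e"
        using N[of n] k rate[OF \<pi> B(2), of k] rate[OF \<pi>s[rule_format] B(1), of n k]
        unfolding real_norm_def abs_less_iff abs_le_iff by linarith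
    qed
  qed
qed

text \<open>For \<open>f = 1\<close> every dyadic sum telescopes. This is how dipoles arise as
  boundaries of curves.\<close>

lemma curve_current_one:
  assumes "\<pi> \<in> Lip"
  shows "curve_current \<gamma> L (\<lambda>_. 1) \<pi> = \<pi> (\<gamma> L) - \<pi> (\<gamma> 0)"
proof -
  have "dyadic_sum ((\<lambda>_. 1) \<circ> \<gamma>) (\<pi> \<circ> \<gamma>) L n = \<pi> (\<gamma> L) - \<pi> (\<gamma> 0)" for n
    using sum_lessThan_telescope[of "\<lambda>i. \<pi> (\<gamma> (real i * (L / 2 ^ n)))" "2 ^ n"]
    by (simp add: dyadic_sum_def comp_def)
  then have "dyadic_sum ((\<lambda>_. 1) \<circ> \<gamma>) (\<pi> \<circ> \<gamma>) L = (\<lambda>_. \<pi> (\<gamma> L) - \<pi> (\<gamma> 0))" by (rule ext)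
  then show ?thesis by (simp add: curve_current_def)
qed

lemma curve_measurable [measurable]: "\<gamma> \<in> borel_measurable borel"
  by (intro borel_measurable_continuous_onI lipschitz_on_continuous_on[OF \<gamma>])

lemma curve_measurable_restrict: "\<gamma> \<in> measurable (restrict_space lborel {0..L}) borel"
  by (intro measurable_restrict_space1) simp

lemma curve_measure_finite_borel: "finite_borel_measure (curve_measure \<gamma> L)"
  and measure_curve_measure: "measure (curve_measure \<gamma> L) UNIV = L"
proof -
  have em: "emeasure (curve_measure \<gamma> L) UNIV = ennreal L"
    unfolding curve_measure_def
    by (subst emeasure_distr[OF curve_measurable_restrict])
      (auto simp: space_restrict_space emeasure_restrict_space L)
  then show "finite_borel_measure (curve_measure \<gamma> L)"
    by (auto simp: finite_borel_measure_def curve_measure_def intro!: finite_measureI)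
  show "measure (curve_measure \<gamma> L) UNIV = L" using em L by (simp add: measure_def)
qed

lemma curve_measure_integral:
  fixes f :: "'a \<Rightarrow> real"
  assumes "f \<in> Lip"
  shows "(\<integral>x. \<bar>f x\<bar> \<partial>curve_measure \<gamma> L) = integral {0..L} (\<lambda>t. \<bar>f (\<gamma> t)\<bar>)"
proof -
  have f [measurable]: "f \<in> borel_measurable borel" by (rule Lip_borel[OF assms])
  have cont: "continuous_on {0..L} (\<lambda>t. \<bar>f (\<gamma> t)\<bar>)"
    using lipschitz_on_continuous_on[OF lipschitz_comp_curve[OF assms]]
    by (intro continuous_intros) (auto simp: comp_def intro: continuous_on_subset)
  have "(\<integral>x. \<bar>f x\<bar> \<partial>curve_measure \<gamma> L) = (\<integral>t. \<bar>f (\<gamma> t)\<bar> \<partial>restrict_space lborel {0..L})"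
    unfolding curve_measure_def by (rule integral_distr[OF curve_measurable_restrict]) simp
  also have "\<dots> = (LINT t:{0..L}|lborel. \<bar>f (\<gamma> t)\<bar>)"
    by (simp add: integral_restrict_space set_lebesgue_integral_def)
  also have "\<dots> = integral {0..L} (\<lambda>t. \<bar>f (\<gamma> t)\<bar>)"
    by (rule set_borel_integral_eq_integral(2))
      (rule borel_integrable_atLeastAtMost', rule cont)
  finally show ?thesis .
qed

text \<open>Since \<open>\<gamma>\<close> is 1-Lipschitz, an increment of
  \<open>\<pi> \<circ> \<gamma>\<close> over a cell is at most \<open>LIP \<pi> * h\<close>; what
  remains is a left Riemann sum of \<open>\<bar>f \<circ> \<gamma>\<bar>\<close>.\<close>

lemma curve_current_controls: "controls (curve_measure \<gamma> L) (curve_current \<gamma> L)"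
  unfolding controls_def
proof (intro ballI)
  fix f \<pi> :: "'a \<Rightarrow> real"
  assume "f \<in> Lip_b" and \<pi>: "\<pi> \<in> Lip"
  then have f: "f \<in> Lip" by (auto intro: Lip_b_subset)
  let ?S = "dyadic_sum (f \<circ> \<gamma>) (\<pi> \<circ> \<gamma>) L" and ?\<phi> = "\<lambda>t. \<bar>f (\<gamma> t)\<bar>"
  have \<phi>: "(LIP f)-lipschitz_on UNIV ?\<phi>"
  proof (rule lipschitz_onI[OF _ LIP_nonneg[OF f]])
    fix s t
    show "dist (?\<phi> s) (?\<phi> t) \<le> LIP f * dist s t"
      using lipschitz_onD[OF lipschitz_comp_curve[OF f], of s t] by (auto simp: dist_real_def)
  qed
  have bound: "\<bar>?S n\<bar> \<le> LIP \<pi> * (integral {0..L} ?\<phi> + LIP f * L\<^sup>2 * (1 / 2) ^ n)" for n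
  proof -
    define h where "h = L / 2 ^ n"
    have h: "0 \<le> h" "real (2 ^ n) * h = L" using L by (simp_all add: h_def)
    have "\<bar>?S n\<bar> \<le> (\<Sum>i<(2::nat) ^ n. ?\<phi> (real i * h) * (LIP \<pi> * h))"
      unfolding dyadic_sum_def h_def[symmetric]
    proof (rule order_trans[OF sum_abs], rule sum_mono)
      fix i
      let ?p = "real i * h" and ?q = "real (Suc i) * h"
      have pq: "\<bar>?q - ?p\<bar> = h" using h by (simp add: algebra_simps)
      have "\<bar>\<pi> (\<gamma> ?q) - \<pi> (\<gamma> ?p)\<bar> \<le> LIP \<pi> * h"
        using lipschitz_onD[OF lipschitz_comp_curve[OF \<pi>], of ?q ?p] pq by (simp add: dist_real_def)
      then show "\<bar>(f \<circ> \<gamma>) ?p * ((\<pi> \<circ> \<gamma>) ?q - (\<pi> \<circ> \<gamma>) ?p)\<bar> \<le> ?\<phi> ?p * (LIP \<pi> * h)"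
        by (simp add: abs_mult mult_left_mono)
    qed
    also have "\<dots> = LIP \<pi> * ((\<Sum>i<(2::nat) ^ n. ?\<phi> (real i * h)) * h)"
      by (simp add: sum_distrib_left sum_distrib_right mult_ac)
    also have "\<dots> \<le> LIP \<pi> * (integral {0..L} ?\<phi> + real (2 ^ n) * (LIP f * h\<^sup>2))"
      using left_riemann_sum_le[OF \<phi> h(1), of "2 ^ n"] LIP_nonneg[OF \<pi>]
      unfolding h(2) by (intro mult_left_mono)
    also have "real (2 ^ n) * (LIP f * h\<^sup>2) = LIP f * L\<^sup>2 * (1 / 2) ^ n"
      by (simp add: h_def power2_eq_square power_divide)
    finally show ?thesis .
  qed
  have lim: "(\<lambda>n. LIP \<pi> * (integral {0..L} ?\<phi> + LIP f * L\<^sup>2 * (1 / 2) ^ n))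
      \<longlonglongrightarrow> LIP \<pi> * (integral {0..L} ?\<phi> + LIP f * L\<^sup>2 * 0)"
    by (intro tendsto_intros) auto
  have "(\<lambda>n. \<bar>?S n\<bar>) \<longlonglongrightarrow> \<bar>curve_current \<gamma> L f \<pi>\<bar>"
    by (intro tendsto_intros dyadic_sum_tendsto_curve_current f \<pi>)
  then have "\<bar>curve_current \<gamma> L f \<pi>\<bar> \<le> LIP \<pi> * (integral {0..L} ?\<phi> + LIP f * L\<^sup>2 * 0)"
    by (rule LIMSEQ_le[OF _ lim]) (use bound in blast)
  then show "\<bar>curve_current \<gamma> L f \<pi>\<bar> \<le> LIP \<pi> * (\<integral>x. \<bar>f x\<bar> \<partial>curve_measure \<gamma> L)"
    by (simp add: curve_measure_integral[OF f])
qed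

end

section \<open>Lipschitz curves in quasiconvex spaces\<close>

context
  fixes g :: "real \<Rightarrow> 'a::metric_space" and K :: real
  assumes g: "path g" and K: "0 \<le> K" and len: "curve_length g \<le> ennreal K"
begin

definition polygon_length :: "real list \<Rightarrow> real" where
  "polygon_length ts = (\<Sum>i<length ts - 1. dist (g (ts ! i)) (g (ts ! Suc i)))"

definition arc_length :: "real \<Rightarrow> real" where
  "arc_length t = Sup (polygon_length ` {ts. sorted ts \<and> set ts \<subseteq> {0..t}})"

lemma polygon_length_snoc:
  "ts \<noteq> [] \<Longrightarrow> polygon_length (ts @ [x]) = polygon_length ts + dist (g (last ts)) (g x)"
  by (cases "length ts") (auto simp: polygon_length_def nth_append last_conv_nth intro!: sum.cong)

lemma polygon_length_le_snoc: "polygon_length ts \<le> polygon_length (ts @ [x])"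
  by (cases "ts = []") (auto simp: polygon_length_snoc, simp add: polygon_length_def)

lemma polygon_length_le:
  assumes "sorted ts" "set ts \<subseteq> {0..1}"
  shows "polygon_length ts \<le> K"
proof -
  have "ennreal (polygon_length ts) \<le> curve_length g"
    unfolding curve_length_def polygon_length_def by (rule SUP_upper) (use assms in simp)
  then show ?thesis using len K order_trans by (fastforce simp: ennreal_le_iff)
qed

lemma arc_length_upper:
  assumes "t \<le> 1" "sorted ts" "set ts \<subseteq> {0..t}"
  shows "polygon_length ts \<le> arc_length t"
  unfolding arc_length_def
proof (rule cSup_upper)
  show "bdd_above (polygon_length ` {ts. sorted ts \<and> set ts \<subseteq> {0..t}})"
    using assms(1) by (intro bdd_aboveI2[where M = K] polygon_length_le) auto
qed (use assms in blast)

lemma arc_length_least: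
  assumes "\<And>ts. sorted ts \<Longrightarrow> set ts \<subseteq> {0..t} \<Longrightarrow> polygon_length ts \<le> b"
  shows "arc_length t \<le> b"
  unfolding arc_length_def
  by (rule cSup_least) (use assms in \<open>auto intro!: exI[of _ "[]"]\<close>)

lemma arc_length_nonneg: "t \<le> 1 \<Longrightarrow> 0 \<le> arc_length t"
  using arc_length_upper[of t "[]"] by (simp add: polygon_length_def)

text \<open>A partition of \<open>{0..u}\<close> extended by the node \<open>u\<close> is no
  shorter, and the further node \<open>v\<close> adds exactly the chord. This superadditivity stands
  in for additivity of length over adjacent intervals.\<close>

lemma arc_length_dist:
  assumes "0 \<le> u" "u \<le> v" "v \<le> 1"
  shows "arc_length u + dist (g u) (g v) \<le> arc_length v"
proof -
  have "arc_length u \<le> arc_length v - dist (g u) (g v)"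
  proof (rule arc_length_least)
    fix ts assume ts: "sorted ts" "set ts \<subseteq> {0..u}"
    have "polygon_length ts + dist (g u) (g v) \<le> polygon_length (ts @ [u]) + dist (g u) (g v)"
      using polygon_length_le_snoc by simp
    also have "\<dots> = polygon_length ((ts @ [u]) @ [v])" by (subst polygon_length_snoc) auto
    also have "\<dots> \<le> arc_length v"
      using assms ts by (intro arc_length_upper) (fastforce simp: sorted_append)+
    finally show "polygon_length ts \<le> arc_length v - dist (g u) (g v)" by simp
  qed
  then show ?thesis by simp
qed

lemma arc_length_mono: "0 \<le> u \<Longrightarrow> u \<le> v \<Longrightarrow> v \<le> 1 \<Longrightarrow> arc_length u \<le> arc_length v"
  using arc_length_dist[of u v] zero_le_dist[of "g u" "g v"] by linarith

text \<open>Continuity of the path enters here: bounds inside an open interval pass to its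
  endpoints, where the parametrisation by last times gives no direct control of the arc
  length.\<close>

lemma dist_path_le:
  assumes ab: "0 \<le> a" "a < b" "b \<le> 1"
    and e: "\<And>u v. a < u \<Longrightarrow> u \<le> v \<Longrightarrow> v < b \<Longrightarrow> dist (g u) (g v) \<le> e"
  shows "dist (g a) (g b) \<le> e"
proof -
  \<comment> \<open>The summand 3 ensures \<open>2 * d n < b - a\<close>, so the left point stays
    before the right one.\<close>
  define d where "d n = (b - a) / real (n + 3)" for n
  have d: "0 < d n" "2 * d n < b - a" for n
  proof -
    show "0 < d n" using ab by (simp add: d_def)
    have "2 * d n = (b - a) * (2 / real (n + 3))" by (simp add: d_def)
    also have "\<dots> < (b - a) * 1" using ab by (intro mult_strict_left_mono) (auto simp: divide_simps)
    finally show "2 * d n < b - a" by simp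
  qed
  have "d \<longlonglongrightarrow> 0" unfolding d_def by real_asymp
  then have lim: "(\<lambda>n. a + d n) \<longlonglongrightarrow> a + 0" "(\<lambda>n. b - d n) \<longlonglongrightarrow> b - 0"
    by (intro tendsto_add tendsto_diff tendsto_const; assumption)+
  have cont: "continuous_on {0..1} g" using g by (simp add: path_def)
  have in01: "a + d n \<in> {0..1}" "b - d n \<in> {0..1}" for n
    using ab d[of n] by auto
  have u: "(\<lambda>n. g (a + d n)) \<longlonglongrightarrow> g a" and v: "(\<lambda>n. g (b - d n)) \<longlonglongrightarrow> g b"
    using continuous_on_tendsto_compose[OF cont lim(1)] continuous_on_tendsto_compose[OF cont lim(2)] in01 ab
    by simp_all
  show ?thesis
  proof (rule LIMSEQ_le_const2[OF tendsto_dist[OF u v]], intro exI allI impI)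
    fix n show "dist (g (a + d n)) (g (b - d n)) \<le> e"
      using d[of n] by (intro e) auto
  qed
qed

text \<open>Taking the last time at which the arc length is at most \<open>r\<close> gives a parametrisation by arc
  length without showing that the arc length is continuous.\<close>

lemma path_lipschitz_reparametrisation:
  "\<exists>\<gamma>. 1-lipschitz_on UNIV \<gamma> \<and> \<gamma> 0 = pathstart g \<and> \<gamma> K = pathfinish g"
proof -
  \<comment> \<open>\<open>max 0 r\<close> keeps 0 in \<open>A r\<close> for negative
    \<open>r\<close>, so the curve is defined on the whole line and is constant for
    \<open>r \<le> 0\<close>.\<close>
  define A where "A r = {t \<in> {0..1}. arc_length t \<le> max 0 r}" for r
  define \<tau> where "\<tau> r = Sup (A r)" for r
  have s0: "arc_length 0 \<le> 0"
  proof (rule arc_length_least)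
    fix ts :: "real list" assume "set ts \<subseteq> {0..0}"
    then have "ts ! i = 0" if "i < length ts" for i using that nth_mem by fastforce
    then show "polygon_length ts \<le> 0" by (simp add: polygon_length_def)
  qed
  have zero: "0 \<in> A r" for r using s0 by (auto simp: A_def)
  have bdd: "bdd_above (A r)" for r by (auto simp: A_def intro: bdd_aboveI[where M = 1])
  have \<tau>01: "0 \<le> \<tau> r" "\<tau> r \<le> 1" for r
    unfolding \<tau>_def using zero bdd by (auto intro!: cSup_upper cSup_least simp: A_def)
  have below: "arc_length t \<le> max 0 r" if t: "0 \<le> t" "t < \<tau> r" for t r
  proof -
    have "A r \<noteq> {}" using zero by blast
    then obtain t' where "t' \<in> A r" "t < t'"
      using t(2) less_cSup_iff[OF _ bdd] unfolding \<tau>_def by blast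
    then show ?thesis using arc_length_mono[of t t'] t by (auto simp: A_def)
  qed
  have above: "max 0 r < arc_length t" if "\<tau> r < t" "t \<le> 1" for t r
  proof -
    have "t \<notin> A r" using cSup_upper[OF _ bdd, of t r] that(1) unfolding \<tau>_def by linarith
    then have "\<not> arc_length t \<le> max 0 r" using that \<tau>01(1)[of r] by (simp add: A_def)
    then show ?thesis by linarith
  qed
  \<comment> \<open>Strictly between \<open>\<tau> r\<close> and \<open>\<tau> r'\<close> the arc
    length exceeds \<open>max 0 r\<close> and is at most \<open>max 0 r'\<close>, so chords there
    are at most \<open>r' - r\<close>; continuity extends this to the endpoints.\<close>
  have lip: "dist (g (\<tau> r)) (g (\<tau> r')) \<le> r' - r" if "r \<le> r'" for r r'
  proof -
    have "\<tau> r \<le> \<tau> r'"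
      unfolding \<tau>_def
    proof (rule cSup_subset_mono[OF _ bdd])
      show "A r \<noteq> {}" using zero by blast
      show "A r \<subseteq> A r'" using that by (auto simp: A_def)
    qed
    then consider "\<tau> r = \<tau> r'" | "\<tau> r < \<tau> r'" by linarith
    then show ?thesis
    proof cases
      case 2
      show ?thesis
      proof (rule dist_path_le[OF \<tau>01(1) 2 \<tau>01(2)])
        fix u v assume uv: "\<tau> r < u" "u \<le> v" "v < \<tau> r'"
        have "u \<ge> 0" "v \<le> 1" using uv \<tau>01[of r] \<tau>01[of r'] by linarith+
        then show "dist (g u) (g v) \<le> r' - r"
          using arc_length_dist[of u v] below[of v r'] above[of r u] uv that by linarith
      qed
    qed (use that in simp)
  qed
  have "1-lipschitz_on UNIV (\<lambda>r. g (\<tau> r))"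
  proof (rule lipschitz_onI)
    fix r r' show "dist (g (\<tau> r)) (g (\<tau> r')) \<le> 1 * dist r r'"
      using lip[of r r'] lip[of r' r] by (cases "r \<le> r'") (auto simp: dist_real_def dist_commute)
  qed simp
  \<comment> \<open>\<open>\<tau> 0\<close> is positive when the path rests at its start; the arc
    length is 0 before that time, so the path has not moved.\<close>
  moreover have "g (\<tau> 0) = pathstart g"
  proof (cases "\<tau> 0 = 0")
    case False
    then have pos: "0 < \<tau> 0" using \<tau>01[of 0] by simp
    have "dist (g 0) (g (\<tau> 0)) \<le> 0"
    proof (rule dist_path_le[OF order_refl pos \<tau>01(2)])
      fix u v assume uv: "0 < u" "u \<le> v" "v < \<tau> 0"
      then show "dist (g u) (g v) \<le> 0"
        using arc_length_dist[of u v] below[of v 0] arc_length_nonneg[of u] \<tau>01(2)[of 0]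
        by (simp del: dist_le_zero_iff)
    qed
    then show ?thesis by (simp add: pathstart_def)
  qed (simp add: pathstart_def)
  moreover have "g (\<tau> K) = pathfinish g"
  proof -
    \<comment> \<open>\<open>K\<close> bounds the whole length, so the last admissible time is 1. If
      \<open>K\<close> exceeds the length, the curve rests at its end.\<close>
    have "arc_length 1 \<le> K" by (rule arc_length_least) (rule polygon_length_le)
    then have "1 \<in> A K" using K by (simp add: A_def)
    then have "\<tau> K = 1" using \<tau>01(2)[of K] cSup_upper[OF _ bdd] by (fastforce simp: \<tau>_def)
    then show ?thesis by (simp add: pathfinish_def)
  qed
  ultimately show ?thesis by (intro exI[of _ "\<lambda>r. g (\<tau> r)"]) simp
qed

end

text \<open>The parameter interval has the prescribed length \<open>C * dist x y\<close>, not the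
  actual length of the curve; this makes the mass of its measure exactly proportional to the
  distance.\<close>

lemma quasiconvex_lipschitz_curves:
  assumes "quasiconvex (UNIV :: 'a::metric_space set)"
  obtains C where "C \<ge> 1"
    "\<And>x y :: 'a. \<exists>\<gamma>. 1-lipschitz_on UNIV \<gamma> \<and> \<gamma> 0 = x \<and> \<gamma> (C * dist x y) = y"
proof -
  obtain C where C: "C \<ge> 1" and g: "\<And>x y :: 'a. \<exists>g. path g \<and> pathstart g = x \<and> pathfinish g = y \<and>
      curve_length g \<le> ennreal (C * dist x y)"
    using assms unfolding quasiconvex_def by blast
  have "\<exists>\<gamma>. 1-lipschitz_on UNIV \<gamma> \<and> \<gamma> 0 = x \<and> \<gamma> (C * dist x y) = y" for x y :: 'a
  proof -
    have "0 \<le> C * dist x y" using C by simp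
    with g[of x y] show ?thesis using path_lipschitz_reparametrisation by metis
  qed
  with C show thesis by (rule that)
qed

section \<open>Measures\<close>

text \<open>Serves finite sums as well, by letting the remaining terms be null measures.\<close>

definition sum_measure :: "(nat \<Rightarrow> 'a::topological_space measure) \<Rightarrow> 'a measure" where
  "sum_measure \<nu> = measure_of UNIV (sets borel) (\<lambda>A. \<Sum>k. emeasure (\<nu> k) A)"

lemma suminf_ennreal_swap:
  fixes f :: "nat \<Rightarrow> nat \<Rightarrow> ennreal"
  shows "(\<Sum>i. \<Sum>j. f i j) = (\<Sum>j. \<Sum>i. f i j)"
proof -
  have "(\<Sum>i. \<Sum>j. f i j) = (\<integral>\<^sup>+i. (\<Sum>j. f i j) \<partial>count_space UNIV)"
    by (rule nn_integral_count_space_nat[symmetric])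
  also have "\<dots> = (\<Sum>j. \<Sum>i. f i j)"
    by (subst nn_integral_suminf) (simp_all add: nn_integral_count_space_nat)
  finally show ?thesis .
qed

lemma sets_sum_measure [simp]: "sets (sum_measure \<nu>) = sets borel"
  by (simp add: sum_measure_def) (metis sets.sigma_sets_eq space_borel)

lemma space_sum_measure [simp]: "space (sum_measure \<nu>) = UNIV"
  by (simp add: sum_measure_def space_measure_of_conv)

lemma emeasure_sum_measure:
  assumes \<nu>: "\<And>k. sets (\<nu> k) = sets borel" and A: "A \<in> sets borel"
  shows "emeasure (sum_measure \<nu>) A = (\<Sum>k. emeasure (\<nu> k) A)"
proof (rule emeasure_measure_of[OF sum_measure_def])
  show "positive (sets (sum_measure \<nu>)) (\<lambda>A. \<Sum>k. emeasure (\<nu> k) A)"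
    by (simp add: positive_def)
  show "countably_additive (sets (sum_measure \<nu>)) (\<lambda>A. \<Sum>k. emeasure (\<nu> k) A)"
  proof (rule countably_additiveI)
    fix A :: "nat \<Rightarrow> 'a set"
    assume "range A \<subseteq> sets (sum_measure \<nu>)" "disjoint_family A"
    then have "(\<Sum>i. emeasure (\<nu> k) (A i)) = emeasure (\<nu> k) (\<Union>i. A i)" for k
      using \<nu> by (intro suminf_emeasure) auto
    then show "(\<Sum>i. \<Sum>k. emeasure (\<nu> k) (A i)) = (\<Sum>k. emeasure (\<nu> k) (\<Union>i. A i))"
      by (subst suminf_ennreal_swap) simp
  qed
qed (use A in auto)

text \<open>Induction over measurable functions. Increasing suprema commute with the sum over
  \<open>k\<close> by monotone convergence for the counting measure.\<close>

lemma nn_integral_sum_measure: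
  assumes \<nu>: "\<And>k. sets (\<nu> k) = sets borel" and f: "f \<in> borel_measurable borel"
  shows "(\<integral>\<^sup>+x. f x \<partial>sum_measure \<nu>) = (\<Sum>k. \<integral>\<^sup>+x. f x \<partial>\<nu> k)"
proof -
  note [measurable_cong] = \<nu>
  have [simp]: "space (\<nu> k) = UNIV" for k using sets_eq_imp_space_eq[OF \<nu>] by simp
  have [simp]: "h \<in> borel_measurable borel \<Longrightarrow> h \<in> borel_measurable (\<nu> k)"
      "h \<in> borel_measurable borel \<Longrightarrow> h \<in> borel_measurable (sum_measure \<nu>)" for h :: "'a \<Rightarrow> ennreal" and k
    using \<nu> by (simp_all cong: measurable_cong_sets)
  show ?thesis using f
  proof induction
    case (cong f g)
    then have "f = g" by auto
    then show ?case using cong by simp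
  next
    case (set A)
    then show ?case by (simp add: \<nu> emeasure_sum_measure)
  next
    case (mult u c)
    then show ?case by (simp add: nn_integral_cmult)
  next
    case (add u v)
    then show ?case by (simp add: nn_integral_add suminf_add[symmetric])
  next
    case (seq U)
    note [measurable] = seq(1)
    have "(\<integral>\<^sup>+x. (SUP i. U i) x \<partial>sum_measure \<nu>) = (SUP i. \<integral>\<^sup>+x. U i x \<partial>sum_measure \<nu>)"
      using seq unfolding SUP_apply by (intro nn_integral_monotone_convergence_SUP) auto
    also have "\<dots> = (SUP i. \<integral>\<^sup>+k. (\<integral>\<^sup>+x. U i x \<partial>\<nu> k) \<partial>count_space UNIV)"
      by (simp add: seq nn_integral_count_space_nat)
    also have "\<dots> = (\<integral>\<^sup>+k. (SUP i. \<integral>\<^sup>+x. U i x \<partial>\<nu> k) \<partial>count_space UNIV)"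
      using \<open>incseq U\<close> by (intro nn_integral_monotone_convergence_SUP[symmetric])
        (auto simp: incseq_def le_fun_def intro!: nn_integral_mono simp del: Sup_apply)
    also have "\<dots> = (\<Sum>k. \<integral>\<^sup>+x. (SUP i. U i) x \<partial>\<nu> k)"
      using \<open>incseq U\<close> unfolding nn_integral_count_space_nat SUP_apply
      by (subst nn_integral_monotone_convergence_SUP) auto
    finally show ?case .
  qed
qed

lemma finite_borel_space: "finite_borel_measure \<mu> \<Longrightarrow> space \<mu> = UNIV"
  using sets_eq_imp_space_eq[of \<mu> borel] by (auto simp: finite_borel_measure_def)

lemma finite_borel_sets: "finite_borel_measure \<mu> \<Longrightarrow> sets \<mu> = sets borel"
  by (simp add: finite_borel_measure_def)

lemma finite_borel_integrable:
  fixes f :: "'a::topological_space \<Rightarrow> real"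
  assumes \<mu>: "finite_borel_measure \<mu>" and f: "f \<in> borel_measurable borel" "\<And>x. \<bar>f x\<bar> \<le> B"
  shows "integrable \<mu> f"
proof -
  interpret finite_measure \<mu> using \<mu> by (simp add: finite_borel_measure_def)
  have "f \<in> borel_measurable \<mu>" using f(1) finite_borel_sets[OF \<mu>] by (simp cong: measurable_cong_sets)
  then show ?thesis by (intro integrable_const_bound[where B = B]) (use f in auto)
qed

lemma Lip_b_integrable:
  assumes "finite_borel_measure \<mu>" "f \<in> Lip_b"
  shows "integrable \<mu> f"
proof -
  obtain B where "\<And>x. \<bar>f x\<bar> \<le> B" using Lip_b_bound[OF assms(2)] by blast
  then show ?thesis
    by (rule finite_borel_integrable[OF assms(1) Lip_borel[OF Lip_b_subset[OF assms(2)]]])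
qed

lemma finite_borel_measure_sum:
  assumes \<nu>: "\<And>k. finite_borel_measure (\<nu> k)" and sm: "summable (\<lambda>k. measure (\<nu> k) UNIV)"
  shows "finite_borel_measure (sum_measure \<nu>)"
    and "measure (sum_measure \<nu>) UNIV = (\<Sum>k. measure (\<nu> k) UNIV)"
proof -
  have em_k: "emeasure (\<nu> k) UNIV = ennreal (measure (\<nu> k) UNIV)" for k
    using \<nu>[of k] finite_measure.emeasure_eq_measure by (auto simp: finite_borel_measure_def)
  have "emeasure (sum_measure \<nu>) UNIV = (\<Sum>k. emeasure (\<nu> k) UNIV)"
    by (rule emeasure_sum_measure) (simp_all add: finite_borel_sets[OF \<nu>])
  also have "\<dots> = ennreal (\<Sum>k. measure (\<nu> k) UNIV)"
    unfolding em_k by (rule suminf_ennreal2[OF _ sm]) simp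
  finally have em: "emeasure (sum_measure \<nu>) UNIV = ennreal (\<Sum>k. measure (\<nu> k) UNIV)" .
  then show "finite_borel_measure (sum_measure \<nu>)"
    by (auto simp: finite_borel_measure_def intro!: finite_measureI)
  show "measure (sum_measure \<nu>) UNIV = (\<Sum>k. measure (\<nu> k) UNIV)"
    using em suminf_nonneg[OF sm] by (simp add: measure_def)
qed

lemma integral_sum_measure:
  fixes f :: "'a::topological_space \<Rightarrow> real"
  assumes \<nu>: "\<And>k. finite_borel_measure (\<nu> k)" and sm: "summable (\<lambda>k. measure (\<nu> k) UNIV)"
    and f: "f \<in> borel_measurable borel" "\<And>x. 0 \<le> f x" "\<And>x. f x \<le> B"
  shows "(\<lambda>k. \<integral>x. f x \<partial>\<nu> k) sums (\<integral>x. f x \<partial>sum_measure \<nu>)"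
proof -
  have int: "integrable (\<nu> k) f" for k
    using f by (intro finite_borel_integrable[OF \<nu>, where B = B]) auto
  have nn: "(\<integral>\<^sup>+x. f x \<partial>\<nu> k) = ennreal (\<integral>x. f x \<partial>\<nu> k)" for k
    using int f by (intro nn_integral_eq_integral) auto
  have int': "integrable (sum_measure \<nu>) f"
    using f by (intro finite_borel_integrable[OF finite_borel_measure_sum(1)[OF \<nu> sm], where B = B]) auto
  have "(\<Sum>k. ennreal (\<integral>x. f x \<partial>\<nu> k)) = ennreal (\<integral>x. f x \<partial>sum_measure \<nu>)"
  proof -
    have "(\<integral>\<^sup>+x. ennreal (f x) \<partial>sum_measure \<nu>) = (\<Sum>k. \<integral>\<^sup>+x. ennreal (f x) \<partial>\<nu> k)"
      by (rule nn_integral_sum_measure) (use f(1) in \<open>simp_all add: finite_borel_sets[OF \<nu>]\<close>)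
    moreover have "(\<integral>\<^sup>+x. ennreal (f x) \<partial>sum_measure \<nu>) = ennreal (\<integral>x. f x \<partial>sum_measure \<nu>)"
      by (rule nn_integral_eq_integral[OF int']) (simp add: f(2))
    ultimately show ?thesis unfolding nn by simp
  qed
  then have "(\<lambda>k. ennreal (\<integral>x. f x \<partial>\<nu> k)) sums ennreal (\<integral>x. f x \<partial>sum_measure \<nu>)"
    by (metis summableI summable_sums)
  then show ?thesis using f by (subst (asm) sums_ennreal) auto
qed

section \<open>Lipschitz approximation of indicators of Borel sets\<close>

lemma Lip_infdist_cutoff:
  fixes K :: "'a::metric_space set"
  assumes "0 \<le> n"
  shows "n-lipschitz_on UNIV (\<lambda>x. min 1 (n * infdist x K))"
proof (rule lipschitz_onI[OF _ assms])
  fix x y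
  have "\<bar>n * infdist x K - n * infdist y K\<bar> = n * \<bar>infdist x K - infdist y K\<bar>"
    using assms by (simp add: abs_mult right_diff_distrib[symmetric])
  also have "\<dots> \<le> n * dist x y" using assms by (intro mult_left_mono infdist_triangle_abs)
  finally show "dist (min 1 (n * infdist x K)) (min 1 (n * infdist y K)) \<le> n * dist x y"
    by (auto simp: dist_real_def min_def)
qed

text \<open>Induction over the Borel sets as generated from open sets by complements and disjoint
  countable unions. Open sets are reached by cutoffs of the distance to the complement, complements
  by \<open>1 - \<phi>\<close>, unions by truncated finite sums.\<close>

lemma indicator_approx_Lip_b:
  fixes E :: "'a::metric_space set"
  assumes \<rho>: "finite_borel_measure \<rho>" and E: "E \<in> sets borel" and e: "0 < (e::real)"
  shows "\<exists>\<phi>\<in>Lip. (\<forall>x. 0 \<le> \<phi> x \<and> \<phi> x \<le> 1) \<and> (\<integral>x. \<bar>\<phi> x - indicator E x\<bar> \<partial>\<rho>) < e"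
proof -
  interpret finite_measure \<rho> using \<rho> by (simp add: finite_borel_measure_def)
  have sp [simp]: "space \<rho> = UNIV" by (rule finite_borel_space[OF \<rho>])
  note [measurable_cong] = finite_borel_sets[OF \<rho>]
  note [simp] = finite_borel_sets[OF \<rho>]
  have int: "integrable \<rho> (\<lambda>x. \<bar>\<phi> x - indicator E x\<bar>)"
    if "\<phi> \<in> Lip" "\<forall>x. 0 \<le> \<phi> x \<and> \<phi> x \<le> 1" "E \<in> sets borel" for \<phi> :: "'a \<Rightarrow> real" and E
    using Lip_borel[OF that(1)] that
    by (intro finite_borel_integrable[OF \<rho>, where B = 1]) (auto simp: indicator_def)
  have "Int_stable {S :: 'a set. open S}" by (auto simp: Int_stable_def)
  moreover have "{S :: 'a set. open S} \<subseteq> Pow UNIV" by simp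
  moreover have "E \<in> sigma_sets UNIV {S. open S}" using E by (simp add: borel_def)
  ultimately have "\<forall>e>0. \<exists>\<phi>\<in>Lip. (\<forall>x. 0 \<le> \<phi> x \<and> \<phi> x \<le> 1) \<and> (\<integral>x. \<bar>\<phi> x - indicator E x\<bar> \<partial>\<rho>) < e"
  proof (induction rule: sigma_sets_induct_disjoint)
    case (basic U)
    then have U: "open U" by simp
    have [measurable]: "U \<in> sets borel" using U by simp
    \<comment> \<open>\<open>infdist\<close> to the empty set is 0, so the whole space needs its own
      clause.\<close>
    define \<phi> where "\<phi> n x = (if -U = {} then 1 else min 1 (real n * infdist x (-U)))" for n x
    have Lip: "\<phi> n \<in> Lip" for n
      unfolding \<phi>_def using Lip_infdist_cutoff[of "real n" "-U"] by (cases "-U = {}") (auto intro: LipI)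
    have lim: "(\<lambda>n. \<bar>\<phi> n x - indicator U x\<bar>) \<longlonglongrightarrow> \<bar>indicator U x - indicator U x\<bar>" for x
    proof (intro tendsto_intros)
      show "(\<lambda>n. \<phi> n x) \<longlonglongrightarrow> indicator U x"
      proof (cases "-U = {} \<or> x \<notin> U")
        case True
        then have "\<phi> n x = indicator U x" for n by (cases "x \<in> U") (auto simp: \<phi>_def)
        then show ?thesis by simp
      next
        case False
        then have d: "0 < infdist x (-U)" using U by (intro infdist_pos_not_in_closed) auto
        obtain N where N: "1 / infdist x (-U) < real N" using reals_Archimedean2 by blast
        have "\<phi> n x = indicator U x" if "n \<ge> N" for n
        proof -
          have "1 \<le> real N * infdist x (-U)" using N d by (simp add: field_simps)
          also have "\<dots> \<le> real n * infdist x (-U)" using that d by (intro mult_right_mono) auto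
          finally show ?thesis using False by (simp add: \<phi>_def)
        qed
        then show ?thesis by (intro tendsto_eventually) (auto simp: eventually_sequentially)
      qed
    qed
    have [measurable]: "\<phi> n \<in> borel_measurable borel" for n by (rule Lip_borel[OF Lip])
    have b: "0 \<le> \<phi> n x \<and> \<phi> n x \<le> 1" for n x by (auto simp: \<phi>_def infdist_nonneg)
    have "(\<lambda>n. \<integral>x. \<bar>\<phi> n x - indicator U x\<bar> \<partial>\<rho>) \<longlonglongrightarrow> (\<integral>x. 0 \<partial>\<rho>)"
    proof (rule integral_dominated_convergence[where w = "\<lambda>_. 1"])
      show "AE x in \<rho>. (\<lambda>n. \<bar>\<phi> n x - indicator U x\<bar>) \<longlonglongrightarrow> 0" using lim by simp
      show "AE x in \<rho>. norm \<bar>\<phi> n x - indicator U x\<bar> \<le> 1" for n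
        using b[of n] by (auto simp: indicator_def)
    qed (use U in auto)
    then have lim0: "(\<lambda>n. \<integral>x. \<bar>\<phi> n x - indicator U x\<bar> \<partial>\<rho>) \<longlonglongrightarrow> 0" by simp
    have "\<exists>n. (\<integral>x. \<bar>\<phi> n x - indicator U x\<bar> \<partial>\<rho>) < e" if "0 < e" for e
      using eventually_happens[OF order_tendstoD(2)[OF lim0 that]] by auto
    then show ?case using b Lip by blast
  next
    case empty
    show ?case by (intro allI impI bexI[of _ "\<lambda>_. 0"]) auto
  next
    case (compl A)
    show ?case
    proof (intro allI impI)
      fix e :: real assume "0 < e"
      then obtain \<phi> where \<phi>: "\<phi> \<in> Lip" "\<forall>x. 0 \<le> \<phi> x \<and> \<phi> x \<le> 1"
          "(\<integral>x. \<bar>\<phi> x - indicator A x\<bar> \<partial>\<rho>) < e"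
        using compl by blast
      have "\<bar>(1 - \<phi> x) - indicator (UNIV - A) x\<bar> = \<bar>\<phi> x - indicator A x\<bar>" for x
        by (auto simp: indicator_def)
      then show "\<exists>\<phi>\<in>Lip. (\<forall>x. 0 \<le> \<phi> x \<and> \<phi> x \<le> 1) \<and> (\<integral>x. \<bar>\<phi> x - indicator (UNIV - A) x\<bar> \<partial>\<rho>) < e"
        using \<phi> by (intro bexI[of _ "\<lambda>x. 1 - \<phi> x"]) (auto intro: Lip_diff)
    qed
  next
    case (union A)
    then have A: "A i \<in> sets borel" for i by (auto simp: borel_def)
    show ?case
    proof (intro allI impI)
      fix e :: real assume e: "0 < e"
      define B where "B n = (\<Union>i<n. A i)" for n
      have B: "B n \<in> sets borel" for n using A by (auto simp: B_def)
      have UB: "(\<Union>n. B n) = (\<Union>i. A i)" by (auto simp: B_def)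
      have "(\<lambda>n. measure \<rho> (B n)) \<longlonglongrightarrow> measure \<rho> (\<Union>n. B n)"
      proof (rule finite_Lim_measure_incseq)
        show "incseq B" unfolding B_def incseq_def by (intro allI impI UN_mono) auto
      qed (use B in auto)
      then have "\<forall>\<^sub>F n in sequentially. measure \<rho> (\<Union>i. A i) - e / 2 < measure \<rho> (B n)"
        using e unfolding UB by (intro order_tendstoD(1)) auto
      then obtain n where n: "measure \<rho> (\<Union>i. A i) - e / 2 < measure \<rho> (B n)"
        by (auto simp: eventually_sequentially)
      \<comment> \<open>The \<open>n\<close> approximations together cost at most
        \<open>e / 2\<close>; the other half pays for the tail of the union beyond
        \<open>B n\<close>.\<close>
      have "\<forall>i. \<exists>\<phi>. \<phi> \<in> Lip \<and> (\<forall>x. 0 \<le> \<phi> x \<and> \<phi> x \<le> 1) \<and>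
          (\<integral>x. \<bar>\<phi> x - indicator (A i) x\<bar> \<partial>\<rho>) < e / (2 * real (Suc n))"
        using union e by (simp add: Bex_def)
      from choice[OF this] obtain \<phi> where \<phi>: "\<And>i. \<phi> i \<in> Lip" "\<And>i. \<forall>x. 0 \<le> \<phi> i x \<and> \<phi> i x \<le> 1"
          "\<And>i. (\<integral>x. \<bar>\<phi> i x - indicator (A i) x\<bar> \<partial>\<rho>) < e / (2 * real (Suc n))"
        by blast
      define \<psi> where "\<psi> x = max 0 (min 1 (\<Sum>i<n. \<phi> i x))" for x
      have "(\<lambda>x. \<Sum>i<n. \<phi> i x) \<in> Lip" by (induction n) (auto intro: Lip_add \<phi>)
      then have \<psi>: "\<psi> \<in> Lip" unfolding \<psi>_def by (intro LipI[OF lipschitz_on_clamp[OF LIP_lipschitz]])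
      \<comment> \<open>On \<open>B n\<close> one summand \<open>\<phi> j\<close> already forces
        \<open>\<psi>\<close> close to 1, and the cap at 1 prevents overshooting. Off
        \<open>B n\<close> every \<open>\<phi> i\<close> with \<open>i < n\<close> equals its own
        error, and the last indicator accounts for the missed tail.\<close>
      have pw: "\<bar>\<psi> x - indicator (\<Union>i. A i) x\<bar>
          \<le> (\<Sum>i<n. \<bar>\<phi> i x - indicator (A i) x\<bar>) + indicator ((\<Union>i. A i) - B n) x" for x
      proof (cases "x \<in> B n")
        case True
        then obtain j where j: "j < n" "x \<in> A j" by (auto simp: B_def)
        have "\<phi> j x \<le> (\<Sum>i<n. \<phi> i x)" using j \<phi>(2) by (intro member_le_sum) auto
        then have "\<bar>\<psi> x - 1\<bar> \<le> \<bar>\<phi> j x - indicator (A j) x\<bar>"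
          using j \<phi>(2)[rule_format, of j x] unfolding \<psi>_def indicator_def by simp
        also have "\<dots> \<le> (\<Sum>i<n. \<bar>\<phi> i x - indicator (A i) x\<bar>)" using j by (intro member_le_sum) auto
        finally show ?thesis using j True by (auto simp: indicator_def)
      next
        case False
        have "\<psi> x \<le> (\<Sum>i<n. \<phi> i x)" using \<phi>(2) by (auto simp: \<psi>_def intro!: sum_nonneg)
        also have "\<dots> = (\<Sum>i<n. \<bar>\<phi> i x - indicator (A i) x\<bar>)"
          using False \<phi>(2) by (intro sum.cong) (auto simp: B_def indicator_def)
        finally have "\<psi> x \<le> \<dots>" .
        moreover have "0 \<le> \<psi> x" "\<psi> x \<le> 1" by (auto simp: \<psi>_def)
        moreover have "0 \<le> (\<Sum>i<n. \<bar>\<phi> i x - indicator (A i) x\<bar>)" by (simp add: sum_nonneg)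
        ultimately show ?thesis using False by (auto simp: indicator_def)
      qed
      have b\<psi>: "\<forall>x. 0 \<le> \<psi> x \<and> \<psi> x \<le> 1" by (auto simp: \<psi>_def)
      have UA: "(\<Union>i. A i) \<in> sets borel" using A by auto
      have i1: "integrable \<rho> (\<lambda>x. \<Sum>i<n. \<bar>\<phi> i x - indicator (A i) x\<bar>)"
        by (intro Bochner_Integration.integrable_sum int \<phi> A)
      have i2: "integrable \<rho> (indicator ((\<Union>i. A i) - B n) :: 'a \<Rightarrow> real)"
        using UA B by (intro integrable_real_indicator) (auto simp: less_top[symmetric])
      have "(\<integral>x. \<bar>\<psi> x - indicator (\<Union>i. A i) x\<bar> \<partial>\<rho>)
          \<le> (\<integral>x. (\<Sum>i<n. \<bar>\<phi> i x - indicator (A i) x\<bar>) + indicator ((\<Union>i. A i) - B n) x \<partial>\<rho>)"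
        by (intro integral_mono int[OF \<psi> b\<psi> UA] Bochner_Integration.integrable_add i1 i2 pw)
      also have "\<dots> = (\<Sum>i<n. \<integral>x. \<bar>\<phi> i x - indicator (A i) x\<bar> \<partial>\<rho>) + measure \<rho> ((\<Union>i. A i) - B n)"
        using i1 i2 UA B by (simp add: Bochner_Integration.integral_sum int \<phi> A)
      also have "measure \<rho> ((\<Union>i. A i) - B n) = measure \<rho> (\<Union>i. A i) - measure \<rho> (B n)"
        using A B by (intro finite_measure_Diff) (auto simp: B_def)
      also have "(\<Sum>i<n. \<integral>x. \<bar>\<phi> i x - indicator (A i) x\<bar> \<partial>\<rho>) \<le> (\<Sum>i<n. e / (2 * real (Suc n)))"
        by (intro sum_mono less_imp_le \<phi>)
      also have "\<dots> \<le> e / 2" using e by (simp add: divide_simps)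
      finally have "(\<integral>x. \<bar>\<psi> x - indicator (\<Union>i. A i) x\<bar> \<partial>\<rho>) < e" using n by simp
      then show "\<exists>\<phi>\<in>Lip. (\<forall>x. 0 \<le> \<phi> x \<and> \<phi> x \<le> 1) \<and>
          (\<integral>x. \<bar>\<phi> x - indicator (\<Union>i. A i) x\<bar> \<partial>\<rho>) < e"
        using \<psi> b\<psi> by blast
    qed
  qed
  then show ?thesis using e by blast
qed

section \<open>Existence of the mass measure\<close>

lemma abs_le_integral_iff_nn:
  fixes f :: "'a::metric_space \<Rightarrow> real"
  assumes \<mu>: "finite_borel_measure \<mu>" and f: "f \<in> Lip_b" and c: "0 \<le> c"
  shows "t \<le> c * (\<integral>x. \<bar>f x\<bar> \<partial>\<mu>) \<longleftrightarrow> ennreal t \<le> ennreal c * (\<integral>\<^sup>+x. ennreal \<bar>f x\<bar> \<partial>\<mu>)"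
proof -
  have "(\<integral>\<^sup>+x. ennreal \<bar>f x\<bar> \<partial>\<mu>) = ennreal (\<integral>x. \<bar>f x\<bar> \<partial>\<mu>)"
    using Lip_b_integrable[OF \<mu> f] by (intro nn_integral_eq_integral integrable_abs) auto
  then show ?thesis using c by (simp add: ennreal_mult[symmetric] ennreal_le_iff)
qed

text \<open>The least controlling measure is built from densities with values in
  \<open>ennreal\<close>; in this form control can be checked without integrability
  conditions.\<close>

lemma controls_iff_nn:
  assumes "finite_borel_measure \<mu>"
  shows "controls \<mu> T \<longleftrightarrow>
    (\<forall>f\<in>Lip_b. \<forall>\<pi>\<in>Lip. ennreal \<bar>T f \<pi>\<bar> \<le> ennreal (LIP \<pi>) * (\<integral>\<^sup>+x. ennreal \<bar>f x\<bar> \<partial>\<mu>))"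
  unfolding controls_def using abs_le_integral_iff_nn[OF assms _ LIP_nonneg] by blast

text \<open>Two controlling measures may be used on complementary Borel sets: split \<open>f\<close> by a Lipschitz
  approximation of the indicator of \<open>E\<close>. This makes controlling measures stable under minima.\<close>

lemma controls_split_real:
  assumes T: "bilinear_Lip T" and \<mu>: "finite_borel_measure \<mu>" "controls \<mu> T"
    and \<nu>: "finite_borel_measure \<nu>" "controls \<nu> T"
    and E: "E \<in> sets borel" and f: "f \<in> Lip_b" and \<pi>: "\<pi> \<in> Lip"
  shows "\<bar>T f \<pi>\<bar> \<le> LIP \<pi> * ((\<integral>x. \<bar>f x\<bar> * indicator E x \<partial>\<mu>) + (\<integral>x. \<bar>f x\<bar> * indicator (-E) x \<partial>\<nu>))"
proof (rule field_le_epsilon)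
  fix e :: real assume e: "0 < e"
  obtain B where B: "0 \<le> B" "\<And>x. \<bar>f x\<bar> \<le> B" using Lip_b_bound[OF f] by metis
  have fm [measurable]: "f \<in> borel_measurable borel" using f by (intro Lip_borel Lip_b_subset)
  note [measurable] = E
  \<comment> \<open>The sum of both measures, so that a single Lipschitz function approximates the
    indicator of \<open>E\<close> in mean for \<open>\<mu>\<close> and for
    \<open>\<nu>\<close>.\<close>
  define \<rho> where "\<rho> = sum_measure (\<lambda>k::nat. if k = 0 then \<mu> else if k = 1 then \<nu> else null_measure borel)"
  have fin: "finite_borel_measure (if k = 0 then \<mu> else if k = 1 then \<nu> else null_measure borel)" for k :: nat
    using \<mu> \<nu> by (auto simp: finite_borel_measure_def intro: finite_measureI)
  have sm: "summable (\<lambda>k::nat. measure (if k = 0 then \<mu> else if k = 1 then \<nu> else null_measure borel) UNIV)"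
    by (rule summable_finite[of "{0, 1}"]) auto
  have \<rho>: "finite_borel_measure \<rho>" unfolding \<rho>_def by (rule finite_borel_measure_sum(1)[OF fin sm])
  have \<rho>_int: "(\<integral>x. h x \<partial>\<rho>) = (\<integral>x. h x \<partial>\<mu>) + (\<integral>x. h x \<partial>\<nu>)"
    if h: "h \<in> borel_measurable borel" "\<And>x. 0 \<le> h x" "\<And>x. h x \<le> 1" for h :: "'a \<Rightarrow> real"
  proof -
    have "(\<lambda>k. \<integral>x. h x \<partial>(if k = 0 then \<mu> else if k = 1 then \<nu> else null_measure borel)) sums (\<integral>x. h x \<partial>\<rho>)"
      unfolding \<rho>_def by (rule integral_sum_measure[OF fin sm h])
    moreover have "(\<lambda>k::nat. \<integral>x. h x \<partial>(if k = 0 then \<mu> else if k = 1 then \<nu> else null_measure borel))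
        sums (\<Sum>k\<in>{0, 1::nat}. \<integral>x. h x \<partial>(if k = 0 then \<mu> else if k = 1 then \<nu> else null_measure borel))"
      by (rule sums_finite) auto
    ultimately show ?thesis using sums_unique2 by fastforce
  qed
  \<comment> \<open>Chosen so that \<open>LIP \<pi> * B * \<delta> \<le> e\<close>; the added 1
    avoids division by 0.\<close>
  define \<delta> where "\<delta> = e / (LIP \<pi> * B + 1)"
  have pos: "0 < LIP \<pi> * B + 1" using B LIP_nonneg[OF \<pi>] by (simp add: add_nonneg_pos)
  then have \<delta>: "0 < \<delta>" using e by (simp add: \<delta>_def)
  obtain \<phi> where \<phi>: "\<phi> \<in> Lip" "\<And>x. 0 \<le> \<phi> x" "\<And>x. \<phi> x \<le> 1"
    and small: "(\<integral>x. \<bar>\<phi> x - indicator E x\<bar> \<partial>\<rho>) < \<delta>"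
    using indicator_approx_Lip_b[OF \<rho> E \<delta>] by blast
  have [measurable]: "\<phi> \<in> borel_measurable borel" using \<phi> by (intro Lip_borel)
  have \<phi>b: "\<phi> \<in> Lip_b" using \<phi> by (intro Lip_bI[where B = 1]) auto
  have \<psi>b: "(\<lambda>x. 1 - \<phi> x) \<in> Lip_b" using \<phi> by (intro Lip_bI[where B = 1] Lip_diff) auto
  have fb: "(\<lambda>x. f x * \<phi> x) \<in> Lip_b" "(\<lambda>x. f x * (1 - \<phi> x)) \<in> Lip_b"
    using Lip_b_mult[OF f \<phi>b] Lip_b_mult[OF f \<psi>b] by auto
  \<comment> \<open>Replacing \<open>\<eta>\<close> by the indicator costs at most the bound of
    \<open>f\<close> times their mean distance. It is applied to \<open>\<phi>\<close> with
    \<open>E\<close> and to \<open>1 - \<phi>\<close> with \<open>-E\<close>.\<close>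
  have approx: "(\<integral>x. \<bar>f x * \<eta> x\<bar> \<partial>\<sigma>) \<le> (\<integral>x. \<bar>f x\<bar> * indicator D x \<partial>\<sigma>) + B * (\<integral>x. \<bar>\<eta> x - indicator D x\<bar> \<partial>\<sigma>)"
    if \<sigma>: "finite_borel_measure \<sigma>" and \<eta>: "\<And>x. 0 \<le> \<eta> x" "\<And>x. \<eta> x \<le> 1"
      and [measurable]: "\<eta> \<in> borel_measurable borel" "D \<in> sets borel" for \<sigma> \<eta> D
  proof -
    have i1: "integrable \<sigma> (\<lambda>x. \<bar>f x * \<eta> x\<bar>)"
      by (rule finite_borel_integrable[OF \<sigma>, where B = "B * 1"])
        (measurable, use B \<eta> in \<open>simp only: abs_mult; intro mult_mono; simp\<close>)
    have i2: "integrable \<sigma> (\<lambda>x. \<bar>f x\<bar> * indicator D x)"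
      by (rule finite_borel_integrable[OF \<sigma>, where B = B])
        (measurable, use B in \<open>auto simp: indicator_def\<close>)
    have i3: "integrable \<sigma> (\<lambda>x. \<bar>\<eta> x - indicator D x\<bar>)"
      by (rule finite_borel_integrable[OF \<sigma>, where B = 1])
        (measurable, use \<eta> in \<open>auto simp: indicator_def\<close>)
    have "(\<integral>x. \<bar>f x * \<eta> x\<bar> \<partial>\<sigma>) \<le> (\<integral>x. \<bar>f x\<bar> * indicator D x + B * \<bar>\<eta> x - indicator D x\<bar> \<partial>\<sigma>)"
    proof (rule integral_mono[OF i1])
      show "integrable \<sigma> (\<lambda>x. \<bar>f x\<bar> * indicator D x + B * \<bar>\<eta> x - indicator D x\<bar>)"
        using i2 i3 by simp
      fix x
      have "\<bar>f x\<bar> * \<eta> x \<le> \<bar>f x\<bar> * (indicator D x + \<bar>\<eta> x - indicator D x\<bar>)"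
        by (intro mult_left_mono) auto
      also have "\<dots> \<le> \<bar>f x\<bar> * indicator D x + B * \<bar>\<eta> x - indicator D x\<bar>"
        using B by (simp add: distrib_left mult_right_mono)
      finally show "\<bar>f x * \<eta> x\<bar> \<le> \<bar>f x\<bar> * indicator D x + B * \<bar>\<eta> x - indicator D x\<bar>"
        using \<eta> by (simp add: abs_mult)
    qed
    also have "\<dots> = (\<integral>x. \<bar>f x\<bar> * indicator D x \<partial>\<sigma>) + B * (\<integral>x. \<bar>\<eta> x - indicator D x\<bar> \<partial>\<sigma>)"
      using i2 i3 by simp
    finally show ?thesis .
  qed
  have compl: "\<bar>(1 - \<phi> x) - indicator (-E) x\<bar> = \<bar>\<phi> x - indicator E x\<bar>" for x by (auto simp: indicator_def)
  have a\<mu>: "(\<integral>x. \<bar>f x * \<phi> x\<bar> \<partial>\<mu>)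
      \<le> (\<integral>x. \<bar>f x\<bar> * indicator E x \<partial>\<mu>) + B * (\<integral>x. \<bar>\<phi> x - indicator E x\<bar> \<partial>\<mu>)"
    using \<phi> by (intro approx \<mu>) auto
  have a\<nu>: "(\<integral>x. \<bar>f x * (1 - \<phi> x)\<bar> \<partial>\<nu>)
      \<le> (\<integral>x. \<bar>f x\<bar> * indicator (-E) x \<partial>\<nu>) + B * (\<integral>x. \<bar>\<phi> x - indicator E x\<bar> \<partial>\<nu>)"
    using approx[OF \<nu>(1), of "\<lambda>x. 1 - \<phi> x" "-E"] \<phi> unfolding compl by auto
  have sum_small: "(\<integral>x. \<bar>\<phi> x - indicator E x\<bar> \<partial>\<mu>) + (\<integral>x. \<bar>\<phi> x - indicator E x\<bar> \<partial>\<nu>) < \<delta>"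
    using small \<phi> by (subst (asm) \<rho>_int) (auto simp: indicator_def)
  have "(\<lambda>x. f x * \<phi> x + f x * (1 - \<phi> x)) = f" by (auto simp: algebra_simps)
  then have "\<bar>T f \<pi>\<bar> \<le> \<bar>T (\<lambda>x. f x * \<phi> x) \<pi>\<bar> + \<bar>T (\<lambda>x. f x * (1 - \<phi> x)) \<pi>\<bar>"
    using bilinear_Lip_add_left[OF T fb \<pi>] by simp
  also have "\<dots> \<le> LIP \<pi> * (\<integral>x. \<bar>f x * \<phi> x\<bar> \<partial>\<mu>) + LIP \<pi> * (\<integral>x. \<bar>f x * (1 - \<phi> x)\<bar> \<partial>\<nu>)"
    using \<mu>(2) \<nu>(2) fb \<pi> unfolding controls_def by (intro add_mono) auto
  also have "\<dots> = LIP \<pi> * ((\<integral>x. \<bar>f x * \<phi> x\<bar> \<partial>\<mu>) + (\<integral>x. \<bar>f x * (1 - \<phi> x)\<bar> \<partial>\<nu>))"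
    by (simp add: distrib_left)
  also have "\<dots> \<le> LIP \<pi> * (((\<integral>x. \<bar>f x\<bar> * indicator E x \<partial>\<mu>) + (\<integral>x. \<bar>f x\<bar> * indicator (-E) x \<partial>\<nu>)) + B * \<delta>)"
  proof (intro mult_left_mono LIP_nonneg \<pi>)
    have "B * ((\<integral>x. \<bar>\<phi> x - indicator E x\<bar> \<partial>\<mu>) + (\<integral>x. \<bar>\<phi> x - indicator E x\<bar> \<partial>\<nu>)) \<le> B * \<delta>"
      using sum_small B by (intro mult_left_mono) auto
    then show "(\<integral>x. \<bar>f x * \<phi> x\<bar> \<partial>\<mu>) + (\<integral>x. \<bar>f x * (1 - \<phi> x)\<bar> \<partial>\<nu>)
        \<le> ((\<integral>x. \<bar>f x\<bar> * indicator E x \<partial>\<mu>) + (\<integral>x. \<bar>f x\<bar> * indicator (-E) x \<partial>\<nu>)) + B * \<delta>"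
      using a\<mu> a\<nu> by (simp add: distrib_left)
  qed
  also have "\<dots> = LIP \<pi> * ((\<integral>x. \<bar>f x\<bar> * indicator E x \<partial>\<mu>) + (\<integral>x. \<bar>f x\<bar> * indicator (-E) x \<partial>\<nu>))
      + LIP \<pi> * B * \<delta>" by (simp add: algebra_simps)
  also have "LIP \<pi> * B * \<delta> \<le> e"
    using pos e by (simp add: \<delta>_def divide_simps)
  finally show "\<bar>T f \<pi>\<bar> \<le> LIP \<pi> * ((\<integral>x. \<bar>f x\<bar> * indicator E x \<partial>\<mu>) + (\<integral>x. \<bar>f x\<bar> * indicator (-E) x \<partial>\<nu>)) + e"
    by simp
qed

lemma controls_split:
  assumes T: "bilinear_Lip T" and \<mu>: "finite_borel_measure \<mu>" "controls \<mu> T"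
    and \<nu>: "finite_borel_measure \<nu>" "controls \<nu> T"
    and E: "E \<in> sets borel" and f: "f \<in> Lip_b" and \<pi>: "\<pi> \<in> Lip"
  shows "ennreal \<bar>T f \<pi>\<bar> \<le> ennreal (LIP \<pi>) * ((\<integral>\<^sup>+x. ennreal \<bar>f x\<bar> * indicator E x \<partial>\<mu>)
      + (\<integral>\<^sup>+x. ennreal \<bar>f x\<bar> * indicator (-E) x \<partial>\<nu>))"
proof -
  obtain B where B: "0 \<le> B" "\<And>x. \<bar>f x\<bar> \<le> B" using Lip_b_bound[OF f] by metis
  have fm [measurable]: "f \<in> borel_measurable borel" using f by (intro Lip_borel Lip_b_subset)
  have nn: "(\<integral>\<^sup>+x. ennreal \<bar>f x\<bar> * indicator D x \<partial>\<sigma>) = ennreal (\<integral>x. \<bar>f x\<bar> * indicator D x \<partial>\<sigma>)"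
    if \<sigma>: "finite_borel_measure \<sigma>" and [measurable]: "D \<in> sets borel" for \<sigma> D
  proof -
    have "integrable \<sigma> (\<lambda>x. \<bar>f x\<bar> * indicator D x)"
      by (rule finite_borel_integrable[OF \<sigma>, where B = B])
        (measurable, use B in \<open>auto simp: indicator_def\<close>)
    then have "(\<integral>\<^sup>+x. ennreal (\<bar>f x\<bar> * indicator D x) \<partial>\<sigma>) = ennreal (\<integral>x. \<bar>f x\<bar> * indicator D x \<partial>\<sigma>)"
      by (rule nn_integral_eq_integral) simp
    moreover have "ennreal (\<bar>f x\<bar> * indicator D x) = ennreal \<bar>f x\<bar> * indicator D x" for x
      by (auto simp: indicator_def)
    ultimately show ?thesis by simp
  qed
  have "ennreal \<bar>T f \<pi>\<bar> \<le> ennreal (LIP \<pi> * ((\<integral>x. \<bar>f x\<bar> * indicator E x \<partial>\<mu>) + (\<integral>x. \<bar>f x\<bar> * indicator (-E) x \<partial>\<nu>)))"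
    by (rule ennreal_leI[OF controls_split_real[OF assms]])
  also have "\<dots> = ennreal (LIP \<pi>) * (ennreal (\<integral>x. \<bar>f x\<bar> * indicator E x \<partial>\<mu>) + ennreal (\<integral>x. \<bar>f x\<bar> * indicator (-E) x \<partial>\<nu>))"
    by (simp add: ennreal_mult LIP_nonneg[OF \<pi>] ennreal_plus)
  finally show ?thesis using E by (simp add: nn \<mu> \<nu>)
qed

section \<open>Minimisation among densities of controlling measures\<close>

context
  fixes T :: "'a::metric_space functional1" and \<mu> :: "'a measure"
  assumes T: "bilinear_Lip T" and \<mu>: "finite_borel_measure \<mu>" "controls \<mu> T"
begin

text \<open>Passing to densities of one fixed controlling measure makes controlling measures
  comparable pointwise, so minima and infima can be taken of functions.\<close>

definition controlling_density :: "('a \<Rightarrow> ennreal) \<Rightarrow> bool" where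
  "controlling_density g \<longleftrightarrow> g \<in> borel_measurable borel \<and>
     finite_borel_measure (density \<mu> g) \<and> controls (density \<mu> g) T"

lemma measurable_base [simp]: "h \<in> borel_measurable borel \<Longrightarrow> h \<in> borel_measurable \<mu>"
  for h :: "'a \<Rightarrow> ennreal"
  using finite_borel_sets[OF \<mu>(1)] by (simp cong: measurable_cong_sets)

lemma Lip_b_measurable_ennreal: "f \<in> Lip_b \<Longrightarrow> (\<lambda>x::'a. ennreal \<bar>f x\<bar>) \<in> borel_measurable borel"
  using Lip_borel[OF Lip_b_subset] by measurable

lemma finite_borel_density_iff:
  assumes "g \<in> borel_measurable borel"
  shows "finite_borel_measure (density \<mu> g) \<longleftrightarrow> (\<integral>\<^sup>+x. g x \<partial>\<mu>) < \<infinity>"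
proof -
  have sp: "space \<mu> = UNIV" by (rule finite_borel_space[OF \<mu>(1)])
  have "emeasure (density \<mu> g) UNIV = (\<integral>\<^sup>+x. g x \<partial>\<mu>)"
    using assms sets.top[of \<mu>] by (simp add: emeasure_density sp)
  then show ?thesis
    using finite_borel_sets[OF \<mu>(1)] finite_measure.emeasure_finite[of "density \<mu> g" UNIV]
    by (auto simp: finite_borel_measure_def sp less_top intro!: finite_measureI)
qed

lemma controlling_density_iff:
  "controlling_density g \<longleftrightarrow> g \<in> borel_measurable borel \<and> (\<integral>\<^sup>+x. g x \<partial>\<mu>) < \<infinity> \<and>
    (\<forall>f\<in>Lip_b. \<forall>\<pi>\<in>Lip. ennreal \<bar>T f \<pi>\<bar> \<le> ennreal (LIP \<pi>) * (\<integral>\<^sup>+x. g x * ennreal \<bar>f x\<bar> \<partial>\<mu>))"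
proof (cases "g \<in> borel_measurable borel")
  case True
  have "(\<integral>\<^sup>+x. ennreal \<bar>f x\<bar> \<partial>density \<mu> g) = (\<integral>\<^sup>+x. g x * ennreal \<bar>f x\<bar> \<partial>\<mu>)" if "f \<in> Lip_b" for f
    using True Lip_b_measurable_ennreal[OF that] by (intro nn_integral_density measurable_base)
  then show ?thesis
    using True controls_iff_nn[of "density \<mu> g" T]
    by (auto simp: controlling_density_def finite_borel_density_iff)
qed (simp add: controlling_density_def)

text \<open>On the Borel set where \<open>g \<le> h\<close> the minimum is \<open>g\<close>, off it
  \<open>h\<close>; control splits over that set and its complement.\<close>

lemma controlling_density_min:
  assumes g: "controlling_density g" and h: "controlling_density h"
  shows "controlling_density (\<lambda>x. min (g x) (h x))"
proof -
  have [measurable]: "g \<in> borel_measurable borel" "h \<in> borel_measurable borel"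
    using g h by (auto simp: controlling_density_def)
  define E where "E = {x. g x \<le> h x}"
  have [measurable]: "E \<in> sets borel" unfolding E_def by measurable
  have "(\<integral>\<^sup>+x. min (g x) (h x) \<partial>\<mu>) \<le> (\<integral>\<^sup>+x. g x \<partial>\<mu>)" by (intro nn_integral_mono) auto
  also have "\<dots> < \<infinity>" using g by (simp add: controlling_density_iff)
  finally have fin: "(\<integral>\<^sup>+x. min (g x) (h x) \<partial>\<mu>) < \<infinity>" .
  have "ennreal \<bar>T f \<pi>\<bar> \<le> ennreal (LIP \<pi>) * (\<integral>\<^sup>+x. min (g x) (h x) * ennreal \<bar>f x\<bar> \<partial>\<mu>)"
    if f: "f \<in> Lip_b" and \<pi>: "\<pi> \<in> Lip" for f \<pi>
  proof -
    note [measurable] = Lip_b_measurable_ennreal[OF f]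
    have "(\<integral>\<^sup>+x. ennreal \<bar>f x\<bar> * indicator E x \<partial>density \<mu> g) + (\<integral>\<^sup>+x. ennreal \<bar>f x\<bar> * indicator (-E) x \<partial>density \<mu> h)
        = (\<integral>\<^sup>+x. g x * (ennreal \<bar>f x\<bar> * indicator E x) \<partial>\<mu>) + (\<integral>\<^sup>+x. h x * (ennreal \<bar>f x\<bar> * indicator (-E) x) \<partial>\<mu>)"
      by (subst (1 2) nn_integral_density) auto
    also have "\<dots> = (\<integral>\<^sup>+x. g x * (ennreal \<bar>f x\<bar> * indicator E x) + h x * (ennreal \<bar>f x\<bar> * indicator (-E) x) \<partial>\<mu>)"
      by (subst nn_integral_add) auto
    also have "\<dots> = (\<integral>\<^sup>+x. min (g x) (h x) * ennreal \<bar>f x\<bar> \<partial>\<mu>)"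
      by (intro nn_integral_cong) (auto simp: E_def indicator_def min_def)
    finally show ?thesis
      using controls_split[OF T _ _ _ _ _ f \<pi>, of "density \<mu> g" "density \<mu> h" E] g h
      by (simp add: controlling_density_def)
  qed
  then show ?thesis using fin by (simp add: controlling_density_iff)
qed

text \<open>\<open>\<nu>\<close> may have a part singular to \<open>\<mu>\<close>. The measure
  constructed is the minimum of the two: \<open>\<nu>\<close> on a Hahn set \<open>Y\<close> where
  it lies below \<open>\<mu>\<close> and so has a density, and \<open>\<mu>\<close> itself off
  \<open>Y\<close>. It controls \<open>T\<close> by the splitting lemma.\<close>

lemma controlling_density_below:
  assumes \<nu>: "finite_borel_measure \<nu>" "controls \<nu> T"
  shows "\<exists>g. controlling_density g \<and> density \<mu> g \<le> \<nu>"
proof -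
  note s\<mu> [simp] = finite_borel_sets[OF \<mu>(1)] and s\<nu> [simp] = finite_borel_sets[OF \<nu>(1)]
  have sp [simp]: "space \<mu> = UNIV" "space \<nu> = UNIV" using \<mu> \<nu> by (simp_all add: finite_borel_space)
  interpret M: finite_measure \<mu> using \<mu> by (simp add: finite_borel_measure_def)
  have "\<exists>Y\<in>sets \<mu>. (\<forall>X\<in>sets \<mu>. X \<subseteq> Y \<longrightarrow> \<nu> X \<le> \<mu> X) \<and> (\<forall>X\<in>sets \<mu>. X \<inter> Y = {} \<longrightarrow> \<mu> X \<le> \<nu> X)"
    using \<mu> \<nu> by (intro finite_unsigned_Hahn_decomposition) (auto simp: finite_borel_measure_def)
  then obtain Y where Y [measurable]: "Y \<in> sets borel"
    and \<nu>le: "\<And>X. X \<in> sets borel \<Longrightarrow> X \<subseteq> Y \<Longrightarrow> \<nu> X \<le> \<mu> X"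
    and \<mu>le: "\<And>X. X \<in> sets borel \<Longrightarrow> X \<inter> Y = {} \<Longrightarrow> \<mu> X \<le> \<nu> X" by auto
  have meas\<nu>: "h \<in> borel_measurable borel \<Longrightarrow> h \<in> borel_measurable \<nu>" for h :: "'a \<Rightarrow> ennreal"
    using s\<nu> by (simp cong: measurable_cong_sets)
  have em\<nu>Y: "emeasure (density \<nu> (indicator Y)) A = \<nu> (A \<inter> Y)" if "A \<in> sets borel" for A
    using that Y by (simp add: emeasure_density meas\<nu> nn_integral_set_ennreal[symmetric] indicator_inter_arith[symmetric] Int_commute)
  have "absolutely_continuous \<mu> (density \<nu> (indicator Y))"
    unfolding absolutely_continuous_def
  proof
    fix N assume N: "N \<in> null_sets \<mu>"
    then have "\<nu> (N \<inter> Y) \<le> \<mu> (N \<inter> Y)" by (intro \<nu>le) auto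
    also have "\<mu> (N \<inter> Y) \<le> \<mu> N" using N by (intro emeasure_mono) auto
    finally have "\<nu> (N \<inter> Y) = 0" using N by auto
    then show "N \<in> null_sets (density \<nu> (indicator Y))" using N em\<nu>Y[of N] by (auto simp: null_sets_def)
  qed
  then obtain g1 where "g1 \<in> borel_measurable \<mu>" and g1: "density \<mu> g1 = density \<nu> (indicator Y)"
    using M.Radon_Nikodym[of "density \<nu> (indicator Y)"] by auto
  then have [measurable]: "g1 \<in> borel_measurable borel" using s\<mu> by (simp cong: measurable_cong_sets)
  define g where "g x = g1 x * indicator Y x + indicator (-Y) x" for x
  have [measurable]: "g \<in> borel_measurable borel" unfolding g_def by measurable
  have split: "(\<integral>\<^sup>+x. g x * h x \<partial>\<mu>) = (\<integral>\<^sup>+x. h x * indicator Y x \<partial>\<nu>) + (\<integral>\<^sup>+x. h x * indicator (-Y) x \<partial>\<mu>)"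
    if [measurable]: "h \<in> borel_measurable borel" for h
  proof -
    have "(\<integral>\<^sup>+x. h x * indicator Y x \<partial>\<nu>) = (\<integral>\<^sup>+x. indicator Y x * (h x * indicator Y x) \<partial>\<nu>)"
      by (intro nn_integral_cong) (auto simp: indicator_def)
    also have "\<dots> = (\<integral>\<^sup>+x. h x * indicator Y x \<partial>density \<nu> (indicator Y))"
      by (rule nn_integral_density[symmetric]) (auto intro: meas\<nu>)
    also have "\<dots> = (\<integral>\<^sup>+x. g1 x * (h x * indicator Y x) \<partial>\<mu>)"
      unfolding g1[symmetric] by (rule nn_integral_density) auto
    finally have "(\<integral>\<^sup>+x. h x * indicator Y x \<partial>\<nu>) + (\<integral>\<^sup>+x. h x * indicator (-Y) x \<partial>\<mu>)
        = (\<integral>\<^sup>+x. g1 x * (h x * indicator Y x) + h x * indicator (-Y) x \<partial>\<mu>)"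
      by (simp add: nn_integral_add)
    also have "\<dots> = (\<integral>\<^sup>+x. g x * h x \<partial>\<mu>)"
      by (intro nn_integral_cong) (auto simp: g_def indicator_def)
    finally show ?thesis by simp
  qed
  have "density \<mu> g \<le> \<nu>"
  proof (subst le_measure)
    show "\<forall>A\<in>sets (density \<mu> g). emeasure (density \<mu> g) A \<le> emeasure \<nu> A"
    proof
      fix A assume "A \<in> sets (density \<mu> g)"
      then have A [measurable]: "A \<in> sets borel" by simp
      have "emeasure (density \<mu> g) A = (\<integral>\<^sup>+x. indicator A x * indicator Y x \<partial>\<nu>) + (\<integral>\<^sup>+x. indicator A x * indicator (-Y) x \<partial>\<mu>)"
        using split[of "indicator A"] by (simp add: emeasure_density)
      also have "\<dots> = \<nu> (A \<inter> Y) + \<mu> (A \<inter> -Y)"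
        using A Y by (simp add: indicator_inter_arith[symmetric])
      also have "\<dots> \<le> \<nu> (A \<inter> Y) + \<nu> (A \<inter> -Y)" by (intro add_left_mono \<mu>le) auto
      also have "\<dots> = \<nu> ((A \<inter> Y) \<union> (A \<inter> -Y))" by (intro plus_emeasure) auto
      also have "(A \<inter> Y) \<union> (A \<inter> -Y) = A" by auto
      finally show "emeasure (density \<mu> g) A \<le> emeasure \<nu> A" .
    qed
  qed simp
  moreover have "controlling_density g"
    unfolding controlling_density_iff
  proof (intro conjI ballI)
    have "(\<integral>\<^sup>+x. g x \<partial>\<mu>) = emeasure (density \<mu> g) UNIV"
      using sets.top[of \<mu>] by (simp add: emeasure_density)
    also have "\<dots> \<le> emeasure \<nu> UNIV" using \<open>density \<mu> g \<le> \<nu>\<close> by (subst (asm) le_measure) auto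
    also have "\<dots> < \<infinity>"
      using \<nu> finite_measure.emeasure_finite[of \<nu> UNIV] by (auto simp: finite_borel_measure_def less_top)
    finally show "(\<integral>\<^sup>+x. g x \<partial>\<mu>) < \<infinity>" .
    fix f \<pi> :: "'a \<Rightarrow> real" assume f: "f \<in> Lip_b" and \<pi>: "\<pi> \<in> Lip"
    show "ennreal \<bar>T f \<pi>\<bar> \<le> ennreal (LIP \<pi>) * (\<integral>\<^sup>+x. g x * ennreal \<bar>f x\<bar> \<partial>\<mu>)"
      unfolding split[OF Lip_b_measurable_ennreal[OF f]] by (rule controls_split[OF T \<nu> \<mu> Y f \<pi>])
  qed measurable
  ultimately show ?thesis by blast
qed

text \<open>A decreasing limit passes under the integral because \<open>G 0\<close>, times a bound
  of \<open>f\<close>, is a majorant of finite integral.\<close>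

lemma controlling_density_decseq_INF:
  assumes g: "\<And>n. controlling_density (G n)" and dec: "decseq G"
  shows "controlling_density (\<lambda>x. INF n. G n x)"
proof -
  have [measurable]: "G n \<in> borel_measurable borel" for n using g by (simp add: controlling_density_def)
  have fin: "(\<integral>\<^sup>+x. G n x \<partial>\<mu>) < \<infinity>" for n using g by (simp add: controlling_density_iff)
  have "(\<integral>\<^sup>+x. (INF n. G n x) \<partial>\<mu>) \<le> (\<integral>\<^sup>+x. G 0 x \<partial>\<mu>)" by (intro nn_integral_mono INF_lower) auto
  then have "(\<integral>\<^sup>+x. (INF n. G n x) \<partial>\<mu>) < \<infinity>" using fin[of 0] by (rule le_less_trans)
  moreover have "ennreal \<bar>T f \<pi>\<bar> \<le> ennreal (LIP \<pi>) * (\<integral>\<^sup>+x. (INF n. G n x) * ennreal \<bar>f x\<bar> \<partial>\<mu>)"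
    if f: "f \<in> Lip_b" and \<pi>: "\<pi> \<in> Lip" for f \<pi>
  proof -
    obtain B where B: "\<And>x. \<bar>f x\<bar> \<le> B" using Lip_b_bound[OF f] by metis
    note [measurable] = Lip_b_measurable_ennreal[OF f]
    have "(\<lambda>n. \<integral>\<^sup>+x. G n x * ennreal \<bar>f x\<bar> \<partial>\<mu>) \<longlonglongrightarrow> (\<integral>\<^sup>+x. (INF n. G n x) * ennreal \<bar>f x\<bar> \<partial>\<mu>)"
    proof (rule nn_integral_dominated_convergence[where w = "\<lambda>x. G 0 x * ennreal \<bar>f x\<bar>"])
      show "AE x in \<mu>. G n x * ennreal \<bar>f x\<bar> \<le> G 0 x * ennreal \<bar>f x\<bar>" for n
        using decseqD[OF dec, of 0 n] by (auto simp: le_fun_def intro!: mult_right_mono)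
      have "(\<integral>\<^sup>+x. G 0 x * ennreal \<bar>f x\<bar> \<partial>\<mu>) \<le> (\<integral>\<^sup>+x. G 0 x * ennreal B \<partial>\<mu>)"
        using B by (intro nn_integral_mono mult_left_mono ennreal_leI) auto
      also have "\<dots> < \<infinity>" using fin[of 0] by (simp add: nn_integral_multc ennreal_mult_less_top)
      finally show "(\<integral>\<^sup>+x. G 0 x * ennreal \<bar>f x\<bar> \<partial>\<mu>) < \<infinity>" .
      have "(\<lambda>n. G n x) \<longlonglongrightarrow> (INF n. G n x)" for x
        using decseqD[OF dec] by (intro LIMSEQ_INF) (auto intro!: decseq_SucI simp: le_fun_def)
      then show "AE x in \<mu>. (\<lambda>n. G n x * ennreal \<bar>f x\<bar>) \<longlonglongrightarrow> (INF n. G n x) * ennreal \<bar>f x\<bar>"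
        by (subst (1 2) mult.commute) (auto intro!: ennreal_tendsto_cmult)
    qed simp_all
    then have "(\<lambda>n. ennreal (LIP \<pi>) * (\<integral>\<^sup>+x. G n x * ennreal \<bar>f x\<bar> \<partial>\<mu>))
        \<longlonglongrightarrow> ennreal (LIP \<pi>) * (\<integral>\<^sup>+x. (INF n. G n x) * ennreal \<bar>f x\<bar> \<partial>\<mu>)"
      by (intro ennreal_tendsto_cmult) auto
    then show ?thesis
      by (rule LIMSEQ_le_const) (use g f \<pi> in \<open>auto simp: controlling_density_iff\<close>)
  qed
  ultimately show ?thesis by (simp add: controlling_density_iff)
qed

text \<open>Minimise the total mass over controlling densities: \<open>H\<close> attains the
  infimum. Given a competitor \<open>\<nu>\<close>, take a controlling density \<open>h\<close>
  below it. The minimum of \<open>H\<close> and \<open>h\<close> is again controlling, so its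
  integral is not smaller than that of \<open>H\<close>, which forces \<open>H \<le> h\<close>
  almost everywhere. Minimal total mass thus gives minimality on every Borel set.\<close>

lemma least_controlling_measure:
  "\<exists>\<sigma>. finite_borel_measure \<sigma> \<and> controls \<sigma> T \<and>
     (\<forall>\<nu>. finite_borel_measure \<nu> \<and> controls \<nu> T \<longrightarrow> \<sigma> \<le> \<nu>)"
proof -
  let ?D = "{g. controlling_density g}" and ?I = "\<lambda>g. \<integral>\<^sup>+x. g x \<partial>\<mu>"
  have "?D \<noteq> {}" using controlling_density_below[OF \<mu>] by auto
  then have "\<exists>f::nat \<Rightarrow> ennreal. decseq f \<and> range f \<subseteq> ?I ` ?D \<and> Inf (?I ` ?D) = (INF i. f i)"
    by (intro ennreal_Inf_countable_INF) auto
  then obtain f :: "nat \<Rightarrow> ennreal" where f: "range f \<subseteq> ?I ` ?D" "Inf (?I ` ?D) = (INF i. f i)" by blast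
  then have "\<forall>n. \<exists>g. controlling_density g \<and> f n = ?I g" by auto
  then obtain g where g: "\<And>n. controlling_density (g n)" "\<And>n. f n = ?I (g n)" by metis
  \<comment> \<open>Running minima make the sequence decreasing, as needed for the limit, and keep
    it below \<open>g n\<close>, hence still minimising.\<close>
  define G where "G = rec_nat (g 0) (\<lambda>n h x. min (h x) (g (Suc n) x))"
  have G0: "G 0 = g 0" and GS: "G (Suc n) = (\<lambda>x. min (G n x) (g (Suc n) x))" for n
    by (simp_all add: G_def)
  have G: "controlling_density (G n)" for n
    by (induction n) (simp_all add: G0 GS g controlling_density_min)
  have dec: "decseq G" by (rule decseq_SucI) (simp add: GS le_fun_def)
  have Gg: "G n x \<le> g n x" for n x by (cases n) (simp_all add: G0 GS)
  define H where "H x = (INF n. G n x)" for x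
  have H: "controlling_density H"
    unfolding H_def by (rule controlling_density_decseq_INF[OF G dec])
  have HI: "?I H \<le> (INF i. f i)"
  proof (rule INF_greatest)
    fix i
    have "H x \<le> g i x" for x
      using INF_lower[of i UNIV "\<lambda>n. G n x"] Gg[of i x] unfolding H_def by simp
    then show "?I H \<le> f i" unfolding g by (intro nn_integral_mono) auto
  qed
  have [measurable]: "H \<in> borel_measurable borel" using H by (simp add: controlling_density_def)
  have "density \<mu> H \<le> \<nu>" if \<nu>: "finite_borel_measure \<nu>" "controls \<nu> T" for \<nu>
  proof -
    obtain h where h: "controlling_density h" "density \<mu> h \<le> \<nu>"
      using controlling_density_below[OF \<nu>] by blast
    have [measurable]: "h \<in> borel_measurable borel" using h by (simp add: controlling_density_def)
    let ?k = "\<lambda>x. min (H x) (h x)"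
    have k: "controlling_density ?k" by (rule controlling_density_min[OF H h(1)])
    have "?I H \<le> ?I ?k"
      using HI k unfolding f(2)[symmetric] by (elim order_trans) (auto intro: INF_lower)
    moreover have "(\<integral>\<^sup>+x. (H x - ?k x) \<partial>\<mu>) = ?I H - ?I ?k"
      using k by (intro nn_integral_diff) (auto simp: controlling_density_iff)
    ultimately have "(\<integral>\<^sup>+x. (H x - ?k x) \<partial>\<mu>) = 0"
      using H by (simp add: diff_eq_0_iff_ennreal controlling_density_iff)
    then have "AE x in \<mu>. H x - ?k x = 0" by (subst (asm) nn_integral_0_iff_AE) auto
    moreover have "AE x in \<mu>. H x \<noteq> \<infinity>"
      using H by (intro nn_integral_noteq_infinite) (auto simp: controlling_density_iff)
    ultimately have AE: "AE x in \<mu>. H x \<le> h x"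
    proof eventually_elim
      case (elim x)
      then have "H x \<le> ?k x" by (metis diff_eq_0_iff_ennreal linorder_not_le top.not_eq_extremum infinity_ennreal_def)
      then show ?case by simp
    qed
    have "density \<mu> H \<le> density \<mu> h"
    proof (subst le_measure)
      show "\<forall>A\<in>sets (density \<mu> H). emeasure (density \<mu> H) A \<le> emeasure (density \<mu> h) A"
        using AE by (auto simp: emeasure_density intro!: nn_integral_mono_AE mult_right_mono elim: eventually_mono)
    qed simp
    then show ?thesis using h(2) by (rule order_trans)
  qed
  then show ?thesis using H by (intro exI[of _ "density \<mu> H"]) (auto simp: controlling_density_def)
qed

end

text \<open>\<open>LEAST\<close> yields a meaningful value once a least element exists; it is unique
  by antisymmetry of the order. These three conclusions are all that is drawn from the definition of
  the mass measure.\<close>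

lemma mass_measure_least:
  assumes "bilinear_Lip T" "finite_borel_measure \<mu>" "controls \<mu> T"
  shows mass_measure_finite_borel: "finite_borel_measure (mass_measure T)"
    and mass_measure_controls: "controls (mass_measure T) T"
    and mass_measure_le: "mass_measure T \<le> \<mu>"
proof -
  obtain \<sigma> where \<sigma>: "finite_borel_measure \<sigma>" "controls \<sigma> T"
    and least: "\<And>\<nu>. finite_borel_measure \<nu> \<Longrightarrow> controls \<nu> T \<Longrightarrow> \<sigma> \<le> \<nu>"
    using least_controlling_measure[OF assms] by blast
  have "mass_measure T = \<sigma>"
    unfolding mass_measure_def by (rule Least_equality) (use \<sigma> least in auto)
  then show "finite_borel_measure (mass_measure T)" "controls (mass_measure T) T" "mass_measure T \<le> \<mu>"
    using \<sigma> least assms by auto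
qed

text \<open>Estimating a mass from above takes any controlling measure, so the mass measure of the
  small correction never has to be computed.\<close>

lemma mass_le:
  assumes "bilinear_Lip T" "finite_borel_measure \<mu>" "controls \<mu> T"
  shows "mass T \<le> ennreal (measure \<mu> UNIV)"
proof -
  have "emeasure (mass_measure T) UNIV \<le> emeasure \<mu> UNIV"
    using mass_measure_le[OF assms] finite_borel_sets[OF assms(2)]
      finite_borel_sets[OF mass_measure_finite_borel[OF assms]] by (subst (asm) le_measure) auto
  then show ?thesis
    using assms(2) finite_measure.emeasure_eq_measure[of \<mu> UNIV]
    by (simp add: mass_def finite_borel_measure_def)
qed

section \<open>Series of currents\<close>

text \<open>The controlling measure is kept explicit because total masses of explicit measures add
  up in sums and series, whereas mass measures are known only through minimality.\<close>

definition controlled_current :: "'a::metric_space functional1 \<Rightarrow> 'a measure \<Rightarrow> bool" where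
  "controlled_current T \<mu> \<longleftrightarrow> bilinear_Lip T \<and> local_current T \<and> jointly_continuous T \<and>
     finite_borel_measure \<mu> \<and> controls \<mu> T"

lemma controlled_currentD:
  assumes "controlled_current T \<mu>"
  shows "bilinear_Lip T" "local_current T" "jointly_continuous T" "finite_borel_measure \<mu>" "controls \<mu> T"
  using assms by (simp_all add: controlled_current_def)

lemma local_currentD:
  assumes "local_current T" "f \<in> Lip_b" "\<pi> \<in> Lip" "open U" "{x. f x \<noteq> 0} \<subseteq> U" "\<forall>x\<in>U. \<pi> x = c"
  shows "T f \<pi> = 0"
  using assms(1)[unfolded local_current_def, rule_format, OF assms(2,3)] assms(4-6) by blast

lemma jointly_continuousD:
  assumes "jointly_continuous T" "f \<in> Lip_b" "\<pi> \<in> Lip" "\<And>n. \<pi>s n \<in> Lip"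
    and "\<And>x. (\<lambda>n. \<pi>s n x) \<longlonglongrightarrow> \<pi> x" "\<And>n. LIP (\<pi>s n) \<le> B"
  shows "(\<lambda>n. T f (\<pi>s n)) \<longlonglongrightarrow> T f \<pi>"
proof -
  have "bdd_above (range (\<lambda>n. LIP (\<pi>s n)))" using assms(6) by (rule bdd_aboveI2)
  then show ?thesis using assms(1-5) unfolding jointly_continuous_def by blast
qed

lemma metric_current1_iff: "metric_current1 T \<longleftrightarrow> (\<exists>\<mu>. controlled_current T \<mu>)"
  by (auto simp: metric_current1_def controlled_current_def)

lemma controls_bound:
  assumes \<mu>: "finite_borel_measure \<mu>" "controls \<mu> T" and f: "f \<in> Lip_b" "\<And>x. \<bar>f x\<bar> \<le> B"
    and \<pi>: "\<pi> \<in> Lip"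
  shows "\<bar>T f \<pi>\<bar> \<le> LIP \<pi> * (B * measure \<mu> UNIV)"
proof -
  interpret finite_measure \<mu> using \<mu> by (simp add: finite_borel_measure_def)
  have "(\<integral>x. \<bar>f x\<bar> \<partial>\<mu>) \<le> (\<integral>x. B \<partial>\<mu>)"
    using f by (intro integral_mono integrable_abs Lip_b_integrable[OF \<mu>(1)]) auto
  then have "(\<integral>x. \<bar>f x\<bar> \<partial>\<mu>) \<le> B * measure \<mu> UNIV"
    using finite_borel_space[OF \<mu>(1)] by (simp add: mult.commute)
  then have "LIP \<pi> * (\<integral>x. \<bar>f x\<bar> \<partial>\<mu>) \<le> LIP \<pi> * (B * measure \<mu> UNIV)"
    by (intro mult_left_mono LIP_nonneg \<pi>)
  then show ?thesis using \<mu>(2) f(1) \<pi> by (auto simp: controls_def intro: order_trans)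
qed

text \<open>With \<open>\<bar>f\<bar> \<le> B\<close>, the terms are dominated by
  \<open>LIP \<pi> * (B * measure (\<nu> k) UNIV)\<close>. This gives absolute convergence and,
  being uniform for bounded Lipschitz constants, lets Tannery's theorem exchange the series with the
  limit in joint continuity.\<close>

lemma controlled_current_suminf:
  assumes S: "\<And>k::nat. controlled_current (S k) (\<nu> k)"
    and sm: "summable (\<lambda>k. measure (\<nu> k) UNIV)"
  shows "controlled_current (\<lambda>f \<pi>. \<Sum>k. S k f \<pi>) (sum_measure \<nu>)"
proof -
  note S' = controlled_currentD[OF S]
  have summ: "summable (\<lambda>k. S k f \<pi>)" if f: "f \<in> Lip_b" and \<pi>: "\<pi> \<in> Lip" for f \<pi>
  proof -
    obtain B where B: "\<And>x. \<bar>f x\<bar> \<le> B" using Lip_b_bound[OF f] by metis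
    show ?thesis
    proof (rule summable_comparison_test')
      show "summable (\<lambda>k. LIP \<pi> * (B * measure (\<nu> k) UNIV))" by (intro summable_mult sm)
      show "norm (S k f \<pi>) \<le> LIP \<pi> * (B * measure (\<nu> k) UNIV)" for k
        using controls_bound[OF S'(4,5) f B \<pi>] by simp
    qed
  qed
  show "controlled_current (\<lambda>f \<pi>. \<Sum>k. S k f \<pi>) (sum_measure \<nu>)"
    unfolding controlled_current_def
  proof (intro conjI)
    show "finite_borel_measure (sum_measure \<nu>)" by (rule finite_borel_measure_sum(1)[OF S'(4) sm])
    show "bilinear_Lip (\<lambda>f \<pi>. \<Sum>k. S k f \<pi>)"
      unfolding bilinear_Lip_def
    proof (intro conjI ballI allI)
      fix f g \<pi> :: "'a \<Rightarrow> real" and a b assume *: "f \<in> Lip_b" "g \<in> Lip_b" "\<pi> \<in> Lip"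
      have "(\<Sum>k. S k (\<lambda>x. a * f x + b * g x) \<pi>) = (\<Sum>k. a * S k f \<pi> + b * S k g \<pi>)"
        using S'(1) * by (simp add: bilinear_Lip_def)
      then show "(\<Sum>k. S k (\<lambda>x. a * f x + b * g x) \<pi>) = a * (\<Sum>k. S k f \<pi>) + b * (\<Sum>k. S k g \<pi>)"
        using summ * by (simp add: suminf_add[symmetric] suminf_mult summable_mult)
    next
      fix f \<pi> \<rho> :: "'a \<Rightarrow> real" and a b assume *: "f \<in> Lip_b" "\<pi> \<in> Lip" "\<rho> \<in> Lip"
      have "(\<Sum>k. S k f (\<lambda>x. a * \<pi> x + b * \<rho> x)) = (\<Sum>k. a * S k f \<pi> + b * S k f \<rho>)"
        using S'(1) * by (simp add: bilinear_Lip_def)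
      then show "(\<Sum>k. S k f (\<lambda>x. a * \<pi> x + b * \<rho> x)) = a * (\<Sum>k. S k f \<pi>) + b * (\<Sum>k. S k f \<rho>)"
        using summ * by (simp add: suminf_add[symmetric] suminf_mult summable_mult)
    qed
    show "local_current (\<lambda>f \<pi>. \<Sum>k. S k f \<pi>)"
      unfolding local_current_def
    proof (intro ballI impI)
      fix f \<pi> :: "'a \<Rightarrow> real"
      assume "f \<in> Lip_b" "\<pi> \<in> Lip" "\<exists>U c. open U \<and> {x. f x \<noteq> 0} \<subseteq> U \<and> (\<forall>x\<in>U. \<pi> x = c)"
      then have "S k f \<pi> = 0" for k using S'(2)[of k] unfolding local_current_def by blast
      then show "(\<Sum>k. S k f \<pi>) = 0" by simp
    qed
    show "jointly_continuous (\<lambda>f \<pi>. \<Sum>k. S k f \<pi>)"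
      unfolding jointly_continuous_def
    proof (intro ballI allI impI)
      fix f \<pi> :: "'a \<Rightarrow> real" and \<pi>s
      assume f: "f \<in> Lip_b" and \<pi>: "\<pi> \<in> Lip" and \<pi>s: "\<forall>n. \<pi>s n \<in> Lip"
        and lim: "\<forall>x. (\<lambda>n. \<pi>s n x) \<longlonglongrightarrow> \<pi> x" and bdd: "bdd_above (range (\<lambda>n. LIP (\<pi>s n)))"
      obtain B where B: "0 \<le> B" "\<And>x. \<bar>f x\<bar> \<le> B" using Lip_b_bound[OF f] by metis
      obtain \<Lambda> where \<Lambda>: "\<And>n. LIP (\<pi>s n) \<le> \<Lambda>" using bdd by (auto simp: bdd_above_def)
      define m where "m k = \<Lambda> * (B * measure (\<nu> k) UNIV)" for k
      have "norm (S k f (\<pi>s n)) \<le> m k" for k n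
      proof -
        have "\<bar>S k f (\<pi>s n)\<bar> \<le> LIP (\<pi>s n) * (B * measure (\<nu> k) UNIV)"
          using \<pi>s by (intro controls_bound[OF S'(4,5) f B(2)]) auto
        also have "\<dots> \<le> m k" unfolding m_def using \<Lambda> B by (intro mult_right_mono) auto
        finally show ?thesis by simp
      qed
      then have bound: "\<forall>\<^sub>F (k, n) in at_top \<times>\<^sub>F sequentially. norm (S k f (\<pi>s n)) \<le> m k"
        by (intro always_eventually) simp
      have sm_m: "summable m" unfolding m_def by (intro summable_mult sm)
      have lim_k: "(\<lambda>n. S k f (\<pi>s n)) \<longlonglongrightarrow> S k f \<pi>" for k
        using S'(3)[of k] f \<pi> \<pi>s lim bdd unfolding jointly_continuous_def by blast
      show "(\<lambda>n. \<Sum>k. S k f (\<pi>s n)) \<longlonglongrightarrow> (\<Sum>k. S k f \<pi>)"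
        using tannerys_theorem[OF lim_k bound sm_m sequentially_bot] by blast
    qed
    show "controls (sum_measure \<nu>) (\<lambda>f \<pi>. \<Sum>k. S k f \<pi>)"
      unfolding controls_def
    proof (intro ballI)
      fix f \<pi> :: "'a \<Rightarrow> real" assume f: "f \<in> Lip_b" and \<pi>: "\<pi> \<in> Lip"
      obtain B where B: "\<And>x. \<bar>f x\<bar> \<le> B" using Lip_b_bound[OF f] by metis
      have "(\<lambda>k. \<integral>x. \<bar>f x\<bar> \<partial>\<nu> k) sums (\<integral>x. \<bar>f x\<bar> \<partial>sum_measure \<nu>)"
        using Lip_borel[OF Lip_b_subset[OF f]] B by (intro integral_sum_measure[OF S'(4) sm]) auto
      then have sums: "(\<lambda>k. LIP \<pi> * (\<integral>x. \<bar>f x\<bar> \<partial>\<nu> k)) sums (LIP \<pi> * (\<integral>x. \<bar>f x\<bar> \<partial>sum_measure \<nu>))"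
        by (rule sums_mult)
      have le: "norm (S k f \<pi>) \<le> LIP \<pi> * (\<integral>x. \<bar>f x\<bar> \<partial>\<nu> k)" for k
        using S'(5)[of k] f \<pi> by (simp add: controls_def)
      have "norm (\<Sum>k. S k f \<pi>) \<le> (\<Sum>k. LIP \<pi> * (\<integral>x. \<bar>f x\<bar> \<partial>\<nu> k))"
        by (rule norm_suminf_le[OF le sums_summable[OF sums]])
      then show "\<bar>\<Sum>k. S k f \<pi>\<bar> \<le> LIP \<pi> * (\<integral>x. \<bar>f x\<bar> \<partial>sum_measure \<nu>)"
        unfolding sums_unique[OF sums, symmetric] by simp
    qed
  qed
qed

lemma controlled_current_scale:
  assumes "controlled_current T \<mu>"
  shows "controlled_current (\<lambda>f \<pi>. c * T f \<pi>) (scale_measure (ennreal \<bar>c\<bar>) \<mu>)"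
proof -
  note T = controlled_currentD[OF assms]
  have fin: "finite_borel_measure (scale_measure (ennreal \<bar>c\<bar>) \<mu>)"
    using T(4) finite_measure.emeasure_finite[of \<mu>]
    by (auto simp: finite_borel_measure_def ennreal_mult_eq_top_iff space_scale_measure intro!: finite_measureI)
  have "controls (scale_measure (ennreal \<bar>c\<bar>) \<mu>) (\<lambda>f \<pi>. c * T f \<pi>)"
    unfolding controls_iff_nn[OF fin]
  proof (intro ballI)
    fix f \<pi> :: "'a \<Rightarrow> real" assume f: "f \<in> Lip_b" and \<pi>: "\<pi> \<in> Lip"
    have "f \<in> borel_measurable \<mu>"
      using Lip_borel[OF Lip_b_subset[OF f]] finite_borel_sets[OF T(4)] by (simp cong: measurable_cong_sets)
    then have "(\<lambda>x. ennreal \<bar>f x\<bar>) \<in> borel_measurable \<mu>" by measurable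
    then have "(\<integral>\<^sup>+x. ennreal \<bar>f x\<bar> \<partial>scale_measure (ennreal \<bar>c\<bar>) \<mu>) = ennreal \<bar>c\<bar> * (\<integral>\<^sup>+x. ennreal \<bar>f x\<bar> \<partial>\<mu>)"
      by (rule nn_integral_scale_measure)
    moreover have "ennreal \<bar>c\<bar> * ennreal \<bar>T f \<pi>\<bar> \<le> ennreal \<bar>c\<bar> * (ennreal (LIP \<pi>) * (\<integral>\<^sup>+x. ennreal \<bar>f x\<bar> \<partial>\<mu>))"
      using T(5) f \<pi> unfolding controls_iff_nn[OF T(4)] by (intro mult_left_mono) auto
    ultimately show "ennreal \<bar>c * T f \<pi>\<bar>
        \<le> ennreal (LIP \<pi>) * (\<integral>\<^sup>+x. ennreal \<bar>f x\<bar> \<partial>scale_measure (ennreal \<bar>c\<bar>) \<mu>)"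
      by (simp add: abs_mult ennreal_mult mult_ac)
  qed
  moreover have "bilinear_Lip (\<lambda>f \<pi>. c * T f \<pi>)"
    using T(1) by (simp add: bilinear_Lip_def algebra_simps)
  moreover have "local_current (\<lambda>f \<pi>. c * T f \<pi>)"
    using T(2) unfolding local_current_def by (metis mult_zero_right)
  moreover have "jointly_continuous (\<lambda>f \<pi>. c * T f \<pi>)"
    unfolding jointly_continuous_def
  proof (intro ballI allI impI)
    fix f \<pi> :: "'a \<Rightarrow> real" and \<pi>s
    assume "f \<in> Lip_b" "\<pi> \<in> Lip" "\<forall>n. \<pi>s n \<in> Lip" "\<forall>x. (\<lambda>n. \<pi>s n x) \<longlonglongrightarrow> \<pi> x"
      "bdd_above (range (\<lambda>n. LIP (\<pi>s n)))"
    then have "(\<lambda>n. T f (\<pi>s n)) \<longlonglongrightarrow> T f \<pi>" using T(3) unfolding jointly_continuous_def by blast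
    then show "(\<lambda>n. c * T f (\<pi>s n)) \<longlonglongrightarrow> c * T f \<pi>" by (rule tendsto_mult_left)
  qed
  ultimately show ?thesis using fin by (simp add: controlled_current_def)
qed

lemma controlled_current_zero: "controlled_current (\<lambda>f \<pi>. 0) (null_measure borel)"
  by (auto simp: controlled_current_def bilinear_Lip_def local_current_def jointly_continuous_def
      controls_def finite_borel_measure_def intro!: finite_measureI)

text \<open>A series with two possibly nonzero terms, so the current axioms need no second
  verification for sums.\<close>

lemma controlled_current_add_scaled:
  assumes T: "controlled_current T \<mu>" and S: "controlled_current S \<nu>"
  shows "\<exists>\<sigma>. controlled_current (\<lambda>f \<pi>. T f \<pi> + c * S f \<pi>) \<sigma> \<and>
    measure \<sigma> UNIV = measure \<mu> UNIV + \<bar>c\<bar> * measure \<nu> UNIV"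
proof -
  define R where "R k = (if k = 0 then T else if k = 1 then (\<lambda>f \<pi>. c * S f \<pi>) else (\<lambda>f \<pi>. 0))" for k :: nat
  define \<rho> where "\<rho> k = (if k = 0 then \<mu> else if k = 1 then scale_measure (ennreal \<bar>c\<bar>) \<nu> else null_measure borel)" for k :: nat
  have R: "controlled_current (R k) (\<rho> k)" for k
    using T controlled_current_scale[OF S, of c] controlled_current_zero
    by (cases "k = 0"; cases "k = 1") (simp_all add: R_def \<rho>_def)
  have "(\<lambda>k. measure (\<rho> k) UNIV) sums (\<Sum>k\<in>{0, 1}. measure (\<rho> k) UNIV)"
    by (rule sums_finite) (auto simp: \<rho>_def)
  then have sums: "(\<lambda>k. measure (\<rho> k) UNIV) sums (measure \<mu> UNIV + \<bar>c\<bar> * measure \<nu> UNIV)"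
    by (simp add: \<rho>_def)
  have "(\<lambda>k. R k f \<pi>) sums (\<Sum>k\<in>{0, 1}. R k f \<pi>)" for f \<pi>
    by (rule sums_finite) (auto simp: R_def)
  then have "(\<Sum>k. R k f \<pi>) = T f \<pi> + c * S f \<pi>" for f \<pi>
    by (simp add: R_def sums_iff)
  then show ?thesis
    using controlled_current_suminf[OF R sums_summable[OF sums]] sums_unique[OF sums]
      finite_borel_measure_sum(2)[OF controlled_currentD(4)[OF R] sums_summable[OF sums]]
    by (intro exI[of _ "sum_measure \<rho>"]) simp
qed

lemma controlled_current_sum:
  assumes "finite I" "\<And>i. i \<in> I \<Longrightarrow> controlled_current (S i) (\<nu> i)"
  shows "\<exists>\<sigma>. controlled_current (\<lambda>f \<pi>. \<Sum>i\<in>I. a i * S i f \<pi>) \<sigma> \<and>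
    measure \<sigma> UNIV = (\<Sum>i\<in>I. \<bar>a i\<bar> * measure (\<nu> i) UNIV)"
  using assms
proof (induction I)
  case empty
  show ?case using controlled_current_zero by (intro exI[of _ "null_measure borel"]) simp
next
  case (insert i I)
  then obtain \<sigma> where "controlled_current (\<lambda>f \<pi>. \<Sum>i\<in>I. a i * S i f \<pi>) \<sigma>"
    "measure \<sigma> UNIV = (\<Sum>i\<in>I. \<bar>a i\<bar> * measure (\<nu> i) UNIV)" by auto
  then show ?case
    using controlled_current_add_scaled[of "\<lambda>f \<pi>. \<Sum>i\<in>I. a i * S i f \<pi>" \<sigma> "S i" "\<nu> i" "a i"] insert
    by (simp add: add.commute)
qed

section \<open>Approximation of functionals by dipoles\<close>

text \<open>The one-dimensional extension step of Hahn--Banach, repeated over the coordinates in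
  \<open>I\<close>, starting from the zero functional.\<close>

lemma finite_Hahn_Banach:
  fixes p :: "('i \<Rightarrow> real) \<Rightarrow> real"
  assumes fin: "finite I"
    and sub: "\<And>u v. p (\<lambda>i. u i + v i) \<le> p u + p v"
    and hom: "\<And>c u. 0 < c \<Longrightarrow> p (\<lambda>i. c * u i) \<le> c * p u"
  shows "\<exists>a. \<forall>u. (\<forall>i. i \<notin> I \<longrightarrow> u i = 0) \<longrightarrow> (\<Sum>i\<in>I. a i * u i) \<le> p u"
  using fin
proof (induction I)
  case empty
  have "p (\<lambda>_. 0) \<le> 2 * p (\<lambda>_. 0)" "2 * p (\<lambda>_. 0) \<ge> p (\<lambda>_. 0)"
    using hom[of 2 "\<lambda>_. 0"] by auto
  then have p0: "0 \<le> p (\<lambda>_. 0)" by simp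
  show ?case
  proof (intro exI allI impI)
    fix u :: "'i \<Rightarrow> real" assume "\<forall>i. i \<notin> {} \<longrightarrow> u i = 0"
    then have "u = (\<lambda>_. 0)" by auto
    then show "(\<Sum>i\<in>{}. undefined i * u i) \<le> p u" using p0 by simp
  qed
next
  case (insert j I)
  then obtain a where a: "\<And>u. (\<forall>i. i \<notin> I \<longrightarrow> u i = 0) \<Longrightarrow> (\<Sum>i\<in>I. a i * u i) \<le> p u" by blast
  define L where "L u = (\<Sum>i\<in>I. a i * u i)" for u
  define V where "V = {u :: 'i \<Rightarrow> real. \<forall>i. i \<notin> I \<longrightarrow> u i = 0}"
  \<comment> \<open>The coefficient of \<open>j\<close> has to lie between all
    \<open>L v - p (v(j := -1))\<close> and all \<open>p (u(j := 1)) - L u\<close>; this is the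
    largest admissible choice.\<close>
  define t where "t = Inf ((\<lambda>u. p (u(j := 1)) - L u) ` V)"
  have jI: "j \<notin> I" and finI: "finite I" using insert by auto
  have L_upd: "L (u(j := s)) = L u" for u s using jI by (auto simp: L_def intro!: sum.cong)
  have L_cmult: "L (\<lambda>i. c * u i) = c * L u" for u c by (simp add: L_def sum_distrib_left mult_ac)
  \<comment> \<open>The entries 1 and -1 at \<open>j\<close> cancel in the sum, which therefore lies
    in \<open>V\<close>, where the inductive bound is available.\<close>
  have key: "L v - p (v(j := -1)) \<le> p (u(j := 1)) - L u" if "u \<in> V" "v \<in> V" for u v
  proof -
    have "L u + L v = (\<Sum>i\<in>I. a i * (u i + v i))"
      by (simp add: L_def sum.distrib distrib_left)
    also have "\<dots> \<le> p (\<lambda>i. u i + v i)" using that by (intro a) (auto simp: V_def)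
    also have "(\<lambda>i. u i + v i) = (\<lambda>i. (u(j := 1)) i + (v(j := -1)) i)" using that jI by (auto simp: V_def)
    also have "p \<dots> \<le> p (u(j := 1)) + p (v(j := -1))" by (rule sub)
    finally show ?thesis by simp
  qed
  have V0: "(\<lambda>_. 0) \<in> V" by (simp add: V_def)
  have t_upper: "t \<le> p (u(j := 1)) - L u" if "u \<in> V" for u
    unfolding t_def using key[OF _ V0] that by (intro cInf_lower) (auto intro!: bdd_belowI)
  have t_lower: "L v - p (v(j := -1)) \<le> t" if "v \<in> V" for v
    unfolding t_def using key that V0 by (intro cInf_greatest) auto
  show ?case
  proof (intro exI allI impI)
    fix w :: "'i \<Rightarrow> real" assume w: "\<forall>i. i \<notin> insert j I \<longrightarrow> w i = 0"
    define u where "u = w(j := 0)"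
    have u: "u \<in> V" using w by (auto simp: u_def V_def)
    have "(\<Sum>i\<in>insert j I. (a(j := t)) i * w i) = t * w j + (\<Sum>i\<in>I. (a(j := t)) i * w i)"
      using jI finI by simp
    also have "(\<Sum>i\<in>I. (a(j := t)) i * w i) = L u"
      unfolding L_def using jI by (intro sum.cong) (auto simp: u_def)
    also have "t * w j + L u \<le> p w"
    proof -
      consider "w j = 0" | "0 < w j" | "w j < 0" by linarith
      then show ?thesis
      proof cases
        case 1
        then have "u = w" by (auto simp: u_def)
        then show ?thesis using a[of u] u 1 by (simp add: L_def V_def)
      next
        case 2
        \<comment> \<open>Dividing by the absolute value of \<open>w j\<close> makes the entry at
          \<open>j\<close> equal to 1, and to -1 in the negative case, where the two bounds on
          \<open>t\<close> apply.\<close>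
        define v where "v = (\<lambda>i. (1 / w j) * u i)"
        have "v \<in> V" using u by (simp add: V_def v_def)
        then have "t + L v \<le> p (v(j := 1))" using t_upper[of v] by simp
        also have "v(j := 1) = (\<lambda>i. (1 / w j) * w i)" using 2 by (auto simp: v_def u_def)
        also have "p \<dots> \<le> (1 / w j) * p w" using 2 by (intro hom) simp
        finally have "t + (1 / w j) * L u \<le> (1 / w j) * p w" unfolding v_def L_cmult .
        then have "w j * (t + (1 / w j) * L u) \<le> w j * ((1 / w j) * p w)"
          using 2 by (intro mult_left_mono) auto
        then show ?thesis using 2 by (simp add: algebra_simps)
      next
        case 3
        define v where "v = (\<lambda>i. (1 / - w j) * u i)"
        have "v \<in> V" using u by (simp add: V_def v_def)
        then have "L v - t \<le> p (v(j := -1))" using t_lower[of v] by simp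
        also have "v(j := -1) = (\<lambda>i. (1 / - w j) * w i)" using 3 by (auto simp: v_def u_def)
        also have "p \<dots> \<le> (1 / - w j) * p w" using 3 by (intro hom) simp
        finally have "(1 / - w j) * L u - t \<le> (1 / - w j) * p w" unfolding v_def L_cmult .
        then have "(- w j) * ((1 / - w j) * L u - t) \<le> (- w j) * ((1 / - w j) * p w)"
          using 3 by (intro mult_left_mono) auto
        then show ?thesis using 3 by (simp add: algebra_simps)
      qed
    qed
    finally show "(\<Sum>i\<in>insert j I. (a(j := t)) i * w i) \<le> p w" .
  qed
qed

text \<open>McShane's formula for the largest extension with constant \<open>l\<close>; over a
  finite set the infimum is attained. It supplies a function whose Lipschitz constant is governed by
  the slopes of \<open>\<pi>\<close> on \<open>A\<close> alone.\<close>

lemma McShane_extension: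
  fixes \<pi> :: "'a::metric_space \<Rightarrow> real"
  assumes A: "finite A" "A \<noteq> {}" and l: "0 \<le> l" "\<And>x y. x \<in> A \<Longrightarrow> y \<in> A \<Longrightarrow> \<pi> x - \<pi> y \<le> l * dist x y"
  shows "\<exists>\<rho>. l-lipschitz_on UNIV \<rho> \<and> (\<forall>x\<in>A. \<rho> x = \<pi> x)"
proof -
  define \<rho> where "\<rho> z = Min ((\<lambda>x. \<pi> x + l * dist z x) ` A)" for z
  have le: "\<rho> z \<le> \<pi> x + l * dist z x" if "x \<in> A" for x z
    unfolding \<rho>_def using A that by (intro Min_le) auto
  have att: "\<exists>x\<in>A. \<rho> z = \<pi> x + l * dist z x" for z
  proof -
    have "\<rho> z \<in> (\<lambda>x. \<pi> x + l * dist z x) ` A" unfolding \<rho>_def using A by (intro Min_in) auto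
    then show ?thesis by blast
  qed
  have le_add: "\<rho> z \<le> \<rho> z' + l * dist z z'" for z z'
  proof -
    obtain x where x: "x \<in> A" "\<rho> z' = \<pi> x + l * dist z' x" using att by blast
    have "\<rho> z \<le> \<pi> x + l * dist z x" by (rule le[OF x(1)])
    also have "\<dots> \<le> \<pi> x + l * (dist z z' + dist z' x)"
      by (intro add_left_mono mult_left_mono dist_triangle l)
    finally show ?thesis using x by (simp add: distrib_left)
  qed
  have "\<bar>\<rho> z - \<rho> z'\<bar> \<le> l * dist z z'" for z z'
    using le_add[of z z'] le_add[of z' z] by (simp add: dist_commute abs_le_iff)
  then have "l-lipschitz_on UNIV \<rho>" using l by (intro lipschitz_onI) (auto simp: dist_real_def)
  moreover have "\<rho> x = \<pi> x" if "x \<in> A" for x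
  proof -
    obtain y where y: "y \<in> A" "\<rho> x = \<pi> y + l * dist x y" using att by blast
    then show ?thesis using le[OF that, of x] l(2)[OF that y(1)] by simp
  qed
  ultimately show ?thesis by blast
qed

definition linear_on_Lip :: "(('a::metric_space \<Rightarrow> real) \<Rightarrow> real) \<Rightarrow> bool" where
  "linear_on_Lip F \<longleftrightarrow>
     (\<forall>\<pi>\<in>Lip. \<forall>\<rho>\<in>Lip. \<forall>a b. F (\<lambda>x. a * \<pi> x + b * \<rho> x) = a * F \<pi> + b * F \<rho>)"

lemma linear_on_LipD:
  "linear_on_Lip F \<Longrightarrow> \<pi> \<in> Lip \<Longrightarrow> \<rho> \<in> Lip \<Longrightarrow> F (\<lambda>x. a * \<pi> x + b * \<rho> x) = a * F \<pi> + b * F \<rho>"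
  unfolding linear_on_Lip_def by blast

text \<open>Finite-dimensional duality: for fields on pairs of points of \<open>A\<close>, the
  largest slope \<open>N\<close> is dual to the transport cost of weights. The sublinear functional
  \<open>p\<close> combines the tolerance \<open>e * LIP \<pi>\<close> with \<open>M + e\<close>
  times the slope of the mismatch, so a single linear minorant yields closeness and the cost bound
  together.\<close>

lemma approximation_by_dipoles:
  fixes F :: "('a::metric_space \<Rightarrow> real) \<Rightarrow> real"
  assumes F: "linear_on_Lip F" and M: "0 \<le> M" "\<forall>\<pi>\<in>Lip. \<bar>F \<pi>\<bar> \<le> M * LIP \<pi>"
    and A: "finite A" "A \<noteq> {}" and e: "0 \<le> e"
    and small: "\<forall>\<pi>\<in>Lip. (\<forall>x\<in>A. \<pi> x = 0) \<longrightarrow> \<bar>F \<pi>\<bar> \<le> e * LIP \<pi>"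
  shows "\<exists>I a. finite I \<and> I \<subseteq> A \<times> A \<and>
    (\<forall>\<pi>\<in>Lip. \<bar>F \<pi> - (\<Sum>z\<in>I. a z * (\<pi> (fst z) - \<pi> (snd z)))\<bar> \<le> e * LIP \<pi>) \<and>
    (\<Sum>z\<in>I. \<bar>a z\<bar> * dist (fst z) (snd z)) \<le> M + e"
proof -
  note M = M(1) M(2)[THEN bspec] and small = small[THEN bspec, THEN mp]
  \<comment> \<open>Diagonal pairs are left out because \<open>N\<close> divides by the
    distance.\<close>
  define I where "I = {z \<in> A \<times> A. fst z \<noteq> snd z}"
  define d :: "'a \<times> 'a \<Rightarrow> real" where "d z = dist (fst z) (snd z)" for z
  \<comment> \<open>Set to 0 off \<open>I\<close>, since the linear minorant is tested only on
    fields supported in \<open>I\<close>.\<close>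
  define D where "D \<pi> z = (if z \<in> I then \<pi> (fst z) - \<pi> (snd z) else 0)" for \<pi> :: "'a \<Rightarrow> real" and z
  \<comment> \<open>The inserted 0 keeps the maximum defined when \<open>I\<close> is empty, as
    happens for a one-point \<open>A\<close>.\<close>
  define N where "N w = Max (insert 0 ((\<lambda>z. \<bar>w z\<bar> / d z) ` I))" for w
  have I: "finite I" "I \<subseteq> A \<times> A" using A by (auto simp: I_def)
  have d: "0 < d z" if "z \<in> I" for z using that by (simp add: I_def d_def)
  have N0: "0 \<le> N w" for w unfolding N_def using I by (intro Max_ge) auto
  have N_upper: "\<bar>w z\<bar> \<le> N w * d z" if "z \<in> I" for w z
  proof -
    have "\<bar>w z\<bar> / d z \<le> N w" unfolding N_def using I that by (intro Max_ge) auto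
    then show ?thesis using d[OF that] by (simp add: field_simps)
  qed
  have N_least: "N w \<le> l" if "0 \<le> l" "\<And>z. z \<in> I \<Longrightarrow> \<bar>w z\<bar> \<le> l * d z" for w l
    unfolding N_def using I that d by (auto simp: field_simps)
  have N_add: "N (\<lambda>z. u z + v z) \<le> N u + N v" for u v
  proof (rule N_least)
    fix z assume z: "z \<in> I"
    show "\<bar>u z + v z\<bar> \<le> (N u + N v) * d z"
      using N_upper[OF z, of u] N_upper[OF z, of v] abs_triangle_ineq[of "u z" "v z"]
      by (simp add: distrib_right)
  qed (use N0 in simp)
  have N_cmult: "N (\<lambda>z. c * u z) \<le> \<bar>c\<bar> * N u" for c u
  proof (rule N_least)
    fix z assume z: "z \<in> I"
    show "\<bar>c * u z\<bar> \<le> \<bar>c\<bar> * N u * d z"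
      using mult_left_mono[OF N_upper[OF z, of u], of "\<bar>c\<bar>"] by (simp add: abs_mult mult.assoc)
  qed (use N0 in simp)
  \<comment> \<open>A linear minorant \<open>a\<close> of the sublinear functional \<open>p\<close> below is the desired weight on dipoles: testing
    it on the difference field \<open>D \<pi>\<close> compares it with \<open>F\<close>, testing it on arbitrary \<open>w\<close> bounds its cost.\<close>
  define J where "J w \<pi> = F \<pi> + e * LIP \<pi> + (M + e) * N (\<lambda>z. w z - D \<pi> z)" for w \<pi>
  define p where "p w = Inf (J w ` Lip)" for w
  \<comment> \<open>The origin of the factor \<open>M + e\<close>. Extending the values of
    \<open>\<pi>\<close> on \<open>A\<close> by McShane with slope \<open>l\<close> gives
    \<open>\<rho>\<close> with \<open>F \<rho> \<ge> - (M * l)\<close>; as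
    \<open>\<pi> - \<rho>\<close> vanishes on \<open>A\<close>, replacing \<open>\<rho>\<close> by
    \<open>\<pi>\<close> changes \<open>F\<close> by at most
    \<open>e * (LIP \<pi> + l)\<close>.\<close>
  have base: "0 \<le> F \<pi> + e * LIP \<pi> + (M + e) * N (D \<pi>)" if \<pi>: "\<pi> \<in> Lip" for \<pi>
  proof -
    define l where "l = N (D \<pi>)"
    have "\<pi> x - \<pi> y \<le> l * dist x y" if "x \<in> A" "y \<in> A" for x y
    proof (cases "x = y")
      case False
      then have "(x, y) \<in> I" using that by (simp add: I_def)
      then show ?thesis using N_upper[of "(x, y)" "D \<pi>"] by (simp add: l_def D_def d_def)
    qed simp
    then obtain \<rho> where \<rho>: "l-lipschitz_on UNIV \<rho>" "\<forall>x\<in>A. \<rho> x = \<pi> x"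
      using McShane_extension[OF A N0, of \<pi>] unfolding l_def by blast
    have \<rho>L: "\<rho> \<in> Lip" using \<rho>(1) by (rule LipI)
    have "M * LIP \<rho> \<le> M * l" by (intro mult_left_mono LIP_le[OF \<rho>(1)] M)
    then have 1: "- (M * l) \<le> F \<rho>" using M(2)[OF \<rho>L] by linarith
    have "\<bar>F (\<lambda>x. 1 * \<pi> x + (-1) * \<rho> x)\<bar> \<le> e * LIP (\<lambda>x. 1 * \<pi> x + (-1) * \<rho> x)"
      using \<rho> by (intro small Lip_add Lip_cmult \<pi> \<rho>L) auto
    also have "\<dots> \<le> e * (LIP \<pi> + l)"
      using LIP_diff_le[OF \<pi> \<rho>L] LIP_le[OF \<rho>(1)] e by (intro mult_left_mono) auto
    finally have "\<bar>F \<pi> - F \<rho>\<bar> \<le> e * LIP \<pi> + e * l"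
      unfolding linear_on_LipD[OF F \<pi> \<rho>L] by (simp add: distrib_left)
    then show ?thesis using 1 unfolding l_def[symmetric] by (simp add: distrib_right)
  qed
  \<comment> \<open>Bounds the competitors for \<open>p w\<close> from below, so that the infimum is
    a genuine one. It writes \<open>D \<pi>\<close> as \<open>w\<close> minus the mismatch.\<close>
  have lower: "- ((M + e) * N w) \<le> J w \<pi>" if \<pi>: "\<pi> \<in> Lip" for w \<pi>
  proof -
    have "N (\<lambda>z. w z + (-1) * (w z - D \<pi> z)) \<le> N w + N (\<lambda>z. w z - D \<pi> z)"
      using N_add[of w "\<lambda>z. (-1) * (w z - D \<pi> z)"] N_cmult[of "-1" "\<lambda>z. w z - D \<pi> z"] by simp
    then have "(M + e) * N (D \<pi>) \<le> (M + e) * (N w + N (\<lambda>z. w z - D \<pi> z))"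
      using M e by (intro mult_left_mono) auto
    then show ?thesis using base[OF \<pi>] by (simp add: J_def distrib_left)
  qed
  have p_le: "p w \<le> J w \<pi>" if "\<pi> \<in> Lip" for w \<pi>
    unfolding p_def using that lower by (intro cInf_lower) (auto intro!: bdd_belowI)
  have p_ge: "b \<le> p w" if "\<And>\<pi>. \<pi> \<in> Lip \<Longrightarrow> b \<le> J w \<pi>" for b w
    unfolding p_def by (rule cInf_greatest) (use that Lip_const in blast)+
  have p_add: "p (\<lambda>z. u z + v z) \<le> p u + p v" for u v
  proof -
    have *: "p (\<lambda>z. u z + v z) \<le> J u \<pi> + J v \<rho>" if \<pi>: "\<pi> \<in> Lip" and \<rho>: "\<rho> \<in> Lip" for \<pi> \<rho>
    proof -
      have eq: "(\<lambda>z. u z + v z - D (\<lambda>x. \<pi> x + \<rho> x) z) = (\<lambda>z. (u z - D \<pi> z) + (v z - D \<rho> z))"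
        by (auto simp: D_def)
      have "p (\<lambda>z. u z + v z) \<le> J (\<lambda>z. u z + v z) (\<lambda>x. \<pi> x + \<rho> x)" by (intro p_le Lip_add \<pi> \<rho>)
      also have "\<dots> \<le> (F \<pi> + F \<rho>) + e * (LIP \<pi> + LIP \<rho>)
          + (M + e) * (N (\<lambda>z. u z - D \<pi> z) + N (\<lambda>z. v z - D \<rho> z))"
        unfolding J_def eq using linear_on_LipD[OF F \<pi> \<rho>, of 1 1] M e
        by (intro add_mono mult_left_mono N_add LIP_add_le \<pi> \<rho>) auto
      also have "\<dots> = J u \<pi> + J v \<rho>" by (simp add: J_def algebra_simps)
      finally show ?thesis .
    qed
    have "p (\<lambda>z. u z + v z) - J v \<rho> \<le> p u" if "\<rho> \<in> Lip" for \<rho>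
      by (rule p_ge) (use *[OF _ that] in \<open>simp add: algebra_simps\<close>)
    then have "p (\<lambda>z. u z + v z) - p u \<le> p v" by (intro p_ge) (simp add: algebra_simps)
    then show ?thesis by simp
  qed
  have p_hom: "p (\<lambda>z. c * u z) \<le> c * p u" if c: "0 < c" for c u
  proof -
    have "p (\<lambda>z. c * u z) / c \<le> p u"
    proof (rule p_ge)
      fix \<pi> :: "'a \<Rightarrow> real" assume \<pi>: "\<pi> \<in> Lip"
      have eq: "(\<lambda>z. c * u z - D (\<lambda>x. c * \<pi> x) z) = (\<lambda>z. c * (u z - D \<pi> z))"
        by (auto simp: D_def algebra_simps)
      have "p (\<lambda>z. c * u z) \<le> J (\<lambda>z. c * u z) (\<lambda>x. c * \<pi> x)" by (intro p_le Lip_cmult \<pi>)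
      also have "\<dots> \<le> c * F \<pi> + e * (\<bar>c\<bar> * LIP \<pi>) + (M + e) * (\<bar>c\<bar> * N (\<lambda>z. u z - D \<pi> z))"
        unfolding J_def eq using linear_on_LipD[OF F \<pi> \<pi>, of c 0] M e
        by (intro add_mono mult_left_mono N_cmult LIP_cmult_le \<pi>) auto
      also have "\<dots> = c * J u \<pi>" using c by (simp add: J_def algebra_simps)
      finally show "p (\<lambda>z. c * u z) / c \<le> J u \<pi>" using c by (simp add: field_simps)
    qed
    then show ?thesis using c by (simp add: field_simps)
  qed
  obtain a where a: "\<And>u. (\<forall>z. z \<notin> I \<longrightarrow> u z = 0) \<Longrightarrow> (\<Sum>z\<in>I. a z * u z) \<le> p u"
    using finite_Hahn_Banach[of I p, OF I(1) p_add p_hom] by blast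
  have upper: "(\<Sum>z\<in>I. a z * (\<pi> (fst z) - \<pi> (snd z))) \<le> F \<pi> + e * LIP \<pi>" if \<pi>: "\<pi> \<in> Lip" for \<pi>
  proof -
    have "(\<Sum>z\<in>I. a z * (\<pi> (fst z) - \<pi> (snd z))) = (\<Sum>z\<in>I. a z * D \<pi> z)"
      by (intro sum.cong) (auto simp: D_def)
    also have "\<dots> \<le> p (D \<pi>)" by (intro a) (auto simp: D_def)
    also have "\<dots> \<le> J (D \<pi>) \<pi>" by (rule p_le[OF \<pi>])
    also have "\<dots> \<le> F \<pi> + e * LIP \<pi> + (M + e) * 0"
      unfolding J_def using M e by (intro add_left_mono mult_left_mono N_least) auto
    finally show ?thesis by simp
  qed
  have "\<bar>F \<pi> - (\<Sum>z\<in>I. a z * (\<pi> (fst z) - \<pi> (snd z)))\<bar> \<le> e * LIP \<pi>" if \<pi>: "\<pi> \<in> Lip" for \<pi>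
  proof -
    let ?\<rho> = "\<lambda>x. (-1) * \<pi> x"
    have "(\<Sum>z\<in>I. a z * (?\<rho> (fst z) - ?\<rho> (snd z))) = - (\<Sum>z\<in>I. a z * (\<pi> (fst z) - \<pi> (snd z)))"
      by (simp add: sum_negf[symmetric] algebra_simps)
    moreover have "F ?\<rho> = - F \<pi>" using linear_on_LipD[OF F \<pi> \<pi>, of "-1" 0] by simp
    moreover have "e * LIP ?\<rho> \<le> e * LIP \<pi>" using LIP_cmult_le[OF \<pi>, of "-1"] e by (intro mult_left_mono) auto
    ultimately show ?thesis using upper[OF \<pi>] upper[OF Lip_cmult[OF \<pi>, of "-1"]] by linarith
  qed
  moreover have "(\<Sum>z\<in>I. \<bar>a z\<bar> * d z) \<le> M + e"
  proof -
    \<comment> \<open>The field of slope at most 1 on which \<open>a\<close> attains its cost; the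
      competitor \<open>\<pi> = 0\<close> shows \<open>p w \<le> M + e\<close>.\<close>
    define w where "w z = (if z \<in> I then sgn (a z) * d z else 0)" for z
    have LIP0: "LIP (\<lambda>_::'a. 0) = 0"
      by (intro antisym LIP_le lipschitz_on_constant LIP_nonneg Lip_const)
    then have "F (\<lambda>_. 0) = 0" using M(2)[of "\<lambda>_. 0"] by simp
    moreover have "D (\<lambda>_. 0) = (\<lambda>_. 0)" by (auto simp: D_def)
    moreover have "N w \<le> 1"
    proof (rule N_least)
      fix z assume z: "z \<in> I"
      show "\<bar>w z\<bar> \<le> 1 * d z" using d[OF z] z by (auto simp: w_def abs_mult sgn_if)
    qed simp
    moreover have "(M + e) * N w \<le> (M + e) * 1" using \<open>N w \<le> 1\<close> M e by (intro mult_left_mono) auto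
    ultimately have "J w (\<lambda>_. 0) \<le> M + e" using LIP0 by (simp add: J_def)
    have "(\<Sum>z\<in>I. \<bar>a z\<bar> * d z) = (\<Sum>z\<in>I. a z * w z)"
      by (intro sum.cong) (auto simp: w_def abs_sgn mult_ac)
    also have "\<dots> \<le> p w" by (intro a) (auto simp: w_def)
    also have "\<dots> \<le> J w (\<lambda>_. 0)" by (rule p_le) simp
    also have "\<dots> \<le> M + e" by fact
    finally show ?thesis .
  qed
  ultimately show ?thesis using I unfolding d_def by (intro exI[of _ I] exI[of _ a]) blast
qed

section \<open>Boundaries and their fillings\<close>

definition finitely_approximable :: "(('a::metric_space \<Rightarrow> real) \<Rightarrow> real) \<Rightarrow> bool" where
  "finitely_approximable F \<longleftrightarrow>
     (\<forall>e>0. \<exists>A. finite A \<and> (\<forall>\<pi>\<in>Lip. (\<forall>x\<in>A. \<pi> x = 0) \<longrightarrow> \<bar>F \<pi>\<bar> \<le> e * LIP \<pi>))"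

text \<open>Locality needs \<open>\<pi>\<close> to vanish on a neighbourhood of \<open>K\<close>; subtracting from \<open>\<pi>\<close> its truncation at
  height \<open>1 / Suc n\<close> achieves this, at the price of the factor 2.\<close>

lemma boundary_bound_vanishing:
  assumes T: "controlled_current T \<mu>" and K: "closed K" and \<pi>: "\<pi> \<in> Lip" and van: "\<forall>x\<in>K. \<pi> x = 0"
  shows "\<bar>T (\<lambda>_. 1) \<pi>\<bar> \<le> 2 * LIP \<pi> * measure \<mu> (-K)"
proof (cases "K = {}")
  \<comment> \<open>\<open>infdist\<close> to the empty set is 0, so the distance cutoff used for
    nonempty \<open>K\<close> would degenerate here.\<close>
  case True
  have "\<bar>T (\<lambda>_. 1) \<pi>\<bar> \<le> LIP \<pi> * (1 * measure \<mu> UNIV)"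
    by (rule controls_bound[OF controlled_currentD(4,5)[OF T]]) (use \<pi> in auto)
  also have "\<dots> \<le> 2 * LIP \<pi> * measure \<mu> (-K)"
    using LIP_nonneg[OF \<pi>] True by (simp add: mult_right_mono)
  finally show ?thesis .
next
  case False
  note T' = controlled_currentD[OF T]
  interpret finite_measure \<mu> using T' by (simp add: finite_borel_measure_def)
  define L where "L = LIP \<pi> + 1"
  have L: "0 < L" using LIP_nonneg[OF \<pi>] by (simp add: L_def)
  define c where "c n = 1 / real (Suc n)" for n
  define \<pi>s where "\<pi>s n x = \<pi> x - max (- c n) (min (c n) (\<pi> x))" for n x
  have c: "0 < c n" for n by (simp add: c_def)
  have "c \<longlonglongrightarrow> 0" unfolding c_def by (rule LIMSEQ_inverse_real_of_nat[unfolded inverse_eq_divide])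
  have clamp: "(LIP \<pi>)-lipschitz_on UNIV (\<lambda>x. max (- c n) (min (c n) (\<pi> x)))" for n
    by (rule lipschitz_on_clamp[OF LIP_lipschitz[OF \<pi>]])
  have lip: "(LIP \<pi> + LIP \<pi>)-lipschitz_on UNIV (\<pi>s n)" for n
    unfolding \<pi>s_def by (rule lipschitz_on_diff[OF LIP_lipschitz[OF \<pi>] clamp])
  have \<pi>sL: "\<pi>s n \<in> Lip" for n by (rule LipI[OF lip])
  have LIPs: "LIP (\<pi>s n) \<le> 2 * LIP \<pi>" for n using LIP_le[OF lip] by simp
  have close: "\<bar>\<pi>s n x - \<pi> x\<bar> \<le> c n" for n x using c[of n] by (auto simp: \<pi>s_def)
  have lim: "(\<lambda>n. \<pi>s n x) \<longlonglongrightarrow> \<pi> x" for x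
  proof (rule LIM_zero_cancel, rule Lim_null_comparison[OF always_eventually \<open>c \<longlonglongrightarrow> 0\<close>])
    show "\<forall>n. norm (\<pi>s n x - \<pi> x) \<le> c n" using close by simp
  qed
  have bound: "\<bar>T (\<lambda>_. 1) (\<pi>s n)\<bar> \<le> 2 * LIP \<pi> * measure \<mu> (-K)" for n
  proof -
    \<comment> \<open>With this slope, \<open>g x < 1\<close> puts \<open>x\<close> within
      \<open>c n / L\<close> of \<open>K\<close>, so \<open>\<bar>\<pi> x\<bar> < c n\<close> and
      \<open>\<pi>s n\<close> vanishes around \<open>x\<close>. Hence locality removes the part
      \<open>1 - g\<close> of the constant 1, and the part \<open>g\<close> is 0 on
      \<open>K\<close>.\<close>
    define k where "k = L / c n"
    have k: "0 < k" using L c by (simp add: k_def)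
    define g where "g x = min 1 (k * infdist x K)" for x
    have gL: "g \<in> Lip" unfolding g_def using Lip_infdist_cutoff[of k K] k by (intro LipI) auto
    have g01: "0 \<le> g x" "g x \<le> 1" for x using k by (auto simp: g_def infdist_nonneg)
    have gK: "g x = 0" if "x \<in> K" for x using that by (simp add: g_def)
    have g: "g \<in> Lip_b" by (rule Lip_bI[OF gL, where B = 1]) (use g01 in simp)
    have g1: "(\<lambda>x. 1 - g x) \<in> Lip_b"
      by (rule Lip_bI[OF Lip_diff[OF Lip_const gL], where B = 1]) (use g01 in simp)
    have "T (\<lambda>x. 1 - g x) (\<pi>s n) = 0"
    proof -
      have "open {x. \<bar>\<pi> x\<bar> < c n}"
        using lipschitz_on_continuous_on[OF LIP_lipschitz[OF \<pi>]]
        by (intro open_Collect_less continuous_intros) auto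
      then show ?thesis
      proof (rule local_currentD[OF T'(2) g1 \<pi>sL])
        show "{x. 1 - g x \<noteq> 0} \<subseteq> {x. \<bar>\<pi> x\<bar> < c n}"
        proof
          fix x assume "x \<in> {x. 1 - g x \<noteq> 0}"
          then have "k * infdist x K < 1" by (auto simp: g_def min_def split: if_splits)
          then have "infdist x K < 1 / k" using k by (simp add: field_simps)
          then obtain y where y: "y \<in> K" "dist x y < 1 / k"
            unfolding infdist_notempty[OF False] using False by (subst (asm) cINF_less_iff) auto
          have "\<bar>\<pi> x - \<pi> y\<bar> \<le> LIP \<pi> * dist x y" by (rule LipD[OF \<pi>])
          also have "\<dots> \<le> L * dist x y" by (simp add: L_def distrib_right)
          also have "\<dots> < L * (1 / k)" using y L by (intro mult_strict_left_mono) auto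
          also have "\<dots> = c n" using L by (simp add: k_def)
          finally show "x \<in> {x. \<bar>\<pi> x\<bar> < c n}" using van y by simp
        qed
        show "\<forall>x\<in>{x. \<bar>\<pi> x\<bar> < c n}. \<pi>s n x = 0" by (auto simp: \<pi>s_def)
      qed
    qed
    moreover have "T (\<lambda>x. g x + (1 - g x)) (\<pi>s n) = T g (\<pi>s n) + T (\<lambda>x. 1 - g x) (\<pi>s n)"
      by (rule bilinear_Lip_add_left[OF T'(1) g g1 \<pi>sL])
    ultimately have "\<bar>T (\<lambda>_. 1) (\<pi>s n)\<bar> = \<bar>T g (\<pi>s n)\<bar>" by simp
    also have "\<dots> \<le> LIP (\<pi>s n) * (\<integral>x. \<bar>g x\<bar> \<partial>\<mu>)" using T'(5) g \<pi>sL by (simp add: controls_def)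
    also have "\<dots> \<le> (2 * LIP \<pi>) * measure \<mu> (-K)"
    proof (intro mult_mono LIPs)
      have "-K \<in> sets \<mu>" using K finite_borel_sets[OF T'(4)] by auto
      then have int: "integrable \<mu> (indicator (-K) :: 'a \<Rightarrow> real)"
        by (intro integrable_real_indicator) (auto simp: less_top[symmetric])
      have "(\<integral>x. \<bar>g x\<bar> \<partial>\<mu>) \<le> (\<integral>x. indicator (-K) x \<partial>\<mu>)"
        using g01 gK by (intro integral_mono integrable_abs Lip_b_integrable[OF T'(4) g] int)
          (auto simp: indicator_def)
      then show "(\<integral>x. \<bar>g x\<bar> \<partial>\<mu>) \<le> measure \<mu> (-K)"
        using finite_borel_space[OF T'(4)] by simp
    qed (use LIP_nonneg[OF \<pi>] in auto)
    finally show ?thesis by simp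
  qed
  have "(\<lambda>n. T (\<lambda>_. 1) (\<pi>s n)) \<longlonglongrightarrow> T (\<lambda>_. 1) \<pi>"
    by (rule jointly_continuousD[OF T'(3) Lip_b_const \<pi> \<pi>sL lim LIPs])
  then have "(\<lambda>n. \<bar>T (\<lambda>_. 1) (\<pi>s n)\<bar>) \<longlonglongrightarrow> \<bar>T (\<lambda>_. 1) \<pi>\<bar>" by (rule tendsto_rabs)
  then show ?thesis by (rule LIMSEQ_le_const2) (use bound in blast)
qed

text \<open>Otherwise finer and finer nets of a large compact \<open>K\<close> carry 1-Lipschitz
  functions that vanish on the net but have boundary value above \<open>e\<close>. Such a function
  is its clamped part, which tends to 0 and is handled by joint continuity, plus a remainder
  vanishing on \<open>K\<close>, which sees only the small mass off \<open>K\<close>.\<close>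

lemma boundary_finitely_approximable:
  assumes T: "controlled_current T \<mu>" and reg: "inner_regular_compact \<mu>"
  shows "finitely_approximable (T (\<lambda>_. 1))"
  unfolding finitely_approximable_def
proof (intro allI impI)
  fix e :: real assume e: "0 < e"
  note T' = controlled_currentD[OF T]
  interpret finite_measure \<mu> using T' by (simp add: finite_borel_measure_def)
  have sp: "space \<mu> = UNIV" by (rule finite_borel_space[OF T'(4)])
  have "emeasure \<mu> UNIV = (SUP K\<in>{K. compact K \<and> K \<subseteq> UNIV}. emeasure \<mu> K)"
    using reg by (simp add: inner_regular_compact_def)
  \<comment> \<open>The remainder has Lipschitz constant at most 2 and the vanishing estimate
    another factor 2, so \<open>e / 8\<close> becomes \<open>e / 2\<close>; with
    \<open>e / 4\<close> from the clamped part this stays below \<open>e\<close>.\<close>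
  then have "\<exists>K\<in>{K. compact K \<and> K \<subseteq> UNIV}. emeasure \<mu> UNIV < emeasure \<mu> K + ennreal (e / 8)"
    using e compact_empty
    by (intro SUP_approx_ennreal[OF _ _ _ emeasure_finite[unfolded infinity_ennreal_def[symmetric]]]) auto
  then obtain K where K: "compact K" "emeasure \<mu> UNIV < emeasure \<mu> K + ennreal (e / 8)" by blast
  have Ks: "K \<in> sets \<mu>" using compact_imp_closed[OF K(1)] finite_borel_sets[OF T'(4)] by simp
  have "ennreal (measure \<mu> UNIV) < ennreal (measure \<mu> K + e / 8)"
    using K(2) e by (simp add: emeasure_eq_measure ennreal_plus)
  then have "measure \<mu> UNIV < measure \<mu> K + e / 8"
    by (simp add: ennreal_less_iff)
  then have mK: "measure \<mu> (-K) \<le> e / 8"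
    using finite_measure_compl[OF Ks] by (simp add: sp Compl_eq_Diff_UNIV)
  have one: "\<exists>A. finite A \<and> (\<forall>\<pi>. 1-lipschitz_on UNIV \<pi> \<longrightarrow> (\<forall>x\<in>A. \<pi> x = 0) \<longrightarrow> \<bar>T (\<lambda>_. 1) \<pi>\<bar> \<le> e)"
  proof (rule ccontr)
    assume "\<not> ?thesis"
    then have no: "\<And>A. finite A \<Longrightarrow> \<exists>\<pi>. 1-lipschitz_on UNIV \<pi> \<and> (\<forall>x\<in>A. \<pi> x = 0) \<and> e < \<bar>T (\<lambda>_. 1) \<pi>\<bar>"
      by (auto simp: not_le)
    define c where "c n = 1 / real (Suc n)" for n
    have c: "0 < c n" for n by (simp add: c_def)
    have clim: "c \<longlonglongrightarrow> 0" unfolding c_def by (rule LIMSEQ_inverse_real_of_nat[unfolded inverse_eq_divide])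
    have "\<forall>n. \<exists>A. finite A \<and> K \<subseteq> (\<Union>x\<in>A. ball x (c n))"
      using K(1) c unfolding compact_eq_totally_bounded by blast
    then obtain A where A: "\<And>n. finite (A n)" "\<And>n. K \<subseteq> (\<Union>x\<in>A n. ball x (c n))" by metis
    have "\<forall>n. \<exists>\<pi>. 1-lipschitz_on UNIV \<pi> \<and> (\<forall>x\<in>A n. \<pi> x = 0) \<and> e < \<bar>T (\<lambda>_. 1) \<pi>\<bar>"
      using no[OF A(1)] by blast
    then obtain \<pi> where \<pi>: "\<And>n. 1-lipschitz_on UNIV (\<pi> n)" "\<And>n x. x \<in> A n \<Longrightarrow> \<pi> n x = 0"
      "\<And>n. e < \<bar>T (\<lambda>_. 1) (\<pi> n)\<bar>" by metis
    define \<psi> where "\<psi> n x = max (- c n) (min (c n) (\<pi> n x))" for n x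
    have \<psi>: "1-lipschitz_on UNIV (\<psi> n)" for n unfolding \<psi>_def by (rule lipschitz_on_clamp[OF \<pi>(1)])
    have L: "\<pi> n \<in> Lip" "\<psi> n \<in> Lip" for n using LipI[OF \<pi>(1)] LipI[OF \<psi>] by auto
    have "\<bar>\<psi> n x\<bar> \<le> c n" for n x using c[of n] by (auto simp: \<psi>_def)
    then have \<psi>lim: "(\<lambda>n. \<psi> n x) \<longlonglongrightarrow> 0" for x
      by (intro Lim_null_comparison[OF always_eventually clim]) simp
    have "(\<lambda>n. T (\<lambda>_. 1) (\<psi> n)) \<longlonglongrightarrow> T (\<lambda>_. 1) (\<lambda>_. 0)"
      by (rule jointly_continuousD[OF T'(3) Lip_b_const Lip_const L(2) \<psi>lim LIP_le[OF \<psi>]])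
    moreover have "T (\<lambda>_. 1) (\<lambda>_. 0) = 0"
      by (rule local_currentD[OF T'(2) Lip_b_const Lip_const open_UNIV]) auto
    ultimately have "(\<lambda>n. \<bar>T (\<lambda>_. 1) (\<psi> n)\<bar>) \<longlonglongrightarrow> 0" by (simp add: tendsto_rabs_zero)
    then have "\<forall>\<^sub>F n in sequentially. \<bar>T (\<lambda>_. 1) (\<psi> n)\<bar> < e / 4"
      using e by (intro order_tendstoD(2)[of _ 0]) auto
    then obtain n where n: "\<bar>T (\<lambda>_. 1) (\<psi> n)\<bar> < e / 4" by (auto simp: eventually_sequentially)
    define \<rho> where "\<rho> x = 1 * \<pi> n x + (-1) * \<psi> n x" for x
    have \<rho>L: "\<rho> \<in> Lip" unfolding \<rho>_def by (intro Lip_add Lip_cmult L)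
    have LIP\<rho>: "LIP \<rho> \<le> 1 + 1"
      unfolding \<rho>_def using lipschitz_on_diff[OF \<pi>(1) \<psi>] by (intro LIP_le) simp
    have van: "\<rho> x = 0" if x: "x \<in> K" for x
    proof -
      obtain y where y: "y \<in> A n" "dist y x < c n" using A(2)[of n] x by auto
      have "\<bar>\<pi> n y - \<pi> n x\<bar> \<le> 1 * dist y x"
        using lipschitz_onD[OF \<pi>(1), of y x n] by (simp add: dist_real_def)
      then have "\<bar>\<pi> n x\<bar> \<le> c n" using y \<pi>(2)[OF y(1)] by simp
      then show ?thesis by (auto simp: \<rho>_def \<psi>_def)
    qed
    have "T (\<lambda>_. 1) \<rho> = 1 * T (\<lambda>_. 1) (\<pi> n) + (-1) * T (\<lambda>_. 1) (\<psi> n)"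
      unfolding \<rho>_def by (rule bilinear_Lip_right[OF T'(1) Lip_b_const L])
    moreover have "\<bar>T (\<lambda>_. 1) \<rho>\<bar> \<le> 2 * LIP \<rho> * measure \<mu> (-K)"
      using van by (intro boundary_bound_vanishing[OF T compact_imp_closed[OF K(1)] \<rho>L]) auto
    moreover have "2 * LIP \<rho> * measure \<mu> (-K) \<le> 2 * (1 + 1) * (e / 8)"
      using LIP\<rho> mK LIP_nonneg[OF \<rho>L] by (intro mult_mono) auto
    ultimately show False using n \<pi>(3)[of n] by simp
  qed
  then obtain A where A: "finite A"
    "\<And>\<pi>. 1-lipschitz_on UNIV \<pi> \<Longrightarrow> \<forall>x\<in>A. \<pi> x = 0 \<Longrightarrow> \<bar>T (\<lambda>_. 1) \<pi>\<bar> \<le> e" by blast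
  have "\<bar>T (\<lambda>_. 1) \<pi>\<bar> \<le> e * LIP \<pi>" if \<pi>: "\<pi> \<in> Lip" "\<forall>x\<in>A. \<pi> x = 0" for \<pi>
  proof (cases "LIP \<pi> = 0")
    case True
    have "\<bar>T (\<lambda>_. 1) \<pi>\<bar> \<le> LIP \<pi> * (1 * measure \<mu> UNIV)"
      by (rule controls_bound[OF T'(4,5) Lip_b_const _ \<pi>(1)]) simp
    then show ?thesis using True by simp
  next
    case False
    then have pos: "0 < LIP \<pi>" using LIP_nonneg[OF \<pi>(1)] by simp
    \<comment> \<open>The zero summand only brings the function into the shape of the linearity
      rule.\<close>
    let ?\<rho> = "\<lambda>x. (1 / LIP \<pi>) * \<pi> x + 0 * \<pi> x"
    have "1-lipschitz_on UNIV ?\<rho>"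
      using lipschitz_on_cmult_real[OF LIP_lipschitz[OF \<pi>(1)], of "1 / LIP \<pi>"] pos by simp
    then have "\<bar>T (\<lambda>_. 1) ?\<rho>\<bar> \<le> e" using \<pi>(2) by (intro A(2)) auto
    also have "T (\<lambda>_. 1) ?\<rho> = (1 / LIP \<pi>) * T (\<lambda>_. 1) \<pi>"
      using bilinear_Lip_right[OF T'(1) Lip_b_const \<pi>(1) \<pi>(1), of 1 "1 / LIP \<pi>" 0] by simp
    finally show ?thesis using pos by (simp add: abs_mult field_simps)
  qed
  with A(1) show "\<exists>A. finite A \<and> (\<forall>\<pi>\<in>Lip. (\<forall>x\<in>A. \<pi> x = 0) \<longrightarrow> \<bar>T (\<lambda>_. 1) \<pi>\<bar> \<le> e * LIP \<pi>)" by blast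
qed

lemma linear_boundary:
  assumes "bilinear_Lip T"
  shows "linear_on_Lip (T (\<lambda>_. 1))"
  using assms unfolding linear_on_Lip_def bilinear_Lip_def by simp

text \<open>Provides the finite measure witnessing normality. \<open>point_measure A\<close> lives
  on the subsets of \<open>A\<close>, hence the push-forward to the Borel sets of the whole
  space.\<close>

lemma point_sum_measure:
  fixes w :: "'a::topological_space \<Rightarrow> real"
  assumes A: "finite A"
  shows "\<exists>\<beta>. finite_borel_measure \<beta> \<and>
    (\<forall>f\<in>borel_measurable borel. (\<integral>x. \<bar>f x :: real\<bar> \<partial>\<beta>) = (\<Sum>x\<in>A. \<bar>w x\<bar> * \<bar>f x\<bar>))"
proof -
  let ?P = "point_measure A (\<lambda>x. ennreal \<bar>w x\<bar>)"
  have id: "(\<lambda>x. x) \<in> measurable ?P borel"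
    by (simp add: measurable_def space_point_measure sets_point_measure)
  have "emeasure (distr ?P borel (\<lambda>x. x)) UNIV = (\<Sum>x\<in>A. ennreal \<bar>w x\<bar>)"
    using A by (subst emeasure_distr[OF id]) (auto simp: space_point_measure emeasure_point_measure_finite)
  then have "finite_borel_measure (distr ?P borel (\<lambda>x. x))"
    by (auto simp: finite_borel_measure_def intro!: finite_measureI)
  moreover have "(\<integral>x. \<bar>f x :: real\<bar> \<partial>distr ?P borel (\<lambda>x. x)) = (\<Sum>x\<in>A. \<bar>w x\<bar> * \<bar>f x\<bar>)"
    if [measurable]: "f \<in> borel_measurable borel" for f
    using A by (subst integral_distr[OF id]) (auto simp: lebesgue_integral_point_measure_finite)
  ultimately show ?thesis by blast
qed

text \<open>Coefficients are collected point by point: those of dipoles starting with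
  \<open>x\<close> minus those of dipoles ending with \<open>x\<close>. In this form the functional
  visibly depends only on the values on \<open>A\<close>.\<close>

lemma sum_dipoles:
  fixes a :: "'a \<times> 'a \<Rightarrow> real"
  assumes I: "finite I" "I \<subseteq> A \<times> A" and A: "finite A"
  shows "\<exists>w. \<forall>\<pi>. (\<Sum>z\<in>I. a z * (\<pi> (fst z) - \<pi> (snd z))) = (\<Sum>x\<in>A. w x * \<pi> x)"
proof (intro exI allI)
  fix \<pi> :: "'a \<Rightarrow> real"
  have "(\<Sum>x\<in>A. (\<Sum>z\<in>{z\<in>I. fst z = x}. a z) * \<pi> x) = (\<Sum>x\<in>A. \<Sum>z\<in>{z\<in>I. fst z = x}. a z * \<pi> (fst z))"
    by (simp add: sum_distrib_right)
  also have "\<dots> = (\<Sum>z\<in>I. a z * \<pi> (fst z))" using I A by (intro sum.group) auto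
  finally have 1: "(\<Sum>x\<in>A. (\<Sum>z\<in>{z\<in>I. fst z = x}. a z) * \<pi> x) = \<dots>" .
  have "(\<Sum>x\<in>A. (\<Sum>z\<in>{z\<in>I. snd z = x}. a z) * \<pi> x) = (\<Sum>x\<in>A. \<Sum>z\<in>{z\<in>I. snd z = x}. a z * \<pi> (snd z))"
    by (simp add: sum_distrib_right)
  also have "\<dots> = (\<Sum>z\<in>I. a z * \<pi> (snd z))" using I A by (intro sum.group) auto
  finally have 2: "(\<Sum>x\<in>A. (\<Sum>z\<in>{z\<in>I. snd z = x}. a z) * \<pi> x) = \<dots>" .
  show "(\<Sum>z\<in>I. a z * (\<pi> (fst z) - \<pi> (snd z)))
      = (\<Sum>x\<in>A. ((\<Sum>z\<in>{z\<in>I. fst z = x}. a z) - (\<Sum>z\<in>{z\<in>I. snd z = x}. a z)) * \<pi> x)"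
    using 1 2 by (simp add: left_diff_distrib right_diff_distrib sum_subtractf)
qed

text \<open>Once the points of \<open>A\<close> are added to the exceptional set, the subtracted
  boundary vanishes on all test functions in question. The residual thus admits another filling
  step.\<close>

lemma boundary_residual:
  fixes F :: "('a::metric_space \<Rightarrow> real) \<Rightarrow> real"
  assumes F: "linear_on_Lip F" "finitely_approximable F" and S: "controlled_current S \<nu>"
    and A: "finite A" "\<forall>\<pi>\<in>Lip. S (\<lambda>_. 1) \<pi> = (\<Sum>x\<in>A. w x * \<pi> x)"
  shows "linear_on_Lip (\<lambda>\<pi>. F \<pi> - S (\<lambda>_. 1) \<pi>)" "finitely_approximable (\<lambda>\<pi>. F \<pi> - S (\<lambda>_. 1) \<pi>)"
proof -
  have "linear_on_Lip (S (\<lambda>_. 1))" by (rule linear_boundary[OF controlled_currentD(1)[OF S]])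
  then show "linear_on_Lip (\<lambda>\<pi>. F \<pi> - S (\<lambda>_. 1) \<pi>)"
    using F(1) unfolding linear_on_Lip_def by (simp add: algebra_simps)
  show "finitely_approximable (\<lambda>\<pi>. F \<pi> - S (\<lambda>_. 1) \<pi>)"
    unfolding finitely_approximable_def
  proof (intro allI impI)
    fix e :: real assume "0 < e"
    then obtain B where B: "finite B" "\<forall>\<pi>\<in>Lip. (\<forall>x\<in>B. \<pi> x = 0) \<longrightarrow> \<bar>F \<pi>\<bar> \<le> e * LIP \<pi>"
      using F(2)[unfolded finitely_approximable_def, THEN spec, THEN mp] by metis
    show "\<exists>A. finite A \<and> (\<forall>\<pi>\<in>Lip. (\<forall>x\<in>A. \<pi> x = 0) \<longrightarrow> \<bar>F \<pi> - S (\<lambda>_. 1) \<pi>\<bar> \<le> e * LIP \<pi>)"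
    proof (intro exI[of _ "A \<union> B"] conjI ballI impI)
      show "finite (A \<union> B)" using A(1) B(1) by simp
      fix \<pi> :: "'a \<Rightarrow> real" assume \<pi>: "\<pi> \<in> Lip" and van: "\<forall>x\<in>A \<union> B. \<pi> x = 0"
      have "S (\<lambda>_. 1) \<pi> = (\<Sum>x\<in>A. w x * \<pi> x)" using A(2) \<pi> by (rule bspec)
      also have "\<dots> = 0" using van by simp
      finally show "\<bar>F \<pi> - S (\<lambda>_. 1) \<pi>\<bar> \<le> e * LIP \<pi>" using B(2) \<pi> van by simp
    qed
  qed
qed

section \<open>Filling functionals by curves\<close>

context
  fixes C :: real
  assumes C: "1 \<le> C"
    and curves: "\<forall>x y :: 'a::metric_space. \<exists>\<gamma>. 1-lipschitz_on UNIV \<gamma> \<and> \<gamma> 0 = x \<and> \<gamma> (C * dist x y) = y"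
begin

text \<open>Each dipole is replaced by a curve whose controlling mass is \<open>C\<close> times its
  distance, so the cost bound \<open>M + e\<close> becomes a mass bound.\<close>

lemma approximate_filling:
  fixes F :: "('a \<Rightarrow> real) \<Rightarrow> real"
  assumes F: "linear_on_Lip F" "finitely_approximable F"
    and M: "0 \<le> M" "\<forall>\<pi>\<in>Lip. \<bar>F \<pi>\<bar> \<le> M * LIP \<pi>" and e: "0 < e"
  shows "\<exists>S \<nu> A w. controlled_current S \<nu> \<and> measure \<nu> UNIV \<le> C * (M + e) \<and> finite A \<and>
    (\<forall>\<pi>\<in>Lip. \<bar>F \<pi> - S (\<lambda>_. 1) \<pi>\<bar> \<le> e * LIP \<pi>) \<and>
    (\<forall>\<pi>\<in>Lip. S (\<lambda>_. 1) \<pi> = (\<Sum>x\<in>A. w x * \<pi> x))"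
proof -
  obtain A0 where A0: "finite A0" "\<forall>\<pi>\<in>Lip. (\<forall>x\<in>A0. \<pi> x = 0) \<longrightarrow> \<bar>F \<pi>\<bar> \<le> e * LIP \<pi>"
    using F(2)[unfolded finitely_approximable_def, THEN spec, THEN mp, OF e] by blast
  \<comment> \<open>The extra point makes the set nonempty, as McShane extension requires; enlarging
    the set leaves fewer test functions to consider.\<close>
  define A where "A = insert undefined A0"
  have A: "finite A" "A \<noteq> {}" using A0 by (auto simp: A_def)
  have small: "\<forall>\<pi>\<in>Lip. (\<forall>x\<in>A. \<pi> x = 0) \<longrightarrow> \<bar>F \<pi>\<bar> \<le> e * LIP \<pi>"
    using A0(2) by (simp add: A_def)
  obtain I a where I: "finite I" "I \<subseteq> A \<times> A"
    and app: "\<forall>\<pi>\<in>Lip. \<bar>F \<pi> - (\<Sum>z\<in>I. a z * (\<pi> (fst z) - \<pi> (snd z)))\<bar> \<le> e * LIP \<pi>"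
    and cost: "(\<Sum>z\<in>I. \<bar>a z\<bar> * dist (fst z) (snd z)) \<le> M + e"
    using approximation_by_dipoles[OF F(1) M A less_imp_le[OF e] small] by blast
  \<comment> \<open>The curve runs from \<open>snd z\<close> to \<open>fst z\<close>, so that its
    boundary has the sign of the dipole.\<close>
  have "\<forall>z :: 'a \<times> 'a. \<exists>\<gamma>. 1-lipschitz_on UNIV \<gamma> \<and> \<gamma> 0 = snd z \<and> \<gamma> (C * dist (snd z) (fst z)) = fst z"
    using curves by blast
  then obtain \<gamma> where \<gamma>: "\<And>z :: 'a \<times> 'a. 1-lipschitz_on UNIV (\<gamma> z)" "\<And>z. \<gamma> z 0 = snd z"
    "\<And>z. \<gamma> z (C * dist (snd z) (fst z)) = fst z" by metis
  define l where "l z = C * dist (snd z) (fst z)" for z :: "'a \<times> 'a"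
  have l: "0 \<le> l z" for z using C by (simp add: l_def)
  have cc: "controlled_current (curve_current (\<gamma> z) (l z)) (curve_measure (\<gamma> z) (l z))" for z
    unfolding controlled_current_def
    by (intro conjI curve_current_bilinear[OF \<gamma>(1) l] curve_current_local[OF \<gamma>(1) l]
        curve_current_jointly_continuous[OF \<gamma>(1) l] curve_measure_finite_borel[OF \<gamma>(1) l]
        curve_current_controls[OF \<gamma>(1) l])
  obtain \<nu> where \<nu>: "controlled_current (\<lambda>f \<pi>. \<Sum>z\<in>I. a z * curve_current (\<gamma> z) (l z) f \<pi>) \<nu>"
    and m\<nu>: "measure \<nu> UNIV = (\<Sum>z\<in>I. \<bar>a z\<bar> * measure (curve_measure (\<gamma> z) (l z)) UNIV)"
    using controlled_current_sum[of I "\<lambda>z. curve_current (\<gamma> z) (l z)"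
      "\<lambda>z. curve_measure (\<gamma> z) (l z)" a, OF I(1) cc] by blast
  have "measure \<nu> UNIV = C * (\<Sum>z\<in>I. \<bar>a z\<bar> * dist (fst z) (snd z))"
    unfolding m\<nu> measure_curve_measure[OF \<gamma>(1) l]
    by (simp add: l_def sum_distrib_left mult_ac dist_commute)
  also have "\<dots> \<le> C * (M + e)" using C cost by (intro mult_left_mono) auto
  finally have mass: "measure \<nu> UNIV \<le> C * (M + e)" .
  have bd: "(\<Sum>z\<in>I. a z * curve_current (\<gamma> z) (l z) (\<lambda>_. 1) \<pi>) = (\<Sum>z\<in>I. a z * (\<pi> (fst z) - \<pi> (snd z)))"
    if "\<pi> \<in> Lip" for \<pi>
    using curve_current_one[OF \<gamma>(1) l that] \<gamma>(2,3) by (simp add: l_def)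
  obtain w where "\<And>\<pi>. (\<Sum>z\<in>I. a z * (\<pi> (fst z) - \<pi> (snd z))) = (\<Sum>x\<in>A. w x * \<pi> x)"
    using sum_dipoles[OF I A(1)] by blast
  then show ?thesis
    using \<nu> mass A(1) app bd
    by (intro exI[of _ "\<lambda>f \<pi>. \<Sum>z\<in>I. a z * curve_current (\<gamma> z) (l z) f \<pi>"] exI[of _ \<nu>] exI[of _ A] exI[of _ w]) simp
qed

text \<open>Each stage fills the residual up to half its norm bound. The increments are boundaries
  of currents with summable masses and telescope to \<open>F\<close>, since the residuals tend to 0
  on every Lipschitz function.\<close>

lemma exact_filling:
  fixes F :: "('a \<Rightarrow> real) \<Rightarrow> real"
  assumes F: "linear_on_Lip F" "finitely_approximable F"
    and d: "0 < d" "\<forall>\<pi>\<in>Lip. \<bar>F \<pi>\<bar> \<le> d * LIP \<pi>"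
  shows "\<exists>R \<nu>. controlled_current R \<nu> \<and> measure \<nu> UNIV \<le> 3 * C * d \<and> (\<forall>\<pi>\<in>Lip. R (\<lambda>_. 1) \<pi> = F \<pi>)"
proof -
  \<comment> \<open>The clause for \<open>n = 0\<close> pins the sequence to start at
    \<open>F\<close>, as dependent choice only yields some first element.\<close>
  define P where "P n G \<longleftrightarrow> (n = 0 \<longrightarrow> G = F) \<and> linear_on_Lip G \<and> finitely_approximable G \<and>
    (\<forall>\<pi>\<in>Lip. \<bar>G \<pi>\<bar> \<le> d * (1 / 2) ^ n * LIP \<pi>)" for n :: nat and G
  define Q where "Q n G G' \<longleftrightarrow> (\<exists>S \<nu>. controlled_current S \<nu> \<and> measure \<nu> UNIV \<le> 3 / 2 * C * d * (1 / 2) ^ n \<and>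
    (\<forall>\<pi>\<in>Lip. G \<pi> - G' \<pi> = S (\<lambda>_. 1) \<pi>))" for n :: nat and G G' :: "('a \<Rightarrow> real) \<Rightarrow> real"
  have "\<exists>G. \<forall>n. P n (G n) \<and> Q n (G n) (G (Suc n))"
  proof (rule dependent_nat_choice[of P Q])
    have "\<forall>\<pi>\<in>Lip. \<bar>F \<pi>\<bar> \<le> d * (1 / 2) ^ 0 * LIP \<pi>" using d(2) by simp
    then have "P 0 F" unfolding P_def using F by blast
    then show "\<exists>G. P 0 G" by (rule exI[of _ F])
    fix G n assume "P n G"
    then have G: "linear_on_Lip G" "finitely_approximable G"
      "\<forall>\<pi>\<in>Lip. \<bar>G \<pi>\<bar> \<le> d * (1 / 2) ^ n * LIP \<pi>" unfolding P_def by blast+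
    have pos: "0 \<le> d * (1 / 2) ^ n" "0 < d * (1 / 2) ^ Suc n" using d by auto
    obtain S \<nu> A w where S: "controlled_current S \<nu>"
      and m: "measure \<nu> UNIV \<le> C * (d * (1 / 2) ^ n + d * (1 / 2) ^ Suc n)" and A: "finite A"
      and app: "\<forall>\<pi>\<in>Lip. \<bar>G \<pi> - S (\<lambda>_. 1) \<pi>\<bar> \<le> d * (1 / 2) ^ Suc n * LIP \<pi>"
      and w: "\<forall>\<pi>\<in>Lip. S (\<lambda>_. 1) \<pi> = (\<Sum>x\<in>A. w x * \<pi> x)"
      using approximate_filling[OF G(1,2) pos(1) G(3) pos(2)] by blast
    have "C * (d * (1 / 2) ^ n + d * (1 / 2) ^ Suc n) = 3 / 2 * C * d * (1 / 2) ^ n"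
      by (simp add: algebra_simps)
    then have "Q n G (\<lambda>\<pi>. G \<pi> - S (\<lambda>_. 1) \<pi>)"
      unfolding Q_def using S m by (intro exI[of _ S] exI[of _ \<nu>]) simp
    moreover have "P (Suc n) (\<lambda>\<pi>. G \<pi> - S (\<lambda>_. 1) \<pi>)"
      using boundary_residual[of G S \<nu> A w, OF G(1,2) S A w] app by (simp add: P_def)
    ultimately show "\<exists>G'. P (Suc n) G' \<and> Q n G G'" by blast
  qed
  then obtain G where P: "\<And>n. P n (G n)" and Q: "\<And>n. Q n (G n) (G (Suc n))" by blast
  have "\<forall>n. \<exists>S \<nu>. controlled_current S \<nu> \<and> measure \<nu> UNIV \<le> 3 / 2 * C * d * (1 / 2) ^ n \<and>
    (\<forall>\<pi>\<in>Lip. G n \<pi> - G (Suc n) \<pi> = S (\<lambda>_. 1) \<pi>)" using Q by (simp add: Q_def)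
  then obtain S \<nu> where S: "\<And>n. controlled_current (S n) (\<nu> n)"
    and m: "\<And>n. measure (\<nu> n) UNIV \<le> 3 / 2 * C * d * (1 / 2) ^ n"
    and step: "\<And>n \<pi>. \<pi> \<in> Lip \<Longrightarrow> S n (\<lambda>_. 1) \<pi> = G n \<pi> - G (Suc n) \<pi>" by metis
  have geo: "(\<lambda>n. 3 / 2 * C * d * (1 / 2) ^ n) sums (3 / 2 * C * d * (1 / (1 - 1 / 2)))"
    by (intro sums_mult geometric_sums) simp
  have sm: "summable (\<lambda>n. measure (\<nu> n) UNIV)"
    by (rule summable_comparison_test'[OF sums_summable[OF geo]]) (use m in simp)
  have "measure (sum_measure \<nu>) UNIV = (\<Sum>n. measure (\<nu> n) UNIV)"
    by (rule finite_borel_measure_sum(2)[OF controlled_currentD(4)[OF S] sm])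
  also have "\<dots> \<le> (\<Sum>n. 3 / 2 * C * d * (1 / 2) ^ n)" by (rule suminf_le[OF m sm sums_summable[OF geo]])
  also have "\<dots> = 3 * C * d" using sums_unique[OF geo] by simp
  finally have mass: "measure (sum_measure \<nu>) UNIV \<le> 3 * C * d" .
  have "(\<Sum>n. S n (\<lambda>_. 1) \<pi>) = F \<pi>" if \<pi>: "\<pi> \<in> Lip" for \<pi>
  proof -
    have "(\<lambda>n. d * (1 / 2) ^ n * LIP \<pi>) \<longlonglongrightarrow> d * 0 * LIP \<pi>" by (intro tendsto_intros) auto
    then have z: "(\<lambda>n. d * (1 / 2) ^ n * LIP \<pi>) \<longlonglongrightarrow> 0" by simp
    have "\<bar>G n \<pi>\<bar> \<le> d * (1 / 2) ^ n * LIP \<pi>" for n using P[of n] \<pi> by (simp add: P_def)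
    then have "(\<lambda>n. G n \<pi>) \<longlonglongrightarrow> 0"
      by (intro Lim_null_comparison[OF always_eventually z]) (simp only: real_norm_def simp_thms)
    then have "(\<lambda>n. G n \<pi> - G (Suc n) \<pi>) sums (G 0 \<pi> - 0)" by (rule telescope_sums')
    moreover have "G 0 = F" using P[of 0] by (simp add: P_def)
    ultimately show ?thesis using step[OF \<pi>] by (simp add: sums_iff)
  qed
  then show ?thesis using controlled_current_suminf[OF S sm] mass by blast
qed

end

theorem theorem1p3:
  fixes T :: "('a::complete_space \<Rightarrow> real) \<Rightarrow> ('a \<Rightarrow> real) \<Rightarrow> real"
  assumes "quasiconvex (UNIV :: 'a set)"
    and "metric_current1 T"
    and "inner_regular_compact (mass_measure T)"
  shows "\<exists>Ti :: nat \<Rightarrow> ('a \<Rightarrow> real) \<Rightarrow> ('a \<Rightarrow> real) \<Rightarrow> real.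
           (\<forall>i. normal_current1 (Ti i)) \<and>
           (\<lambda>i. mass (\<lambda>f \<pi>. T f \<pi> - Ti i f \<pi>)) \<longlonglongrightarrow> 0"
proof -
  obtain C where C: "1 \<le> C"
    "\<forall>x y :: 'a. \<exists>\<gamma>. 1-lipschitz_on UNIV \<gamma> \<and> \<gamma> 0 = x \<and> \<gamma> (C * dist x y) = y"
    using quasiconvex_lipschitz_curves[OF assms(1)] by blast
  obtain \<mu>0 where \<mu>0: "controlled_current T \<mu>0" using assms(2) by (auto simp: metric_current1_iff)
  note T0 = controlled_currentD[OF \<mu>0]
  \<comment> \<open>The mass measure serves as controlling measure because inner regularity is
    assumed for it.\<close>
  define \<mu> where "\<mu> = mass_measure T"
  have T: "controlled_current T \<mu>"
    using T0 mass_measure_finite_borel[OF T0(1,4,5)] mass_measure_controls[OF T0(1,4,5)]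
    by (simp add: controlled_current_def \<mu>_def)
  note T' = controlled_currentD[OF T]
  have lin: "linear_on_Lip (T (\<lambda>_. 1))" by (rule linear_boundary[OF T'(1)])
  have app: "finitely_approximable (T (\<lambda>_. 1))"
    using boundary_finitely_approximable[OF T] assms(3) by (simp add: \<mu>_def)
  have bound: "\<forall>\<pi>\<in>Lip. \<bar>T (\<lambda>_. 1) \<pi>\<bar> \<le> measure \<mu> UNIV * LIP \<pi>"
    using controls_bound[OF T'(4,5) Lip_b_const, of 1 1] by (simp add: mult.commute)
  have ex: "\<exists>N. normal_current1 N \<and> mass (\<lambda>f \<pi>. T f \<pi> - N f \<pi>) \<le> ennreal (3 * C * d)" if d: "0 < d" for d
  proof -
    \<comment> \<open>\<open>S\<close> supplies a reference boundary of finite support within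
      \<open>d\<close> of that of \<open>T\<close>. What gets subtracted from \<open>T\<close> is
      the filling \<open>R\<close> of the difference, whose mass is proportional to
      \<open>d\<close>, while the mass of \<open>S\<close> is governed by that of
      \<open>T\<close>.\<close>
    obtain S \<nu> A w where S: "controlled_current S \<nu>" and A: "finite A"
      and close: "\<forall>\<pi>\<in>Lip. \<bar>T (\<lambda>_. 1) \<pi> - S (\<lambda>_. 1) \<pi>\<bar> \<le> d * LIP \<pi>"
      and w: "\<forall>\<pi>\<in>Lip. S (\<lambda>_. 1) \<pi> = (\<Sum>x\<in>A. w x * \<pi> x)"
      using approximate_filling[OF C lin app measure_nonneg bound d] by blast
    note res = boundary_residual[of "T (\<lambda>_. 1)" S \<nu> A w, OF lin app S A w]
    obtain R \<rho> where R: "controlled_current R \<rho>" and m: "measure \<rho> UNIV \<le> 3 * C * d"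
      and RF: "\<forall>\<pi>\<in>Lip. R (\<lambda>_. 1) \<pi> = T (\<lambda>_. 1) \<pi> - S (\<lambda>_. 1) \<pi>"
      using exact_filling[OF C res d close] by blast
    define N where "N f \<pi> = T f \<pi> + (-1) * R f \<pi>" for f \<pi>
    obtain \<sigma> where "controlled_current N \<sigma>"
      using controlled_current_add_scaled[OF T R, of "-1"] unfolding N_def by blast
    then have "metric_current1 N" by (auto simp: metric_current1_iff)
    moreover obtain \<beta> where \<beta>: "finite_borel_measure \<beta>"
      "\<forall>f\<in>borel_measurable borel. (\<integral>x. \<bar>f x :: real\<bar> \<partial>\<beta>) = (\<Sum>x\<in>A. \<bar>w x\<bar> * \<bar>f x\<bar>)"
      using point_sum_measure[OF A] by blast
    have "\<bar>boundary N f\<bar> \<le> (\<integral>x. \<bar>f x\<bar> \<partial>\<beta>)" if "f \<in> Lip_b" for f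
    proof -
      have f: "f \<in> Lip" using that by (rule Lip_b_subset)
      have "boundary N f = (\<Sum>x\<in>A. w x * f x)" using RF w f by (simp add: boundary_def N_def)
      also have "\<bar>\<dots>\<bar> \<le> (\<Sum>x\<in>A. \<bar>w x\<bar> * \<bar>f x\<bar>)" using sum_abs[of "\<lambda>x. w x * f x" A] by (simp add: abs_mult)
      also have "\<dots> = (\<integral>x. \<bar>f x\<bar> \<partial>\<beta>)" using \<beta>(2) Lip_borel[OF f] by simp
      finally show ?thesis .
    qed
    ultimately have "normal_current1 N" using \<beta>(1) unfolding normal_current1_def by blast
    moreover have "(\<lambda>f \<pi>. T f \<pi> - N f \<pi>) = R" by (simp add: N_def)
    moreover have "mass R \<le> ennreal (3 * C * d)"
      using mass_le[OF controlled_currentD(1,4,5)[OF R]] ennreal_leI[OF m] by (rule order_trans)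
    ultimately show ?thesis by auto
  qed
  have "\<forall>i. \<exists>N. normal_current1 N \<and> mass (\<lambda>f \<pi>. T f \<pi> - N f \<pi>) \<le> ennreal (3 * C * (1 / real (Suc i)))"
    by (intro allI ex) simp
  then obtain Ti where Ti: "\<And>i. normal_current1 (Ti i)"
    "\<And>i. mass (\<lambda>f \<pi>. T f \<pi> - Ti i f \<pi>) \<le> ennreal (3 * C * (1 / real (Suc i)))" by metis
  have "(\<lambda>i. 3 * C * (1 / real (Suc i))) \<longlonglongrightarrow> 3 * C * 0"
    by (intro tendsto_intros LIMSEQ_inverse_real_of_nat[unfolded inverse_eq_divide])
  then have "(\<lambda>i. ennreal (3 * C * (1 / real (Suc i)))) \<longlonglongrightarrow> ennreal (3 * C * 0)" by (rule tendsto_ennrealI)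
  then have lim: "(\<lambda>i. ennreal (3 * C * (1 / real (Suc i)))) \<longlonglongrightarrow> 0"
    by (simp only: mult_zero_right ennreal_0)
  have "(\<lambda>i. mass (\<lambda>f \<pi>. T f \<pi> - Ti i f \<pi>)) \<longlonglongrightarrow> 0"
  proof (rule tendsto_sandwich[OF _ _ tendsto_const lim])
    show "\<forall>\<^sub>F i in sequentially. 0 \<le> mass (\<lambda>f \<pi>. T f \<pi> - Ti i f \<pi>)" by simp
    show "\<forall>\<^sub>F i in sequentially. mass (\<lambda>f \<pi>. T f \<pi> - Ti i f \<pi>) \<le> ennreal (3 * C * (1 / real (Suc i)))"
      by (intro always_eventually allI Ti(2))
  qed
  with Ti(1) show ?thesis by blast
qed

end
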